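(* $\Psi\in\mathrm{MAVal}_k(\mathbb{R}^n)$ is $\mathrm{GL}(n,\mathbb{R})$-equivariant with weight $q\in \mathbb{R}$ if and only if \begin{itemize} \item $k=0$, $q=-1$ and $\Psi$ is a multiple of the Lebesgue measure, or \item $k=n$, $q=1$ and $\Psi$ is a multiple of the real Monge-Amp\`ere operator. \end{itemize}
   Context: $\mathrm{MAVal}_k(\mathbb{R}^n)$ is the space of continuous valuations $\Psi:\mathrm{Conv}(\mathbb{R}^n,\mathbb{R})\to\mathcal{M}(\mathbb{R}^n)$ (finite-valued convex functions with locally uniform convergence, complex Radon measures with weak*-topology) that are dually epi-translation invariant, locally determined, translation equivariant and $k$-homogeneous. $\mathrm{GL}(n,\mathbb{R})$ acts by $[g\cdot\Psi](f)[B]=\Psi(f\circ g)[g^{-1}B]$, and $\Psi$ is $\mathrm{GL}(n,\mathbb{R})$-equivariant with weight $q$ if $g\cdot\Psi=|\det(g)|^q\Psi$ for all $g\in\mathrm{GL}(n,\mathbb{R})$.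
   Formalization: Ψ is assumed not identically zero, because Ψ=0 belongs to every MAVal_k and is GL(n,R)-equivariant with every weight q, so the equivalence fails for it. *)

theory Defs
  imports "HOL-Analysis.Analysis"
begin

definition tsupp :: "(real^'n::finite \<Rightarrow> complex) \<Rightarrow> (real^'n) set" where
  "tsupp \<phi> = closure {x. \<phi> x \<noteq> 0}"

definition Cc :: "(real^'n::finite \<Rightarrow> complex) \<Rightarrow> bool" where
  "Cc \<phi> \<longleftrightarrow> continuous_on UNIV \<phi> \<and> compact (tsupp \<phi>)"

text \<open>Complex Radon measures on R^n, viewed (Riesz / Bourbaki) as continuous linear
  functionals on C_c(R^n): linear, and bounded by C_K times the sup norm on test
  functions supported in a compact set K.\<close>
definition radon_functional :: "((real^'n::finite \<Rightarrow> complex) \<Rightarrow> complex) \<Rightarrow> bool" where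
  "radon_functional L \<longleftrightarrow>
     (\<forall>\<phi> \<psi>. Cc \<phi> \<longrightarrow> Cc \<psi> \<longrightarrow> L (\<lambda>x. \<phi> x + \<psi> x) = L \<phi> + L \<psi>) \<and>
     (\<forall>c \<phi>. Cc \<phi> \<longrightarrow> L (\<lambda>x. c * \<phi> x) = c * L \<phi>) \<and>
     (\<forall>K. compact K \<longrightarrow> (\<exists>C. \<forall>\<phi>. Cc \<phi> \<longrightarrow> tsupp \<phi> \<subseteq> K \<longrightarrow>
          norm (L \<phi>) \<le> C * (SUP x. norm (\<phi> x))))"

definition Conv :: "(real^'n::finite \<Rightarrow> real) set" where
  "Conv = {f. convex_on UNIV f}"

definition loc_unif_conv :: "(nat \<Rightarrow> real^'n::finite \<Rightarrow> real) \<Rightarrow> (real^'n \<Rightarrow> real) \<Rightarrow> bool" where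
  "loc_unif_conv fs f \<longleftrightarrow>
     (\<forall>K. compact K \<longrightarrow> (\<forall>e>0. eventually (\<lambda>j. \<forall>x\<in>K. \<bar>fs j x - f x\<bar> < e) sequentially))"

type_synonym 'n mval = "(real^'n \<Rightarrow> real) \<Rightarrow> (real^'n \<Rightarrow> complex) \<Rightarrow> complex"

text \<open>The measure Psi(f) is represented by the functional phi |-> integral of phi w.r.t. Psi(f).
  Pushing forward along a map T corresponds to phi |-> Psi(f)(phi o T).\<close>

definition is_mval :: "'n::finite mval \<Rightarrow> bool" where
  "is_mval \<Psi> \<longleftrightarrow> (\<forall>f\<in>Conv. radon_functional (\<Psi> f))"

definition mval_valuation :: "'n::finite mval \<Rightarrow> bool" where
  "mval_valuation \<Psi> \<longleftrightarrow>
     (\<forall>f\<in>Conv. \<forall>h\<in>Conv. (\<lambda>x. min (f x) (h x)) \<in> Conv \<longrightarrow>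
        (\<forall>\<phi>. Cc \<phi> \<longrightarrow>
          \<Psi> (\<lambda>x. max (f x) (h x)) \<phi> + \<Psi> (\<lambda>x. min (f x) (h x)) \<phi> = \<Psi> f \<phi> + \<Psi> h \<phi>))"

text \<open>Continuity (Conv with locally uniform convergence is metrizable, so sequential
  continuity into the weak* topology is continuity).\<close>
definition mval_continuous :: "'n::finite mval \<Rightarrow> bool" where
  "mval_continuous \<Psi> \<longleftrightarrow>
     (\<forall>fs f. (\<forall>j. fs j \<in> Conv) \<longrightarrow> f \<in> Conv \<longrightarrow> loc_unif_conv fs f \<longrightarrow>
        (\<forall>\<phi>. Cc \<phi> \<longrightarrow> (\<lambda>j. \<Psi> (fs j) \<phi>) \<longlonglongrightarrow> \<Psi> f \<phi>))"

definition dually_epi_translation_invariant :: "'n::finite mval \<Rightarrow> bool" where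
  "dually_epi_translation_invariant \<Psi> \<longleftrightarrow>
     (\<forall>f\<in>Conv. \<forall>y c \<phi>. Cc \<phi> \<longrightarrow> \<Psi> (\<lambda>x. f x + y \<bullet> x + c) \<phi> = \<Psi> f \<phi>)"

definition locally_determined :: "'n::finite mval \<Rightarrow> bool" where
  "locally_determined \<Psi> \<longleftrightarrow>
     (\<forall>f\<in>Conv. \<forall>h\<in>Conv. \<forall>U. open U \<longrightarrow> (\<forall>x\<in>U. f x = h x) \<longrightarrow>
        (\<forall>\<phi>. Cc \<phi> \<longrightarrow> tsupp \<phi> \<subseteq> U \<longrightarrow> \<Psi> f \<phi> = \<Psi> h \<phi>))"

text \<open>Translation equivariant: Psi(f(. - x))[B + x] = Psi(f)[B].\<close>
definition translation_equivariant :: "'n::finite mval \<Rightarrow> bool" where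
  "translation_equivariant \<Psi> \<longleftrightarrow>
     (\<forall>f\<in>Conv. \<forall>z \<phi>. Cc \<phi> \<longrightarrow> \<Psi> (\<lambda>x. f (x - z)) \<phi> = \<Psi> f (\<lambda>x. \<phi> (x + z)))"

definition homogeneous :: "nat \<Rightarrow> 'n::finite mval \<Rightarrow> bool" where
  "homogeneous k \<Psi> \<longleftrightarrow>
     (\<forall>f\<in>Conv. \<forall>t::real. t > 0 \<longrightarrow> (\<forall>\<phi>. Cc \<phi> \<longrightarrow>
        \<Psi> (\<lambda>x. t * f x) \<phi> = complex_of_real (t ^ k) * \<Psi> f \<phi>))"

definition MAVal :: "nat \<Rightarrow> 'n::finite mval set" where
  "MAVal k = {\<Psi>. is_mval \<Psi> \<and> mval_continuous \<Psi> \<and> mval_valuation \<Psi> \<and>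
     dually_epi_translation_invariant \<Psi> \<and> locally_determined \<Psi> \<and>
     translation_equivariant \<Psi> \<and> homogeneous k \<Psi>}"

text \<open>GL action: [g.Psi](f)[B] = Psi(f o g)[g^-1 B]; as functionals phi |-> Psi(f o g)(phi o g).\<close>
definition GL_act :: "real^'n::finite^'n \<Rightarrow> 'n mval \<Rightarrow> 'n mval" where
  "GL_act g \<Psi> = (\<lambda>f \<phi>. \<Psi> (\<lambda>x. f (g *v x)) (\<lambda>x. \<phi> (g *v x)))"

definition GL_equivariant :: "real \<Rightarrow> 'n::finite mval \<Rightarrow> bool" where
  "GL_equivariant q \<Psi> \<longleftrightarrow>
     (\<forall>g::real^'n^'n. invertible g \<longrightarrow> (\<forall>f\<in>Conv. \<forall>\<phi>. Cc \<phi> \<longrightarrow>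
        GL_act g \<Psi> f \<phi> = complex_of_real (\<bar>det g\<bar> powr q) * \<Psi> f \<phi>))"

definition subgradients :: "(real^'n::finite \<Rightarrow> real) \<Rightarrow> real^'n \<Rightarrow> (real^'n) set" where
  "subgradients f x = {y. \<forall>z. f z \<ge> f x + y \<bullet> (z - x)}"

definition monge_ampere :: "(real^'n::finite \<Rightarrow> real) \<Rightarrow> (real^'n) measure" where
  "monge_ampere f = measure_of UNIV (sets borel)
     (\<lambda>B. emeasure lebesgue (\<Union>x\<in>B. subgradients f x))"

end

theory Submission
  imports Defs
begin

text \<open>Let \<open>h\<^sub>J\<close> be the support function of the simplex spanned by 0 and the unit vectors indexed by J.
  A generic piecewise affine convex function coincides near each point with some \<open>h\<^sub>J\<close>, up to an
  affine summand and an affine change of coordinates, and such functions are dense; hence an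
  equivariant \<open>\<Psi>\<close> is determined by its values on the \<open>h\<^sub>J\<close>, and vanishes if these do.

  If k = 0, then \<open>\<Psi> f = \<Psi> 0\<close> by letting the factor t in \<open>\<Psi> (t f) = \<Psi> f\<close> tend to 0, and \<open>\<Psi> 0\<close> is translation
  invariant. Let k be positive. If \<open>q \<le> 0\<close>, induction on J shows that \<open>\<Psi> h\<^sub>J\<close> lives on the subspace where
  the coordinates in J vanish; dilating these coordinates multiplies \<open>h\<^sub>J\<close> but fixes that subspace,
  so \<open>\<Psi> h\<^sub>J = 0\<close>. If \<open>q > 0\<close>, stretching a coordinate outside J leaves \<open>h\<^sub>J\<close> fixed while the weight blows
  up, so \<open>\<Psi> h\<^sub>J = 0\<close> unless J is the full index set, and then it is a multiple of the Dirac measure at 0.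
  Cutting the simplex into two affinely equivalent halves gives \<open>2 * (1/2) powr q = 1\<close>, that is q = 1. The
  Monge--Ampere operator has the same properties with q = 1, so a suitable difference
  \<open>\<Psi> - c MA\<close> vanishes on all \<open>h\<^sub>J\<close>.\<close>

section \<open>Linear change of variables\<close>

text \<open>The values on the simplex functions can be controlled because Radon functionals have
  order zero: one that vanishes on test functions supported away from a closed set sees only their
  restriction to that set, whereas a distribution could still see normal derivatives. A test
  function may therefore be replaced by any other with the same restriction, in particular by its
  composition with a dilation fixing the set. Genericity is reached by moving the constants of
  finitely many supporting planes one at a time, since each possible dependence excludes a single
  value. The obstacle on the Monge-Ampere side is that \<open>measure_of\<close> returns the zero
  measure unless the set function is countably additive. This is resolved by inverting the
  subgradient relation: almost every attained slope has a single contact point, and the Monge-Ampere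
  measure is the image of Lebesgue measure under the map from slopes to contact points.
  Equivariance, locality and weak continuity then become statements about the contact points of a
  fixed slope.\<close>

lemma measure_shear_image_cbox:
  fixes a b :: "real^'n::finite"
  assumes "m \<noteq> n"
  shows "measure lebesgue ((\<lambda>x. \<chi> i. if i = m then x$m + x$n else x$i) ` cbox a b)
    = measure lebesgue (cbox a b)" (is "measure _ (?h ` _) = _")
proof (cases "cbox a b = {}")
  case False
  \<comment> \<open>\<open>measure_shear_interval\<close> asks for a nonnegative lower n-th
    coordinate, so the box is translated until that coordinate is 0.\<close>
  define v :: "real^'n" where "v = (\<chi> i. if i = n then - a$n else 0)"
  have lin: "linear ?h"
    by (rule linearI) (auto simp: algebra_simps vec_eq_iff)
  have "?h ` cbox (v + a) (v + b) = (+) (?h v) ` ?h ` cbox a b"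
    unfolding cbox_translation image_comp
    by (intro image_cong refl) (auto simp: linear_add[OF lin])
  then have "measure lebesgue (?h ` cbox a b) = measure lebesgue (?h ` cbox (v + a) (v + b))"
    by (simp only: measure_translation)
  also have "\<dots> = measure lebesgue (cbox (v + a) (v + b))"
    by (rule measure_shear_interval) (use assms False in \<open>auto simp: v_def cbox_translation\<close>)
  also have "\<dots> = measure lebesgue (cbox a b)"
    by (simp only: cbox_translation measure_translation)
  finally show ?thesis .
qed simp

text \<open>Unlike \<open>measure_linear_image\<close>, this needs no well-order on the index type: the order matters
  only for the determinant of a shear, which is also obtained from a row operation.\<close>

lemma lmeasurable_linear_image_finite:
  fixes f :: "real^'n::finite \<Rightarrow> real^'n"
  assumes "linear f"
  shows "\<forall>S\<in>lmeasurable. f ` S \<in> lmeasurable \<and>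
    measure lebesgue (f ` S) = \<bar>det (matrix f)\<bar> * measure lebesgue S"
proof (rule induct_linear_elementary[OF assms]; intro ballI)
  fix f g :: "real^'n \<Rightarrow> real^'n" and S :: "(real^'n) set"
  assume *: "linear f" "linear g"
    "\<forall>S\<in>lmeasurable. f ` S \<in> lmeasurable \<and> measure lebesgue (f ` S) = \<bar>det (matrix f)\<bar> * measure lebesgue S"
    "\<forall>S\<in>lmeasurable. g ` S \<in> lmeasurable \<and> measure lebesgue (g ` S) = \<bar>det (matrix g)\<bar> * measure lebesgue S"
    "S \<in> lmeasurable"
  then show "(f \<circ> g) ` S \<in> lmeasurable \<and>
      measure lebesgue ((f \<circ> g) ` S) = \<bar>det (matrix (f \<circ> g))\<bar> * measure lebesgue S"
    by (simp add: image_comp[symmetric] matrix_compose[OF *(2,1)] det_mul abs_mult del: o_apply image_comp)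
next
  fix f :: "real^'n \<Rightarrow> real^'n" and i and S :: "(real^'n) set"
  assume f: "linear f" "\<And>x. f x $ i = 0"
  have "\<not> inj f"
    using linear_injective_imp_surjective[OF f(1)] f(2)
    by (metis axis_nth surjD zero_neq_one)
  then have "negligible (f ` S)" "det (matrix f) = 0"
    using negligible_linear_singular_image[OF f(1)] det_nz_iff_inj[OF f(1)] by auto
  then show "f ` S \<in> lmeasurable \<and> measure lebesgue (f ` S) = \<bar>det (matrix f)\<bar> * measure lebesgue S"
    by (simp add: negligible_iff_measure)
next
  fix c and S :: "(real^'n) set"
  assume "S \<in> lmeasurable"
  then show "(\<lambda>x. \<chi> i. c i * x$i) ` S \<in> lmeasurable \<and>
      measure lebesgue ((\<lambda>x. \<chi> i. c i * x$i) ` S)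
        = \<bar>det (matrix (\<lambda>x. \<chi> i. c i * x$i))\<bar> * measure lebesgue S"
    by (simp add: measurable_stretch measure_stretch matrix_def axis_def det_diagonal)
next
  fix m n :: 'n and S :: "(real^'n) set"
  assume S: "S \<in> lmeasurable"
  let ?t = "Transposition.transpose m n" and ?h = "\<lambda>x::real^'n. \<chi> i. x $ Transposition.transpose m n i"
  have lin: "linear ?h"
    by (rule linearI) (auto simp: vec_eq_iff)
  have "?h ` cbox a b = cbox (?h a) (?h b)" for a b
  proof (intro equalityI subsetI)
    fix x assume x: "x \<in> cbox (?h a) (?h b)"
    have "?h x \<in> cbox a b"
      unfolding mem_box_cart by (metis (no_types, lifting) mem_box_cart(2) transpose_involutory vec_lambda_beta x)
    moreover have "x = ?h (?h x)" by (simp add: vec_eq_iff)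
    ultimately show "x \<in> ?h ` cbox a b" by blast
  qed (auto simp: mem_box_cart)
  note im = this
  have "measure lebesgue (?h ` cbox a b) = 1 * measure lebesgue (cbox a b)" for a b
  proof (cases "cbox a b = {}")
    case False
    then have "cbox (?h a) (?h b) \<noteq> {}" using im by (metis image_is_empty)
    then show ?thesis
      using prod.permute[OF permutes_swap_id, where S=UNIV and g="\<lambda>i. (b - a)$i", of m n] False
      by (simp add: im content_cbox_if_cart)
  qed simp
  moreover have "?h \<circ> ?h = id" by (auto simp: fun_eq_iff vec_eq_iff)
  then have "det (matrix ?h) * det (matrix ?h) = 1"
    using matrix_compose[OF lin lin] by (metis det_I det_mul matrix_id_mat_1)
  then have "\<bar>det (matrix ?h)\<bar> = 1"
    by (auto simp: square_eq_1_iff)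
  ultimately show "?h ` S \<in> lmeasurable \<and> measure lebesgue (?h ` S) = \<bar>det (matrix ?h)\<bar> * measure lebesgue S"
    using measure_linear_sufficient[OF lin S, of 1] by auto
next
  fix m n :: 'n and S :: "(real^'n) set"
  assume mn: "m \<noteq> n" and S: "S \<in> lmeasurable"
  let ?h = "\<lambda>x::real^'n. \<chi> i. if i = m then x$m + x$n else x$i"
  have lin: "linear ?h"
    by (rule linearI) (auto simp: algebra_simps vec_eq_iff)
  have "matrix ?h = (\<chi> k. if k = m then row m (mat 1) + 1 *s row n (mat 1) else row k (mat 1))"
    by (auto simp: vec_eq_iff matrix_def row_def mat_def axis_def)
  then have "det (matrix ?h) = 1"
    by (simp only: det_row_operation[OF mn] det_I)
  then show "?h ` S \<in> lmeasurable \<and> measure lebesgue (?h ` S) = \<bar>det (matrix ?h)\<bar> * measure lebesgue S"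
    using measure_linear_sufficient[OF lin S, of 1] measure_shear_image_cbox[OF mn] by auto
qed

lemma invertible_inverse_vec:
  fixes g :: "real^'n::finite^'n"
  assumes "invertible g"
  obtains g' where "invertible g'" "\<And>x. g *v (g' *v x) = x" "\<And>x. g' *v (g *v x) = x"
    "\<bar>det g\<bar> * \<bar>det g'\<bar> = 1" "det g \<noteq> 0"
proof -
  obtain g' where g': "g ** g' = mat 1" "g' ** g = mat 1"
    using assms unfolding invertible_def by blast
  show ?thesis
  proof
    show "invertible g'" using g' unfolding invertible_def by blast
    show "\<bar>det g\<bar> * \<bar>det g'\<bar> = 1"
      using g'(1) by (metis abs_mult abs_one det_I det_mul)
    show "det g \<noteq> 0" using assms invertible_det_nz by blast
  qed (simp_all add: matrix_vector_mul_assoc g')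
qed

lemma continuous_on_matrix_vector [continuous_intros]:
  fixes g :: "real^'n::finite^'m::finite"
  shows "continuous_on S f \<Longrightarrow> continuous_on S (\<lambda>x. g *v f x)"
  by (rule continuous_on_compose2[OF linear_continuous_on[OF matrix_vector_mul_bounded_linear] _ subset_UNIV])

text \<open>Lebesgue measure is characterised by its values on boxes, and the preimage of a box
  under \<open>g\<close> is its image under the inverse, to which the image formula applies.\<close>

lemma lborel_eq_density_distr_matrix:
  fixes g :: "real^'n::finite^'n"
  assumes "invertible g"
  shows "lborel = density (distr lborel borel ((*v) g)) (\<lambda>_. ennreal \<bar>det g\<bar>)"
proof (rule lborel_eqI)
  obtain g' where g': "invertible g'" "\<And>x. g *v (g' *v x) = x" "\<And>x. g' *v (g *v x) = x"
    "\<bar>det g\<bar> * \<bar>det g'\<bar> = 1" "det g \<noteq> 0" using invertible_inverse_vec[OF assms] by blast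
  fix l u :: "real^'n"
  assume le: "\<And>b. b \<in> Basis \<Longrightarrow> l \<bullet> b \<le> u \<bullet> b"
  have [measurable]: "(*v) g \<in> borel_measurable borel"
    by (intro borel_measurable_continuous_onI continuous_intros)
  have pre: "(*v) g -` box l u = (*v) g' ` box l u"
    using g'(2,3) by (auto simp: image_iff) metis
  have im: "(*v) g' ` box l u \<in> lmeasurable"
    "measure lebesgue ((*v) g' ` box l u) = \<bar>det g'\<bar> * measure lebesgue (box l u)"
    using lmeasurable_linear_image_finite[OF matrix_vector_mul_linear, of g'] by auto
  have "(*v) g -` box l u \<inter> space borel \<in> sets borel" by measurable
  then have bo: "(*v) g' ` box l u \<in> sets borel" by (simp add: pre)
  have "emeasure (distr lborel borel ((*v) g)) (box l u) = emeasure lborel ((*v) g' ` box l u)"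
    by (subst emeasure_distr) (auto simp: pre)
  also have "\<dots> = emeasure lebesgue ((*v) g' ` box l u)"
    using bo by simp
  also have "\<dots> = ennreal (\<bar>det g'\<bar> * measure lebesgue (box l u))"
    using im by (simp add: emeasure_eq_measure2)
  finally have "emeasure (distr lborel borel ((*v) g)) (box l u) = ennreal (\<bar>det g'\<bar> * measure lebesgue (box l u))" .
  then have "emeasure (density (distr lborel borel ((*v) g)) (\<lambda>_. ennreal \<bar>det g\<bar>)) (box l u)
     = ennreal \<bar>det g\<bar> * ennreal (\<bar>det g'\<bar> * measure lebesgue (box l u))"
    by (simp add: emeasure_density nn_integral_cmult_indicator)
  also have "\<dots> = ennreal (measure lebesgue (box l u))"
    using g'(4) by (simp add: ennreal_mult'[symmetric] mult.assoc[symmetric])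
  also have "\<dots> = ennreal (\<Prod>b\<in>Basis. (u - l) \<bullet> b)"
    using le by (simp add: measure_lborel_box inner_diff_left)
  finally show "emeasure (density (distr lborel borel ((*v) g)) (\<lambda>_. ennreal \<bar>det g\<bar>)) (box l u)
    = ennreal (\<Prod>b\<in>Basis. (u - l) \<bullet> b)" .
qed simp

lemma lborel_integral_matrix:
  fixes g :: "real^'n::finite^'n" and f :: "real^'n \<Rightarrow> complex"
  assumes "invertible g" and [measurable]: "f \<in> borel_measurable borel"
  shows "(LINT x|lborel. f (g *v x)) = complex_of_real (inverse \<bar>det g\<bar>) * (LINT x|lborel. f x)"
proof -
  have [measurable]: "(*v) g \<in> borel_measurable borel"
    by (intro borel_measurable_continuous_onI continuous_intros)
  have "(LINT x|lborel. f x) = \<bar>det g\<bar> *\<^sub>R (LINT x|lborel. f (g *v x))"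
    by (subst lborel_eq_density_distr_matrix[OF assms(1)])
      (simp add: integral_density integral_distr)
  moreover have "det g \<noteq> 0" using assms(1) invertible_det_nz by blast
  ultimately show ?thesis by (simp add: scaleR_conv_of_real)
qed

lemma lborel_integral_translation:
  fixes f :: "'a::euclidean_space \<Rightarrow> complex"
  assumes [measurable]: "f \<in> borel_measurable borel"
  shows "(LINT x|lborel. f (c + x)) = (LINT x|lborel. f x)"
  by (subst (2) lborel_distr_plus[of c, symmetric]) (simp add: integral_distr)

section \<open>Test functions and Radon functionals\<close>

lemma tsupp_subset: "closed K \<Longrightarrow> (\<And>x. \<phi> x \<noteq> 0 \<Longrightarrow> x \<in> K) \<Longrightarrow> tsupp \<phi> \<subseteq> K"
  unfolding tsupp_def by (rule closure_minimal) auto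

lemma CcI: "continuous_on UNIV \<phi> \<Longrightarrow> compact K \<Longrightarrow> (\<And>x. \<phi> x \<noteq> 0 \<Longrightarrow> x \<in> K) \<Longrightarrow> Cc \<phi>"
  unfolding Cc_def using tsupp_subset[of K \<phi>] compact_imp_closed[of K]
  by (metis closed_closure compact_Int_closed inf.absorb_iff2 tsupp_def)

lemma Cc_continuous: "Cc \<phi> \<Longrightarrow> continuous_on S \<phi>"
  unfolding Cc_def using continuous_on_subset by blast

lemma Cc_compact_tsupp: "Cc \<phi> \<Longrightarrow> compact (tsupp \<phi>)"
  by (simp add: Cc_def)

lemma in_tsupp: "\<phi> x \<noteq> 0 \<Longrightarrow> x \<in> tsupp \<phi>"
  unfolding tsupp_def using closure_subset by force

lemma Cc_borel_measurable: "Cc \<phi> \<Longrightarrow> \<phi> \<in> borel_measurable borel"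
  by (simp add: Cc_continuous borel_measurable_continuous_onI)

lemma Cc_mult:
  assumes "Cc \<phi>" "continuous_on UNIV \<eta>"
  shows "Cc (\<lambda>x. \<phi> x * \<eta> x)" "tsupp (\<lambda>x. \<phi> x * \<eta> x) \<subseteq> tsupp \<phi>"
proof -
  show "Cc (\<lambda>x. \<phi> x * \<eta> x)"
    by (rule CcI[OF _ Cc_compact_tsupp[OF assms(1)]])
      (auto intro!: continuous_on_mult Cc_continuous[OF assms(1)] assms(2) in_tsupp)
  show "tsupp (\<lambda>x. \<phi> x * \<eta> x) \<subseteq> tsupp \<phi>"
    unfolding tsupp_def by (rule closure_mono) auto
qed

lemma Cc_cmult: "Cc \<phi> \<Longrightarrow> Cc (\<lambda>x. c * \<phi> x)"
  using Cc_mult(1)[of \<phi> "\<lambda>_. c"] by (simp add: mult.commute)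

lemma Cc_add:
  assumes "Cc \<phi>" "Cc \<psi>" shows "Cc (\<lambda>x. \<phi> x + \<psi> x)"
proof (rule CcI[OF _ compact_Un[OF assms[THEN Cc_compact_tsupp]]])
  show "continuous_on UNIV (\<lambda>x. \<phi> x + \<psi> x)"
    using assms by (intro continuous_on_add Cc_continuous)
qed (metis UnCI add.right_neutral in_tsupp)

lemma Cc_diff: "Cc \<phi> \<Longrightarrow> Cc \<psi> \<Longrightarrow> Cc (\<lambda>x. \<phi> x - \<psi> x)"
  using Cc_add[OF _ Cc_cmult[of \<psi> "-1"], of \<phi>] by simp

lemma Cc_sum: "finite I \<Longrightarrow> (\<And>i. i \<in> I \<Longrightarrow> Cc (\<phi> i)) \<Longrightarrow> Cc (\<lambda>x. \<Sum>i\<in>I. \<phi> i x)"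
proof (induction rule: finite_induct)
  case empty
  show ?case by (simp add: Cc_def tsupp_def)
qed (simp add: Cc_add)

lemma Cc_compose:
  assumes "Cc \<phi>" "continuous_on UNIV T" "continuous_on UNIV S" "\<And>x. S (T x) = x"
  shows "Cc (\<lambda>x. \<phi> (T x))"
proof (rule CcI)
  show "continuous_on UNIV (\<lambda>x. \<phi> (T x))"
    using continuous_on_compose2[OF Cc_continuous[OF assms(1), of UNIV] assms(2)] by simp
  show "compact (S ` tsupp \<phi>)"
    using Cc_compact_tsupp[OF assms(1)] assms(3) compact_continuous_image continuous_on_subset by blast
  show "x \<in> S ` tsupp \<phi>" if "\<phi> (T x) \<noteq> 0" for x
    using in_tsupp[of \<phi>, OF that] assms(4)[of x] by (metis imageI)
qed

lemma Cc_translate: "Cc \<phi> \<Longrightarrow> Cc (\<lambda>x. \<phi> (x + z))"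
  by (rule Cc_compose[where S = "\<lambda>x. x - z"]) (auto intro!: continuous_intros)

lemma Cc_matrix:
  fixes g :: "real^'n::finite^'n"
  assumes "Cc \<phi>" "invertible g"
  shows "Cc (\<lambda>x. \<phi> (g *v x))"
proof -
  obtain g' where "\<And>x. g' *v (g *v x) = x" using invertible_inverse_vec[OF assms(2)] by blast
  then show ?thesis
    by (intro Cc_compose[OF assms(1), where S = "(*v) g'"] continuous_intros)
qed

lemma Cc_bounded:
  assumes "Cc \<phi>"
  shows "norm (\<phi> x) \<le> (SUP x. norm (\<phi> x))"
proof (rule cSUP_upper[OF UNIV_I])
  obtain B where B: "\<And>x. x \<in> tsupp \<phi> \<Longrightarrow> norm (\<phi> x) \<le> B"
    using compact_imp_bounded[OF compact_continuous_image[OF Cc_continuous Cc_compact_tsupp], OF assms assms]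
    unfolding bounded_iff by blast
  have "norm (\<phi> x) \<le> max B 0" for x
    using B[of x] in_tsupp[of \<phi> x] by fastforce
  then show "bdd_above (range (\<lambda>x. norm (\<phi> x)))" by (rule bdd_aboveI2)
qed

text \<open>The nonnegative real values matter where an integral of the bump is shown not to
  vanish.\<close>

lemma exists_Cc_bump:
  fixes p :: "real^'n::finite"
  obtains \<phi> where "Cc \<phi>" "\<phi> p = 1" "\<And>x. \<exists>r\<ge>0. \<phi> x = complex_of_real r"
proof
  show "Cc (\<lambda>x. complex_of_real (max 0 (1 - dist p x)))"
  proof (rule CcI[of _ "cball p 1"])
    show "continuous_on UNIV (\<lambda>x. complex_of_real (max 0 (1 - dist p x)))"
      by (intro continuous_intros)
  qed (auto simp: max_def split: if_splits)
qed (auto intro: exI[of _ "max 0 (1 - dist p x)" for x])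

section \<open>Radon functionals: bounds, localisation and support\<close>

locale radon =
  fixes L :: "(real^'n::finite \<Rightarrow> complex) \<Rightarrow> complex"
  assumes radon: "radon_functional L"
begin

lemma add: "Cc \<phi> \<Longrightarrow> Cc \<psi> \<Longrightarrow> L (\<lambda>x. \<phi> x + \<psi> x) = L \<phi> + L \<psi>"
  and cmult: "Cc \<phi> \<Longrightarrow> L (\<lambda>x. c * \<phi> x) = c * L \<phi>"
  using radon unfolding radon_functional_def by auto

lemma diff: "Cc \<phi> \<Longrightarrow> Cc \<psi> \<Longrightarrow> L (\<lambda>x. \<phi> x - \<psi> x) = L \<phi> - L \<psi>"
  using add[of \<phi> "\<lambda>x. -1 * \<psi> x"] cmult[of \<psi> "-1"] Cc_cmult[of \<psi> "-1"] by simp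

lemma zero: "L (\<lambda>x. 0) = 0"
  using cmult[of "\<lambda>x. 0" 0] by (simp add: Cc_def tsupp_def)

lemma sum: "finite I \<Longrightarrow> (\<And>i. i \<in> I \<Longrightarrow> Cc (\<phi> i)) \<Longrightarrow> L (\<lambda>x. \<Sum>i\<in>I. \<phi> i x) = (\<Sum>i\<in>I. L (\<phi> i))"
  by (induction rule: finite_induct) (simp_all add: zero add Cc_sum)

lemma bound:
  assumes "compact K"
  obtains C where "C \<ge> 0"
    "\<And>\<phi> B. Cc \<phi> \<Longrightarrow> tsupp \<phi> \<subseteq> K \<Longrightarrow> (\<And>x. norm (\<phi> x) \<le> B) \<Longrightarrow> norm (L \<phi>) \<le> C * B"
proof -
  obtain C where C: "\<And>\<phi>. Cc \<phi> \<Longrightarrow> tsupp \<phi> \<subseteq> K \<Longrightarrow> norm (L \<phi>) \<le> C * (SUP x. norm (\<phi> x))"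
    using radon assms unfolding radon_functional_def by meson
  show ?thesis
  proof
    fix \<phi> B assume \<phi>: "Cc \<phi>" "tsupp \<phi> \<subseteq> K" "\<And>x. norm (\<phi> x) \<le> B"
    have "0 \<le> norm (\<phi> 0)" by simp
    also have "\<dots> \<le> (SUP x. norm (\<phi> x))" by (rule Cc_bounded[OF \<phi>(1)])
    finally have "C * (SUP x. norm (\<phi> x)) \<le> max C 0 * (SUP x. norm (\<phi> x))"
      by (intro mult_right_mono) auto
    also have "\<dots> \<le> max C 0 * B"
      by (intro mult_left_mono cSUP_least) (auto simp: \<phi>)
    finally show "norm (L \<phi>) \<le> max C 0 * B" using C[OF \<phi>(1,2)] by linarith
  qed simp
qed

text \<open>A partition of unity on the compact support cuts \<open>\<phi>\<close> into finitely
  many pieces, each supported in a closed ball on which the functional vanishes.\<close>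

lemma locally_zero_imp_zero:
  assumes "Cc \<phi>"
    and loc: "\<And>x. x \<in> tsupp \<phi> \<Longrightarrow> \<exists>U. open U \<and> x \<in> U \<and> (\<forall>\<psi>. Cc \<psi> \<longrightarrow> tsupp \<psi> \<subseteq> U \<longrightarrow> L \<psi> = 0)"
  shows "L \<phi> = 0"
proof -
  let ?good = "\<lambda>x r. r > 0 \<and> (\<forall>\<psi>. Cc \<psi> \<longrightarrow> tsupp \<psi> \<subseteq> cball x r \<longrightarrow> L \<psi> = 0)"
  have "\<exists>r. ?good x r" if "x \<in> tsupp \<phi>" for x
  proof -
    obtain U where "open U" "x \<in> U" and U: "\<And>\<psi>. Cc \<psi> \<Longrightarrow> tsupp \<psi> \<subseteq> U \<Longrightarrow> L \<psi> = 0"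
      using loc[OF \<open>x \<in> tsupp \<phi>\<close>] by blast
    then obtain r where "r > 0" "cball x r \<subseteq> U" using open_contains_cball by blast
    then show ?thesis using U by blast
  qed
  then obtain r where r: "\<And>x. x \<in> tsupp \<phi> \<Longrightarrow> ?good x (r x)" by metis
  have "tsupp \<phi> \<subseteq> (\<Union>x\<in>tsupp \<phi>. ball x (r x))" using r by fastforce
  then obtain F where F: "F \<subseteq> tsupp \<phi>" "finite F" "tsupp \<phi> \<subseteq> (\<Union>x\<in>F. ball x (r x))"
    using compactE_image[OF Cc_compact_tsupp[OF assms(1)], of "tsupp \<phi>" "\<lambda>x. ball x (r x)"] by blast
  define \<theta> where "\<theta> p x = max 0 (r p - dist p x)" for p x
  define \<sigma> where "\<sigma> x = (\<Sum>p\<in>F. \<theta> p x)" for x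
  have cont: "continuous_on UNIV (\<theta> p)" "continuous_on UNIV \<sigma>" for p
    unfolding \<theta>_def[abs_def] \<sigma>_def[abs_def] by (intro continuous_intros)+
  have pos: "\<sigma> x > 0" if x: "x \<in> tsupp \<phi>" for x
  proof -
    obtain p where "p \<in> F" "x \<in> ball p (r p)" using subsetD[OF F(3) x] by blast
    then show ?thesis
      unfolding \<sigma>_def using F(2) by (intro sum_pos2[of F p]) (auto simp: \<theta>_def)
  qed
  show ?thesis
  proof (cases "tsupp \<phi> = {}")
    case True
    then have "\<phi> = (\<lambda>x. 0)" using in_tsupp[of \<phi>] by blast
    then show ?thesis using zero by simp
  next
    case False
    obtain m where m: "m \<in> tsupp \<phi>" "\<And>x. x \<in> tsupp \<phi> \<Longrightarrow> \<sigma> m \<le> \<sigma> x"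
      using continuous_attains_inf[OF Cc_compact_tsupp[OF assms(1)] False] cont(2) continuous_on_subset by blast
    \<comment> \<open>\<open>\<sigma> m\<close> is the positive minimum of \<open>\<sigma>\<close>
      on the support. Truncating the denominator there from below leaves it unchanged on the support
      and makes the weights continuous on the whole space.\<close>
    define w where "w p x = complex_of_real (\<theta> p x / max (\<sigma> x) (\<sigma> m))" for p x
    have [simp]: "max (\<sigma> x) (\<sigma> m) \<noteq> 0" for x using pos[OF m(1)] by linarith
    have w: "continuous_on UNIV (w p)" for p
      unfolding w_def[abs_def] by (intro continuous_intros cont) auto
    have "(\<Sum>p\<in>F. \<phi> x * w p x) = \<phi> x" for x
    proof (cases "\<phi> x = 0")
      case False
      then have x: "x \<in> tsupp \<phi>" by (rule in_tsupp)
      then have "max (\<sigma> x) (\<sigma> m) = \<sigma> x" using m(2) by auto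
      then have "(\<Sum>p\<in>F. w p x) = complex_of_real (\<sigma> x / \<sigma> x)"
        unfolding w_def by (simp only: sum_divide_distrib[symmetric] of_real_sum[symmetric]) (simp add: \<sigma>_def)
      then have "(\<Sum>p\<in>F. w p x) = 1" using pos[OF x] by simp
      then show ?thesis by (simp add: sum_distrib_left[symmetric])
    qed simp
    then have "L \<phi> = L (\<lambda>x. \<Sum>p\<in>F. \<phi> x * w p x)" by presburger
    also have "\<dots> = (\<Sum>p\<in>F. L (\<lambda>x. \<phi> x * w p x))"
      by (rule sum[OF F(2) Cc_mult(1)[OF assms(1) w]])
    also have "\<dots> = 0"
    proof (rule sum.neutral, rule ballI)
      fix p assume p: "p \<in> F"
      have "tsupp (\<lambda>x. \<phi> x * w p x) \<subseteq> cball p (r p)"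
        by (rule tsupp_subset) (auto simp: w_def \<theta>_def max_def split: if_splits)
      then show "L (\<lambda>x. \<phi> x * w p x) = 0"
        using r[of p] p F(1) Cc_mult(1)[OF assms(1) w] by blast
    qed
    finally show ?thesis .
  qed
qed

text \<open>The part of \<open>\<phi>\<close> with norm at least \<open>e\<close> is supported off
  \<open>A\<close> and contributes 0. The remaining part is uniformly of size \<open>e\<close> with
  support in one fixed compact set, so the Radon bound makes its contribution arbitrarily
  small.\<close>

lemma zero_off_closed:
  assumes off: "\<And>\<psi>. Cc \<psi> \<Longrightarrow> tsupp \<psi> \<inter> A = {} \<Longrightarrow> L \<psi> = 0"
    and "Cc \<phi>" "\<And>x. x \<in> A \<Longrightarrow> \<phi> x = 0"
  shows "L \<phi> = 0"
proof -
  obtain C where C: "C \<ge> 0"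
    "\<And>\<psi> B. Cc \<psi> \<Longrightarrow> tsupp \<psi> \<subseteq> tsupp \<phi> \<Longrightarrow> (\<And>x. norm (\<psi> x) \<le> B) \<Longrightarrow> norm (L \<psi>) \<le> C * B"
    using bound[OF Cc_compact_tsupp[OF assms(2)]] by blast
  have "norm (L \<phi>) \<le> C * (2 * e)" if "e > 0" for e
  proof -
    \<comment> \<open>The cutoff is 0 where \<open>norm (\<phi> x) \<le> e\<close> and 1 where
      \<open>norm (\<phi> x) \<ge> 2 * e\<close>.\<close>
    define \<eta> where "\<eta> x = complex_of_real (max 0 (min 1 (norm (\<phi> x) / e - 1)))" for x
    have cont: "continuous_on UNIV \<eta>"
      unfolding \<eta>_def[abs_def] using that by (intro continuous_intros Cc_continuous[OF assms(2)]) auto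
    note Cc\<eta> = Cc_mult(1)[OF assms(2) cont]
    have 1: "tsupp (\<lambda>x. \<phi> x * \<eta> x) \<subseteq> {x. e \<le> norm (\<phi> x)}"
    proof (rule tsupp_subset)
      show "closed {x. e \<le> norm (\<phi> x)}"
        by (intro closed_Collect_le continuous_intros Cc_continuous[OF assms(2)])
      fix x assume "\<phi> x * \<eta> x \<noteq> 0"
      then have "max 0 (min 1 (norm (\<phi> x) / e - 1)) \<noteq> 0" by (auto simp: \<eta>_def)
      then have "norm (\<phi> x) / e > 1" by linarith
      then show "x \<in> {x. e \<le> norm (\<phi> x)}" using that by (simp add: field_simps)
    qed
    have "{x. e \<le> norm (\<phi> x)} \<inter> A = {}" using assms(3) that by auto
    then have L0: "L (\<lambda>x. \<phi> x * \<eta> x) = 0"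
      using off[OF Cc\<eta>] 1 by blast
    have "Cc (\<lambda>x. \<phi> x * (1 - \<eta> x))" "tsupp (\<lambda>x. \<phi> x * (1 - \<eta> x)) \<subseteq> tsupp \<phi>"
      by (intro Cc_mult assms(2) continuous_intros cont)+
    moreover have "norm (\<phi> x * (1 - \<eta> x)) \<le> 2 * e" for x
    proof (cases "norm (\<phi> x) \<le> 2 * e")
      case True
      have "1 - \<eta> x = complex_of_real (1 - max 0 (min 1 (norm (\<phi> x) / e - 1)))"
        by (simp add: \<eta>_def)
      then have "norm (1 - \<eta> x) \<le> 1" by (simp only: norm_of_real)
      then show ?thesis
        using mult_mono[OF True, of "norm (1 - \<eta> x)" 1] that by (simp add: norm_mult)
    next
      case False
      then have "norm (\<phi> x) / e - 1 \<ge> 1" using that by (simp add: field_simps)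
      then have "\<eta> x = 1" by (simp add: \<eta>_def)
      then show ?thesis using that by simp
    qed
    ultimately have "norm (L (\<lambda>x. \<phi> x * (1 - \<eta> x))) \<le> C * (2 * e)"
      using C(2) by blast
    moreover have "L (\<lambda>x. \<phi> x * (1 - \<eta> x)) = L \<phi>"
      using diff[OF assms(2) Cc\<eta>] L0 by (simp add: algebra_simps)
    ultimately show ?thesis by simp
  qed
  note small = this
  \<comment> \<open>The denominator \<open>C + 1\<close> also covers \<open>C = 0\<close>.\<close>
  have "norm (L \<phi>) \<le> 0 + e" if "e > 0" for e
  proof -
    have "norm (L \<phi>) \<le> C * (2 * (e / (2 * (C + 1))))"
      using C(1) that by (intro small divide_pos_pos) auto
    also have "\<dots> = e * (C / (C + 1))" using C(1) by (simp add: field_simps)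
    also have "\<dots> \<le> e * 1" using C(1) that by (intro mult_left_mono) auto
    finally show ?thesis by simp
  qed
  then show ?thesis
    using field_le_epsilon[of "norm (L \<phi>)" 0] by simp
qed

end

section \<open>Convex functions\<close>

lemma Conv_continuous: "f \<in> Conv \<Longrightarrow> continuous_on S f"
  unfolding Conv_def using convex_on_continuous[OF open_UNIV] continuous_on_subset by blast

lemma ConvI:
  assumes "\<And>x y u v. u \<ge> 0 \<Longrightarrow> v \<ge> 0 \<Longrightarrow> u + v = 1 \<Longrightarrow> f (u *\<^sub>R x + v *\<^sub>R y) \<le> u * f x + v * f y"
  shows "f \<in> Conv"
  unfolding Conv_def convex_on_def using assms by auto

lemma ConvD: "f \<in> Conv \<Longrightarrow> u \<ge> 0 \<Longrightarrow> v \<ge> 0 \<Longrightarrow> u + v = 1 \<Longrightarrow> f (u *\<^sub>R x + v *\<^sub>R y) \<le> u * f x + v * f y"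
  unfolding Conv_def convex_on_def by auto

lemma Conv_matrix: "f \<in> Conv \<Longrightarrow> (\<lambda>x. f (g *v x)) \<in> Conv"
  by (rule ConvI) (simp add: matrix_vector_right_distrib matrix_vector_mult_scaleR ConvD)

lemma Conv_translate:
  assumes "f \<in> Conv" shows "(\<lambda>x. f (x - z)) \<in> Conv"
proof (rule ConvI)
  fix x y and u v :: real
  assume uv: "u \<ge> 0" "v \<ge> 0" "u + v = 1"
  have "u *\<^sub>R x + v *\<^sub>R y - z = u *\<^sub>R (x - z) + v *\<^sub>R (y - z)"
    using uv(3) by (simp add: algebra_simps flip: scaleR_add_left)
  then show "f (u *\<^sub>R x + v *\<^sub>R y - z) \<le> u * f (x - z) + v * f (y - z)"
    using ConvD[OF assms uv] by metis
qed

lemma Conv_add_affine: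
  assumes "f \<in> Conv" shows "(\<lambda>x. f x + y \<bullet> x + c) \<in> Conv"
proof (rule ConvI)
  fix a b and u v :: real
  assume uv: "u \<ge> 0" "v \<ge> 0" "u + v = 1"
  have "c = u * c + v * c" using uv(3) by (metis distrib_right mult_1)
  then show "f (u *\<^sub>R a + v *\<^sub>R b) + y \<bullet> (u *\<^sub>R a + v *\<^sub>R b) + c
      \<le> u * (f a + y \<bullet> a + c) + v * (f b + y \<bullet> b + c)"
    using ConvD[OF assms uv, of a b] by (simp add: inner_add_right distrib_left)
qed

lemma Conv_cmult: "f \<in> Conv \<Longrightarrow> t \<ge> 0 \<Longrightarrow> (\<lambda>x. t * f x) \<in> Conv"
  unfolding Conv_def by (simp add: convex_on_cmul)

lemma Conv_zero: "(\<lambda>x. 0) \<in> Conv"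
  by (rule ConvI) simp

text \<open>A hyperplane with normal \<open>(\<alpha>, s)\<close> separates the point
  \<open>(p, f p)\<close> from the strict epigraph. Since the epigraph is unbounded upwards,
  \<open>s \<ge> 0\<close>; a vertical hyperplane is impossible because \<open>f\<close> is finite
  everywhere. The slope is then \<open>- \<alpha> /\<^sub>R s\<close>.\<close>

lemma subgradients_nonempty:
  fixes f :: "real^'n::finite \<Rightarrow> real"
  assumes "f \<in> Conv"
  shows "subgradients f p \<noteq> {}"
proof -
  let ?T = "{(z, t). f z < t}"
  have "convex ?T"
  proof (rule convexI)
    fix P Q :: "(real^'n) \<times> real" and u v :: real
    assume PQ: "P \<in> ?T" "Q \<in> ?T" and uv: "0 \<le> u" "0 \<le> v" "u + v = 1"
    obtain a s b t where [simp]: "P = (a, s)" "Q = (b, t)" by (metis surj_pair)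
    have *: "f a < s" "f b < t" "0 \<le> u" "0 \<le> v" "u + v = 1" using PQ uv by auto
    have "u * f a + v * f b < u * s + v * t"
    proof (cases "u = 0")
      case False
      then show ?thesis using * by (intro add_less_le_mono mult_strict_left_mono mult_left_mono) auto
    qed (use * in auto)
    then show "u *\<^sub>R P + v *\<^sub>R Q \<in> ?T"
      using ConvD[OF assms *(3-5), of a b] by simp
  qed
  moreover have "(p, f p + 1) \<in> ?T" by simp
  ultimately obtain w c where w: "w \<noteq> 0" "w \<bullet> (p, f p) \<le> c" "\<And>x. x \<in> ?T \<Longrightarrow> c \<le> w \<bullet> x"
    using separating_hyperplane_sets[of "{(p, f p)}" ?T] by blast
  obtain \<alpha> s where ws: "w = (\<alpha>, s)" by (cases w)
  have ineq: "\<alpha> \<bullet> p + s * f p \<le> \<alpha> \<bullet> z + s * t" if "f z < t" for z t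
    using w(2) w(3)[of "(z, t)"] that by (simp add: ws)
  have "s \<ge> 0" using ineq[of p "f p + 1"] by (simp add: algebra_simps)
  moreover have "s \<noteq> 0"
  proof
    assume "s = 0"
    then have "\<alpha> \<bullet> p \<le> \<alpha> \<bullet> z" for z using ineq[of z "f z + 1"] by simp
    from this[of "p - \<alpha>"] have "\<alpha> = 0" by (simp add: inner_diff_right) (metis inner_ge_zero inner_eq_zero_iff order_antisym)
    then show False using w(1) ws \<open>s = 0\<close> by (simp add: zero_prod_def)
  qed
  ultimately have s: "s > 0" by simp
  have "f z \<ge> f p + (- \<alpha> /\<^sub>R s) \<bullet> (z - p)" for z
  proof (rule field_le_epsilon)
    fix e :: real assume "e > 0"
    then show "f p + (- \<alpha> /\<^sub>R s) \<bullet> (z - p) \<le> f z + e"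
      using ineq[of z "f z + e"] s by (simp add: field_simps inner_diff_right)
  qed
  then show ?thesis unfolding subgradients_def by blast
qed

section \<open>Piecewise affine functions\<close>

definition pl :: "(real^'n::finite) set \<Rightarrow> (real^'n \<Rightarrow> real) \<Rightarrow> real^'n \<Rightarrow> real" where
  "pl Y b x = Max ((\<lambda>y. y \<bullet> x + b y) ` Y)"

text \<open>The slopes that are active at a point \<open>x\<close> share the value \<open>c\<close>
  there, so under this condition every active set consists of the vertices of a simplex.\<close>

definition generic :: "(real^'n::finite) set \<Rightarrow> (real^'n \<Rightarrow> real) \<Rightarrow> bool" where
  "generic Y b \<longleftrightarrow>
     (\<forall>Z\<subseteq>Y. (\<exists>x c. \<forall>y\<in>Z. y \<bullet> x + b y = c) \<longrightarrow> \<not> affine_dependent Z)"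

text \<open>The support function of the simplex spanned by 0 and the unit vectors indexed by J.\<close>

definition simplex_fn :: "'n::finite set \<Rightarrow> real^'n \<Rightarrow> real" where
  "simplex_fn J x = Max (insert 0 ((\<lambda>j. x$j) ` J))"

lemma pl_Conv:
  assumes "finite Y" "Y \<noteq> {}" shows "pl Y b \<in> Conv"
proof (rule ConvI)
  fix x z and u v :: real
  assume uv: "u \<ge> 0" "v \<ge> 0" "u + v = 1"
  have "y \<bullet> (u *\<^sub>R x + v *\<^sub>R z) + b y \<le> u * pl Y b x + v * pl Y b z" if "y \<in> Y" for y
  proof -
    have "y \<bullet> (u *\<^sub>R x + v *\<^sub>R z) + b y = u * (y \<bullet> x + b y) + v * (y \<bullet> z + b y)"
    proof -
      have "b y = u * b y + v * b y" using uv(3) by (metis distrib_right mult_1)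
      then show ?thesis by (simp add: inner_add_right distrib_left)
    qed
    also have "\<dots> \<le> u * pl Y b x + v * pl Y b z"
      using uv that assms by (intro add_mono mult_left_mono) (auto simp: pl_def)
    finally show ?thesis .
  qed
  then show "pl Y b (u *\<^sub>R x + v *\<^sub>R z) \<le> u * pl Y b x + v * pl Y b z"
    using assms by (subst pl_def) auto
qed

lemma simplex_fn_eq_pl: "simplex_fn J = pl (insert 0 ((\<lambda>j. axis j 1) ` J)) (\<lambda>_. 0)"
  by (auto simp: simplex_fn_def pl_def fun_eq_iff image_image inner_axis' image_insert)

lemma simplex_fn_Conv: "simplex_fn J \<in> Conv"
  unfolding simplex_fn_eq_pl by (rule pl_Conv) auto

text \<open>The inactive pieces lie strictly below an active one at \<open>x\<close>, and finitely
  many strict inequalities between continuous functions persist nearby.\<close>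

lemma pl_active:
  fixes x :: "real^'n::finite" and b :: "real^'n \<Rightarrow> real"
  assumes "finite Y" "Y \<noteq> {}" and Z_def: "Z = {y \<in> Y. y \<bullet> x + b y = pl Y b x}"
  obtains U where "Z \<noteq> {}" "open U" "x \<in> U" "\<And>z. z \<in> U \<Longrightarrow> pl Y b z = pl Z b z"
proof -
  have "pl Y b x \<in> (\<lambda>y. y \<bullet> x + b y) ` Y"
    unfolding pl_def using assms by (intro Max_in) auto
  then obtain p where p: "p \<in> Z" unfolding Z_def by auto
  have Z: "finite Z" "Z \<subseteq> Y" unfolding Z_def using assms by auto
  define U where "U = (\<Inter>y\<in>Y - Z. {z. y \<bullet> z + b y < p \<bullet> z + b p})"
  show ?thesis
  proof
    show "open U" unfolding U_def using assms(1)
      by (intro open_INT) (auto intro!: open_Collect_less continuous_intros)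
    show "x \<in> U"
    proof -
      have "y \<bullet> x + b y < p \<bullet> x + b p" if "y \<in> Y - Z" for y
      proof -
        have "y \<bullet> x + b y \<le> pl Y b x" unfolding pl_def using assms that by auto
        then show ?thesis using that p unfolding Z_def by auto
      qed
      then show ?thesis unfolding U_def by auto
    qed
    fix z assume z: "z \<in> U"
    show "pl Y b z = pl Z b z"
    proof (rule antisym)
      show "pl Z b z \<le> pl Y b z"
        unfolding pl_def using Z p assms by (intro Max_mono) auto
      have "y \<bullet> z + b y \<le> pl Z b z" if "y \<in> Y" for y
      proof (cases "y \<in> Z")
        case False
        then have "y \<bullet> z + b y < p \<bullet> z + b p" using z that unfolding U_def by auto
        also have "\<dots> \<le> pl Z b z" unfolding pl_def using Z p by auto
        finally show ?thesis by simp
      qed (use Z in \<open>auto simp: pl_def\<close>)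
      then show "pl Y b z \<le> pl Z b z" using assms by (subst (1) pl_def) auto
    qed
  qed (use p in auto)
qed

text \<open>Induction on the set of slopes. A new slope \<open>p\<close> creates a dependence with
  an independent \<open>Z\<close> only if it lies in the affine hull of \<open>Z\<close>. Then a
  common value on \<open>Z\<close> already determines the constant that \<open>p\<close> would need
  to join it, whatever \<open>x\<close> and \<open>c\<close> are, so only finitely many constants
  are forbidden.\<close>

lemma generic_perturbation:
  fixes Y :: "(real^'n::finite) set"
  assumes "finite Y" "e > 0"
  shows "\<exists>b'. (\<forall>y\<in>Y. \<bar>b' y - b y\<bar> < e) \<and> generic Y b'"
  using assms(1)
proof (induction rule: finite_induct)
  case empty
  then show ?case by (auto simp: generic_def affine_dependent_def)
next
  case (insert p Y)
  from insert.IH obtain b' where b': "\<forall>y\<in>Y. \<bar>b' y - b y\<bar> < e" "generic Y b'" by (elim exE conjE)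
  have "\<exists>v. \<forall>x c. (\<forall>y\<in>Z. y \<bullet> x + b' y = c) \<longrightarrow> c - p \<bullet> x = v"
    if Z: "Z \<subseteq> Y" "p \<in> affine hull Z" for Z
  proof -
    have "finite Z" using Z insert finite_subset by blast
    then obtain u where u: "sum u Z = 1" "(\<Sum>z\<in>Z. u z *\<^sub>R z) = p"
      using Z(2) by (auto simp: affine_hull_finite)
    have "c - p \<bullet> x = (\<Sum>z\<in>Z. u z * b' z)" if "\<forall>y\<in>Z. y \<bullet> x + b' y = c" for x c
    proof -
      have "c = (\<Sum>z\<in>Z. u z * c)" using u(1) by (simp flip: sum_distrib_right)
      also have "\<dots> = (\<Sum>z\<in>Z. u z * (z \<bullet> x + b' z))" using that by (intro sum.cong) auto
      also have "\<dots> = p \<bullet> x + (\<Sum>z\<in>Z. u z * b' z)"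
        by (simp add: u(2)[symmetric] inner_sum_left distrib_left sum.distrib)
      finally show ?thesis by simp
    qed
    then show ?thesis by (intro exI allI impI)
  qed
  then have "\<forall>Z. \<exists>v. Z \<subseteq> Y \<longrightarrow> p \<in> affine hull Z \<longrightarrow>
      (\<forall>x c. (\<forall>y\<in>Z. y \<bullet> x + b' y = c) \<longrightarrow> c - p \<bullet> x = v)" by (metis (no_types))
  from choice[OF this] obtain v where
    v: "\<And>Z x c. Z \<subseteq> Y \<Longrightarrow> p \<in> affine hull Z \<Longrightarrow> \<forall>y\<in>Z. y \<bullet> x + b' y = c \<Longrightarrow> c - p \<bullet> x = v Z"
    by (elim exE) (rule that, simp)
  \<comment> \<open>There is at most one forbidden value \<open>v Z\<close> for each subset
    \<open>Z\<close> of \<open>Y\<close>, while the interval is infinite.\<close>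
  have "infinite ({b p - e<..<b p + e} - v ` Pow Y)"
    using insert(1) assms(2) by (simp add: infinite_Ioo)
  then obtain \<beta> where \<beta>: "\<beta> \<in> {b p - e<..<b p + e}" "\<beta> \<notin> v ` Pow Y"
    using infinite_imp_nonempty by blast
  define b'' where "b'' = b'(p := \<beta>)"
  have "\<not> affine_dependent Z" if Z: "Z \<subseteq> insert p Y" "\<forall>y\<in>Z. y \<bullet> x + b'' y = c" for Z x c
  proof -
    have eq: "\<forall>y\<in>Z - {p}. y \<bullet> x + b' y = c"
      using Z(2) by (metis Diff_iff b''_def fun_upd_other insertI1)
    have sub: "Z - {p} \<subseteq> Y" using Z(1) by auto
    have ind: "\<not> affine_dependent (Z - {p})"
      using b'(2)[unfolded generic_def, rule_format, OF sub] eq by (metis (no_types))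
    show ?thesis
    proof (cases "p \<in> Z")
      case True
      have "p \<notin> affine hull (Z - {p})"
      proof
        assume "p \<in> affine hull (Z - {p})"
        then have "c - p \<bullet> x = v (Z - {p})" by (rule v[OF sub _ eq])
        moreover have "c - p \<bullet> x = \<beta>" using Z(2) True by (auto simp: b''_def)
        ultimately show False using \<beta>(2) sub by auto
      qed
      then show ?thesis using affine_independent_insert[OF ind] True by (metis insert_Diff)
    qed (use ind in simp)
  qed
  moreover have "\<forall>y\<in>insert p Y. \<bar>b'' y - b y\<bar> < e"
    using b'(1) \<beta>(1) by (auto simp: b''_def)
  ultimately show ?case unfolding generic_def by (intro exI[of _ b'']) auto
qed

text \<open>Supporting planes at finitely many points approximate \<open>f\<close> from below on the
  ball by compactness; half of \<open>e\<close> is kept for making the constants generic.\<close>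

lemma generic_pl_approx:
  fixes f :: "real^'n::finite \<Rightarrow> real"
  assumes f: "f \<in> Conv" and "e > 0" "R \<ge> 0"
  shows "\<exists>Y b. finite Y \<and> Y \<noteq> {} \<and> generic Y b \<and> (\<forall>x\<in>cball 0 R. \<bar>pl Y b x - f x\<bar> < e)"
proof -
  have "\<forall>p. \<exists>y. y \<in> subgradients f p" using subgradients_nonempty[OF f] by blast
  then obtain \<eta> where \<eta>: "\<And>p. \<eta> p \<in> subgradients f p" by metis
  define U where "U p = {x. f x - e/2 < f p + \<eta> p \<bullet> (x - p)}" for p
  have opU: "open (U p)" for p
    unfolding U_def by (intro open_Collect_less continuous_intros Conv_continuous[OF f])
  have "p \<in> U p" for p unfolding U_def using assms(2) by simp
  then have "cball 0 R \<subseteq> (\<Union>p\<in>cball 0 R. U p)" by blast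
  then obtain F where F: "F \<subseteq> cball 0 R" "finite F" "cball 0 R \<subseteq> (\<Union>p\<in>F. U p)"
    by (rule compactE_image[OF compact_cball opU])
  define Y where "Y = \<eta> ` F"
  have Y: "finite Y" "Y \<noteq> {}"
    using F assms(3) by (auto simp: Y_def)
  \<comment> \<open>Several points of \<open>F\<close> may have the same slope, so the constant is
    read off at one chosen preimage. Supporting planes with equal slope coincide, so the choice does
    no harm.\<close>
  define b where "b y = (let p = inv_into F \<eta> y in f p - y \<bullet> p)" for y
  have below: "y \<bullet> x + b y \<le> f x" if "y \<in> Y" for x y
  proof -
    have "\<eta> (inv_into F \<eta> y) = y" using that unfolding Y_def by (simp add: f_inv_into_f)
    then have "y \<in> subgradients f (inv_into F \<eta> y)" using \<eta> by metis
    then have "f x \<ge> f (inv_into F \<eta> y) + y \<bullet> (x - inv_into F \<eta> y)"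
      unfolding subgradients_def by blast
    then show ?thesis unfolding b_def Let_def by (simp add: inner_diff_right)
  qed
  have above: "f x - e/2 < \<eta> p \<bullet> x + b (\<eta> p)" if "x \<in> U p" "p \<in> F" for x p
  proof -
    let ?p = "inv_into F \<eta> (\<eta> p)"
    have "\<eta> ?p = \<eta> p" using that(2) by (simp add: f_inv_into_f)
    then have "f p + \<eta> p \<bullet> (?p - p) \<le> f ?p" using \<eta>[of p] unfolding subgradients_def by auto
    then show ?thesis using that(1) unfolding U_def b_def Let_def by (auto simp: inner_diff_right algebra_simps)
  qed
  from generic_perturbation[OF Y(1) half_gt_zero[OF assms(2)], of b]
  obtain b' where near: "\<forall>y\<in>Y. \<bar>b' y - b y\<bar> < e/2" and gen: "generic Y b'" by (elim exE conjE)
  note b' = bspec[OF near] gen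
  have "\<bar>pl Y b' x - f x\<bar> < e" if x: "x \<in> cball 0 R" for x
  proof -
    have "pl Y b' x < f x + e"
    proof -
      have "y \<bullet> x + b' y < f x + e" if "y \<in> Y" for y
        using b'(1)[OF that] below[OF that, of x] assms(2) by linarith
      then show ?thesis unfolding pl_def using Y by auto
    qed
    moreover obtain p where p: "p \<in> F" "x \<in> U p" using F(3) x by blast
    have "\<eta> p \<in> Y" using p by (auto simp: Y_def)
    then have "\<eta> p \<bullet> x + b' (\<eta> p) \<le> pl Y b' x" unfolding pl_def using Y by auto
    then have "f x - e < pl Y b' x"
      using above[OF p(2,1)] b'(1)[OF \<open>\<eta> p \<in> Y\<close>] by linarith
    ultimately show ?thesis by linarith
  qed
  then show ?thesis using Y b'(2) by (intro exI[of _ Y] exI[of _ b']) simp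
qed

section \<open>Equivariant measure-valued functionals are determined on simplex functions\<close>

text \<open>These conditions hold for the Monge-Ampere functional and pass to differences of
  functionals with the same weight. Homogeneity and the valuation property are assumed at the places
  where they enter.\<close>

locale GL_mval =
  fixes \<Psi> :: "'n::finite mval" and q :: real
  assumes is_mval: "is_mval \<Psi>"
    and continuous: "mval_continuous \<Psi>"
    and epi_invariant: "dually_epi_translation_invariant \<Psi>"
    and local: "locally_determined \<Psi>"
    and translation: "translation_equivariant \<Psi>"
    and GL: "GL_equivariant q \<Psi>"
begin

definition vanish :: "(real^'n \<Rightarrow> real) \<Rightarrow> bool" where
  "vanish f \<longleftrightarrow> (\<forall>\<phi>. Cc \<phi> \<longrightarrow> \<Psi> f \<phi> = 0)"

lemma radon: "f \<in> Conv \<Longrightarrow> radon (\<Psi> f)"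
  using is_mval by (simp add: is_mval_def radon_def)

lemma GL_apply:
  "invertible g \<Longrightarrow> f \<in> Conv \<Longrightarrow> Cc \<phi> \<Longrightarrow>
    \<Psi> (\<lambda>x. f (g *v x)) (\<lambda>x. \<phi> (g *v x)) = complex_of_real (\<bar>det g\<bar> powr q) * \<Psi> f \<phi>"
  by (rule GL[unfolded GL_equivariant_def GL_act_def, rule_format])

lemma epi_apply: "f \<in> Conv \<Longrightarrow> Cc \<phi> \<Longrightarrow> \<Psi> (\<lambda>x. f x + y \<bullet> x + c) \<phi> = \<Psi> f \<phi>"
  by (rule epi_invariant[unfolded dually_epi_translation_invariant_def, rule_format])

lemma vanish_GL:
  assumes "invertible g" "f \<in> Conv" "vanish f"
  shows "vanish (\<lambda>x. f (g *v x))"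
  unfolding vanish_def
proof (intro allI impI)
  fix \<phi> :: "real^'n \<Rightarrow> complex" assume \<phi>: "Cc \<phi>"
  obtain g' where g': "invertible g'" "\<And>x. g' *v (g *v x) = x"
    by (rule invertible_inverse_vec[OF assms(1)]) (rule that)
  have "\<Psi> f (\<lambda>x. \<phi> (g' *v x)) = 0"
    by (rule assms(3)[unfolded vanish_def, rule_format, OF Cc_matrix[OF \<phi> g'(1)]])
  then show "\<Psi> (\<lambda>x. f (g *v x)) \<phi> = 0"
    using GL_apply[OF assms(1,2) Cc_matrix[OF \<phi> g'(1)]] unfolding g'(2) by simp
qed

lemma vanish_translate:
  assumes "f \<in> Conv" "vanish f"
  shows "vanish (\<lambda>x. f (x - z))"
  unfolding vanish_def
proof (intro allI impI)
  fix \<phi> :: "real^'n \<Rightarrow> complex" assume "Cc \<phi>"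
  then show "\<Psi> (\<lambda>x. f (x - z)) \<phi> = 0"
    using translation[unfolded translation_equivariant_def, rule_format, OF assms(1), of \<phi> z]
      assms(2)[unfolded vanish_def, rule_format, OF Cc_translate[of \<phi> z]] by simp
qed

lemma vanish_affine:
  assumes "f \<in> Conv" "vanish f"
  shows "vanish (\<lambda>x. f x + y \<bullet> x + c)"
  unfolding vanish_def
  using epi_apply[OF assms(1)] assms(2)[unfolded vanish_def, rule_format] by simp

text \<open>Local determination turns agreement with a vanishing function near each point into local
  vanishing of the functional, and the partition of unity globalises it.\<close>

lemma zero_of_locally_vanish:
  assumes "f \<in> Conv" "Cc \<phi>"
    and "\<And>x. x \<in> tsupp \<phi> \<Longrightarrow> \<exists>U h. open U \<and> x \<in> U \<and> h \<in> Conv \<and> (\<forall>z\<in>U. f z = h z) \<and> vanish h"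
  shows "\<Psi> f \<phi> = 0"
proof -
  interpret L: radon "\<Psi> f" by (rule radon[OF assms(1)])
  show ?thesis
  proof (rule L.locally_zero_imp_zero[OF assms(2)])
    fix x assume "x \<in> tsupp \<phi>"
    then obtain U h where U: "open U" "x \<in> U" "h \<in> Conv" "\<And>z. z \<in> U \<Longrightarrow> f z = h z" "vanish h"
      using assms(3)[of x] by (elim meta_impE exE conjE) simp_all
    have "\<Psi> f \<psi> = 0" if "Cc \<psi>" "tsupp \<psi> \<subseteq> U" for \<psi>
    proof -
      have "\<Psi> f \<psi> = \<Psi> h \<psi>"
        by (rule local[unfolded locally_determined_def, rule_format, OF assms(1) U(3,1,4) that])
      then show ?thesis using U(5) that(1) by (simp add: vanish_def)
    qed
    then show "\<exists>U. open U \<and> x \<in> U \<and> (\<forall>\<psi>. Cc \<psi> \<longrightarrow> tsupp \<psi> \<subseteq> U \<longrightarrow> \<Psi> f \<psi> = 0)"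
      using U by blast
  qed
qed

text \<open>Up to an affine summand and an affine change of coordinates, an affinely independent
  maximum is a simplex function.\<close>

lemma vanish_pl_of_simplex:
  assumes Z: "\<not> affine_dependent Z" "Z \<noteq> {}" and J: "card Z = Suc (card J)" "vanish (simplex_fn J)"
  shows "vanish (pl Z b)"
proof -
  have finZ: "finite Z" using J(1) card.infinite by fastforce
  obtain p where p: "p \<in> Z" using Z(2) by blast
  define W where "W = (\<lambda>y. - p + y) ` (Z - {p})"
  have "independent W"
    using Z(1) affine_dependent_iff_dependent2[OF p] unfolding W_def by blast
  \<comment> \<open>The edge vectors from \<open>p\<close> are completed to a basis. With this basis
    as rows of \<open>G\<close>, the edges become the coordinates indexed by
    \<open>J\<close>.\<close>
  then obtain B where B: "W \<subseteq> B" "independent B" "span B = UNIV"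
    using independent_extend_basis extend_basis_superset span_extend_basis by (intro that)
  have cardB: "finite B" "card B = CARD('n)"
    using independent_imp_finite[OF B(2)] dim_eq_card[of B UNIV] B by auto
  have "card W = card J"
    unfolding W_def using J(1) p finZ by (subst card_image) (auto simp: inj_on_def)
  then obtain \<beta>1 where \<beta>1: "bij_betw \<beta>1 J W"
    using finite_same_card_bij[of J W] finite_subset[OF B(1) cardB(1)] by (elim meta_impE exE) simp_all
  have "card (UNIV - J) = card (B - W)"
    using \<open>card W = card J\<close> cardB B(1) finite_subset[OF B(1)] by (simp add: card_Diff_subset)
  then obtain \<beta>2 where \<beta>2: "bij_betw \<beta>2 (UNIV - J) (B - W)"
    using finite_same_card_bij[of "UNIV - J" "B - W"] cardB(1) by (elim meta_impE exE) simp_all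
  define \<beta> where "\<beta> i = (if i \<in> J then \<beta>1 i else \<beta>2 i)" for i
  have \<beta>J: "\<beta> ` J = W" using \<beta>1 by (auto simp: \<beta>_def bij_betw_def)
  have "\<beta> ` (UNIV - J) = B - W" using \<beta>2 by (auto simp: \<beta>_def bij_betw_def)
  then have \<beta>B: "range \<beta> = B" using \<beta>J B(1) by blast
  define G :: "real^'n^'n" where "G = (\<chi> i. \<beta> i)"
  have G: "(G *v x) $ i = \<beta> i \<bullet> x" for x i
    by (simp add: G_def matrix_vector_mult_def inner_vec_def)
  have "rows G = B"
    using \<beta>B by (auto simp: rows_def row_def G_def)
  then have inv: "invertible G"
    using matrix_left_invertible_span_rows[of G] B(3) invertible_left_inverse by blast
  obtain G' where G': "\<And>x. G *v (G' *v x) = x" by (rule invertible_inverse_vec[OF inv]) (rule that)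
  \<comment> \<open>All affine pieces with slopes in \<open>Z\<close> take the same value at
    \<open>v\<close>, so \<open>v\<close> is moved to the origin.\<close>
  define v where "v = G' *v (\<chi> j. b p - b (p + \<beta> j))"
  have v: "\<beta> j \<bullet> v = b p - b (p + \<beta> j)" for j
    using G[of v j] unfolding v_def G' by simp
  have Zeq: "Z = insert p ((\<lambda>j. p + \<beta> j) ` J)"
  proof -
    have "(\<lambda>j. p + \<beta> j) ` J = (+) p ` W" by (simp add: \<beta>J[symmetric] image_image)
    also have "\<dots> = Z - {p}" by (auto simp: W_def image_image)
    finally show ?thesis using p by auto
  qed
  have "pl Z b x = simplex_fn J (G *v (x - v)) + p \<bullet> x + b p" for x
  proof -
    have "(\<lambda>y. y \<bullet> x + b y) ` Z = (\<lambda>t. t + (p \<bullet> x + b p)) ` insert 0 ((\<lambda>j. (G *v (x - v)) $ j) ` J)"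
      unfolding Zeq image_insert image_image G
      by (intro arg_cong2[where f=insert] image_cong) (auto simp: inner_diff_right v inner_add_left)
    then show ?thesis
      unfolding pl_def simplex_fn_def
      using Max_add_commute[of "insert 0 ((\<lambda>j. (G *v (x - v)) $ j) ` J)" "\<lambda>t. t" "p \<bullet> x + b p"]
      by (simp add: add.assoc)
  qed
  then have eq: "pl Z b = (\<lambda>x. simplex_fn J (G *v (x - v)) + p \<bullet> x + b p)" by blast
  have "(\<lambda>x. simplex_fn J (G *v x)) \<in> Conv" "vanish (\<lambda>x. simplex_fn J (G *v x))"
    by (intro Conv_matrix vanish_GL inv simplex_fn_Conv J(2))+
  from Conv_translate[OF this(1), of v] vanish_translate[OF this, of v]
  show ?thesis unfolding eq by (rule vanish_affine)
qed

lemma affine_independent_simplex_vertices: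
  "\<not> affine_dependent (insert 0 ((\<lambda>j. axis j 1 :: real^'n) ` J))"
proof -
  have "(\<lambda>j. axis j 1 :: real^'n) ` J \<subseteq> Basis" by (auto simp: axis_in_Basis_iff)
  then have "independent ((\<lambda>j. axis j 1 :: real^'n) ` J)"
    using independent_Basis independent_mono by blast
  moreover have "0 \<notin> (\<lambda>j. axis j 1 :: real^'n) ` J" by auto
  ultimately show ?thesis by (simp add: affine_dependent_iff_dependent)
qed

text \<open>Off the face some vertex of the simplex is inactive, so the function is locally a
  maximum over fewer affinely independent slopes and the induction hypothesis on smaller index sets
  applies.\<close>

lemma simplex_fn_zero_off_face:
  assumes "\<And>K. card K < card J \<Longrightarrow> vanish (simplex_fn K)"
    and "Cc \<phi>" "tsupp \<phi> \<inter> {x. \<forall>j\<in>J. x$j = 0} = {}"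
  shows "\<Psi> (simplex_fn J) \<phi> = 0"
proof (rule zero_of_locally_vanish[OF simplex_fn_Conv assms(2)])
  fix x assume "x \<in> tsupp \<phi>"
  let ?Y = "insert 0 ((\<lambda>j. axis j 1 :: real^'n) ` J)"
  define Z where "Z = {y \<in> ?Y. y \<bullet> x + 0 = pl ?Y (\<lambda>_. 0) x}"
  obtain U where U: "Z \<noteq> {}" "open U" "x \<in> U" "\<And>z. z \<in> U \<Longrightarrow> pl ?Y (\<lambda>_. 0) z = pl Z (\<lambda>_. 0) z"
    by (rule pl_active[OF _ _ Z_def]) (simp, simp, rule that)
  have "Z \<noteq> ?Y"
  proof
    assume Z: "Z = ?Y"
    have "y \<bullet> x = 0" if "y \<in> ?Y" for y
    proof -
      have "y \<in> Z" "0 \<in> Z" using that unfolding Z by auto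
      then have "y \<bullet> x + 0 = 0 \<bullet> x + 0" unfolding Z_def by simp
      then show ?thesis by simp
    qed
    from this[of "axis j 1" for j] have "x \<in> {x. \<forall>j\<in>J. x$j = 0}" by (simp add: inner_axis')
    then show False using assms(3) \<open>x \<in> tsupp \<phi>\<close> by blast
  qed
  moreover have "Z \<subseteq> ?Y" unfolding Z_def by blast
  ultimately have "card Z < card ?Y" by (intro psubset_card_mono) auto
  also have "card ?Y \<le> Suc (card J)"
    using card_image_le[of J "\<lambda>j. axis j 1 :: real^'n"] by (simp add: card_insert_if)
  finally have "card Z < Suc (card J)" .
  moreover have "card Z > 0"
    using U(1) finite_subset[OF \<open>Z \<subseteq> ?Y\<close>] by (auto simp: card_gt_0_iff)
  ultimately have "card Z - 1 < card J" by linarith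
  \<comment> \<open>The set \<open>Z\<close> spans a simplex of dimension \<open>card Z - 1\<close>;
    any index set of that size serves.\<close>
  obtain K where "K \<subseteq> J" "card K = card Z - 1"
    by (rule obtain_subset_with_card_n[of "card Z - 1" J]) (use \<open>card Z - 1 < card J\<close> in auto)
  then have "vanish (pl Z (\<lambda>_. 0))"
    using \<open>card Z - 1 < card J\<close> \<open>card Z > 0\<close>
    by (intro vanish_pl_of_simplex[of Z K] assms(1) U(1)
        affine_independent_subset[OF affine_independent_simplex_vertices \<open>Z \<subseteq> ?Y\<close>]) simp_all
  moreover have "pl Z (\<lambda>_. 0) \<in> Conv"
    using finite_subset[OF \<open>Z \<subseteq> ?Y\<close>] U(1) by (intro pl_Conv) auto
  ultimately show "\<exists>U h. open U \<and> x \<in> U \<and> h \<in> Conv \<and> (\<forall>z\<in>U. simplex_fn J z = h z) \<and> vanish h"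
    using U unfolding simplex_fn_eq_pl by (intro exI[of _ U] exI[of _ "pl Z (\<lambda>_. 0)"]) simp
qed

lemma vanish_generic_pl:
  assumes "\<And>J. vanish (simplex_fn J)" "finite Y" "Y \<noteq> {}" "generic Y b"
  shows "vanish (pl Y b)"
  unfolding vanish_def
proof (intro allI impI zero_of_locally_vanish[OF pl_Conv[OF assms(2,3)]])
  fix x
  define Z where "Z = {y \<in> Y. y \<bullet> x + b y = pl Y b x}"
  obtain U where U: "Z \<noteq> {}" "open U" "x \<in> U" "\<And>z. z \<in> U \<Longrightarrow> pl Y b z = pl Z b z"
    by (rule pl_active[OF assms(2,3) Z_def]) (rule that)
  have "finite Z" "Z \<subseteq> Y" unfolding Z_def using assms(2) by auto
  moreover have ind: "\<not> affine_dependent Z"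
    by (rule assms(4)[unfolded generic_def, rule_format, OF \<open>Z \<subseteq> Y\<close>]) (auto simp: Z_def)
  \<comment> \<open>At most n + 1 points are affinely independent, which leaves room for an index
    set of size \<open>card Z - 1\<close>.\<close>
  then have "card Z \<le> CARD('n) + 1"
    using affine_independent_card_dim_diffs[of Z] aff_dim_le_DIM[of Z] affine_independent_iff_card[of Z] by auto
  then have "card Z - 1 \<le> CARD('n)" by simp
  then obtain J :: "'n set" where "card J = card Z - 1"
    by (rule obtain_subset_with_card_n)
  then have "vanish (pl Z b)"
    using U(1) \<open>finite Z\<close> by (intro vanish_pl_of_simplex[OF ind U(1) _ assms(1), of J]) (simp add: card_gt_0_iff)
  ultimately show "\<exists>U h. open U \<and> x \<in> U \<and> h \<in> Conv \<and> (\<forall>z\<in>U. pl Y b z = h z) \<and> vanish h"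
    using U pl_Conv[OF \<open>finite Z\<close> U(1)] by (intro exI[of _ U] exI[of _ "pl Z b"]) simp
qed

text \<open>Generic piecewise affine functions that are 1/(j+1)-close to \<open>f\<close> on the
  ball of radius j converge locally uniformly, and continuity carries the vanishing to the
  limit.\<close>

lemma vanish_all:
  assumes "\<And>J. vanish (simplex_fn J)" "f \<in> Conv"
  shows "vanish f"
  unfolding vanish_def
proof (intro allI impI)
  fix \<phi> :: "real^'n \<Rightarrow> complex" assume \<phi>: "Cc \<phi>"
  have "\<forall>j. \<exists>h. h \<in> Conv \<and> vanish h \<and> (\<forall>x\<in>cball 0 (real j). \<bar>h x - f x\<bar> < inverse (real (Suc j)))"
  proof
    fix j
    have "inverse (real (Suc j)) > 0" by simp
    from generic_pl_approx[OF assms(2) this of_nat_0_le_iff[of j]] obtain Y b where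
      Y: "finite Y" "Y \<noteq> {}" "generic Y b" "\<forall>x\<in>cball 0 (real j). \<bar>pl Y b x - f x\<bar> < inverse (real (Suc j))"
      by (elim exE conjE)
    then show "\<exists>h. h \<in> Conv \<and> vanish h \<and> (\<forall>x\<in>cball 0 (real j). \<bar>h x - f x\<bar> < inverse (real (Suc j)))"
      using pl_Conv[OF Y(1,2)] vanish_generic_pl[OF assms(1) Y(1-3)] by (intro exI[of _ "pl Y b"] conjI)
  qed
  from choice[OF this] obtain h where
    hh: "\<forall>j. h j \<in> Conv \<and> vanish (h j) \<and> (\<forall>x\<in>cball 0 (real j). \<bar>h j x - f x\<bar> < inverse (real (Suc j)))" ..
  then have h: "\<And>j. h j \<in> Conv" "\<And>j. vanish (h j)"
    "\<And>j x. x \<in> cball 0 (real j) \<Longrightarrow> \<bar>h j x - f x\<bar> < inverse (real (Suc j))"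
    by simp_all
  have "loc_unif_conv h f"
    unfolding loc_unif_conv_def
  proof (intro allI impI)
    fix K :: "(real^'n) set" and e :: real
    assume K: "compact K" and e: "e > 0"
    obtain R where R: "\<And>x. x \<in> K \<Longrightarrow> norm x \<le> R"
      using compact_imp_bounded[OF K] unfolding bounded_iff by blast
    obtain N1 where N1: "R \<le> real N1" using real_arch_simple by blast
    obtain N2 where N2: "inverse (real (Suc N2)) < e" using reals_Archimedean[OF e] by blast
    show "eventually (\<lambda>j. \<forall>x\<in>K. \<bar>h j x - f x\<bar> < e) sequentially"
      using eventually_ge_at_top[of "max N1 N2"]
    proof eventually_elim
      case (elim j)
      show ?case
      proof
        fix x assume "x \<in> K"
        then have "norm x \<le> real j" using R[of x] N1 elim by (smt (verit) max.bounded_iff of_nat_le_iff)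
        then have "\<bar>h j x - f x\<bar> < inverse (real (Suc j))" using h(3) by auto
        also have "\<dots> \<le> inverse (real (Suc N2))" using elim by (intro le_imp_inverse_le) auto
        finally show "\<bar>h j x - f x\<bar> < e" using N2 by linarith
      qed
    qed
  qed
  then have "(\<lambda>j. \<Psi> (h j) \<phi>) \<longlonglongrightarrow> \<Psi> f \<phi>"
    using continuous[unfolded mval_continuous_def, rule_format, OF h(1) assms(2)] \<phi> by simp
  moreover have "\<Psi> (h j) \<phi> = 0" for j using h(2)[of j] \<phi> by (simp add: vanish_def)
  ultimately show "\<Psi> f \<phi> = 0" by (simp add: LIMSEQ_const_iff)
qed

end

section \<open>Translation-invariant Radon functionals\<close>

lemma uniformly_continuous_compact_support:
  fixes H :: "'a::euclidean_space \<Rightarrow> 'b::real_normed_vector"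
  assumes "continuous_on UNIV H" and supp: "\<And>x. H x \<noteq> 0 \<Longrightarrow> norm x \<le> R"
  shows "uniformly_continuous_on UNIV H"
  unfolding uniformly_continuous_on_def
proof (intro allI impI)
  fix e :: real assume e: "e > 0"
  have "uniformly_continuous_on (cball 0 (R + 1)) H"
    using assms(1) by (intro compact_uniformly_continuous continuous_on_subset[OF assms(1)]) auto
  then obtain d where d: "d > 0"
    "\<And>x y. x \<in> cball 0 (R + 1) \<Longrightarrow> y \<in> cball 0 (R + 1) \<Longrightarrow> dist y x < d \<Longrightarrow> dist (H y) (H x) < e"
    using e unfolding uniformly_continuous_on_def by (metis (no_types))
  \<comment> \<open>With steps shorter than 1, a pair not contained in the ball of radius
    \<open>R + 1\<close> lies outside radius \<open>R\<close> altogether, where \<open>H\<close> is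
    0.\<close>
  have "dist (H y) (H x) < e" if "dist y x < min d 1" for x y
  proof (cases "x \<in> cball 0 (R + 1) \<and> y \<in> cball 0 (R + 1)")
    case False
    have "\<bar>norm y - norm x\<bar> \<le> dist y x" by (metis dist_norm norm_triangle_ineq3)
    then have "norm x > R" "norm y > R" using False that by auto
    then have "H x = 0" "H y = 0" using supp[of x] supp[of y] by force+
    then show ?thesis using e by simp
  qed (use d that in auto)
  then show "\<exists>d>0. \<forall>x\<in>UNIV. \<forall>x'\<in>UNIV. dist x' x < d \<longrightarrow> dist (H x') (H x) < e"
    using d(1) by (intro exI[of _ "min d 1"]) auto
qed

lemma Cc_support_ball:
  assumes "Cc \<phi>" obtains R where "R \<ge> 0" "\<And>x. \<phi> x \<noteq> 0 \<Longrightarrow> norm x \<le> R"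
proof -
  obtain R where R: "\<forall>x\<in>tsupp \<phi>. norm x \<le> R"
    using compact_imp_bounded[OF Cc_compact_tsupp[OF assms]] unfolding bounded_iff by (elim exE)
  show ?thesis
  proof (rule that[of "max R 0"])
    show "norm x \<le> max R 0" if "\<phi> x \<noteq> 0" for x
      using R in_tsupp[of \<phi> x, OF that] by (simp add: max.coboundedI1)
  qed simp
qed

text \<open>Connects the gauge integral over a box, used below for Banach-valued maps, with the
  Lebesgue integral.\<close>

lemma integral_cbox_eq_lborel:
  fixes f :: "'a::euclidean_space \<Rightarrow> complex"
  assumes "continuous_on UNIV f" "\<And>x. f x \<noteq> 0 \<Longrightarrow> x \<in> cbox a b"
  shows "integrable lborel f" "integral (cbox a b) f = (LINT x|lborel. f x)"
proof -
  have eq: "(\<lambda>x. indicator (cbox a b) x *\<^sub>R f x) = f"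
    using assms(2) by (auto simp: fun_eq_iff indicator_def)
  show int: "integrable lborel f"
    using borel_integrable_compact[OF compact_cbox continuous_on_subset[OF assms(1)], of a b] unfolding eq by simp
  then have "set_integrable lborel (cbox a b) f"
    unfolding set_integrable_def eq .
  from set_borel_integral_eq_integral(2)[OF this]
  show "integral (cbox a b) f = (LINT x|lborel. f x)"
    unfolding set_lebesgue_integral_def eq by simp
qed

lemma norm_ball_subset_cbox:
  obtains a b :: "'a::euclidean_space" where "\<And>x. norm x \<le> R \<Longrightarrow> x \<in> cbox a b"
  using bounded_subset_cbox_symmetric[OF bounded_cball, of 0 R] by (metis mem_cball_0 subsetD)

lemma Cc_integrable: "Cc \<phi> \<Longrightarrow> integrable lborel \<phi>"
  by (metis Cc_continuous Cc_support_ball integral_cbox_eq_lborel(1) norm_ball_subset_cbox)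

text \<open>Completeness makes continuous maps into this space integrable over boxes.\<close>

instance bcontfun :: (metric_space, banach) banach ..

text \<open>The functional is moved inside the integral by viewing the integrand as a continuous map
  into the Banach space of bounded continuous functions.\<close>

lemma radon_integral_exchange:
  fixes L :: "(real^'n::finite \<Rightarrow> complex) \<Rightarrow> complex" and \<sigma> :: real
  assumes "radon L" "Cc \<alpha>" "Cc \<beta>" and inv: "\<And>z. L (\<lambda>x. \<beta> (x + z)) = L \<beta>"
  shows "L (\<lambda>x. LINT z|lborel. \<alpha> z * \<beta> (x + \<sigma> *\<^sub>R z)) = (LINT z|lborel. \<alpha> z) * L \<beta>"
proof -
  interpret L: radon L by fact
  obtain A where A: "A \<ge> 0" "\<And>x. \<alpha> x \<noteq> 0 \<Longrightarrow> norm x \<le> A" by (rule Cc_support_ball[OF assms(2)]) (rule that)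
  obtain B where B: "B \<ge> 0" "\<And>x. \<beta> x \<noteq> 0 \<Longrightarrow> norm x \<le> B" by (rule Cc_support_ball[OF assms(3)]) (rule that)
  define R where "R = B + \<bar>\<sigma>\<bar> * A"
  have R: "norm x \<le> R" "norm z \<le> A" if "\<alpha> z * \<beta> (x + \<sigma> *\<^sub>R z) \<noteq> 0" for x z
  proof -
    have *: "norm z \<le> A" "norm (x + \<sigma> *\<^sub>R z) \<le> B" using that A(2) B(2) by auto
    have "norm x \<le> norm (x + \<sigma> *\<^sub>R z) + norm (\<sigma> *\<^sub>R z)" by (metis add_diff_cancel norm_triangle_ineq4)
    also have "\<dots> \<le> B + \<bar>\<sigma>\<bar> * A" using * by (intro add_mono) (auto intro: mult_left_mono)
    finally show "norm x \<le> R" "norm z \<le> A" using * by (auto simp: R_def)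
  qed
  define H where "H = (\<lambda>(z, x). \<alpha> z * \<beta> (x + \<sigma> *\<^sub>R z))"
  have contH: "continuous_on UNIV H"
    unfolding H_def case_prod_unfold
    by (intro continuous_intros continuous_on_compose2[OF Cc_continuous[OF assms(2), of UNIV]]
        continuous_on_compose2[OF Cc_continuous[OF assms(3), of UNIV]]) auto
  have "norm p \<le> A + R" if "H p \<noteq> 0" for p
    using R[of "fst p" "snd p"] that norm_Pair_le[of "fst p" "snd p"] by (force simp: H_def case_prod_unfold)
  then have unif: "uniformly_continuous_on UNIV H"
    by (rule uniformly_continuous_compact_support[OF contH])
  obtain MA where MA: "\<And>x. norm (\<alpha> x) \<le> MA" using Cc_bounded[OF assms(2)] by (rule that)
  obtain MB where MB: "\<And>x. norm (\<beta> x) \<le> MB" using Cc_bounded[OF assms(3)] by (rule that)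
  define F where "F z = Bcontfun (\<lambda>x. \<alpha> z * \<beta> (x + \<sigma> *\<^sub>R z))" for z
  have F: "apply_bcontfun (F z) = (\<lambda>x. \<alpha> z * \<beta> (x + \<sigma> *\<^sub>R z))" for z
    unfolding F_def
  proof (rule Bcontfun_inverse, rule bcontfun_normI)
    show "continuous_on UNIV (\<lambda>x. \<alpha> z * \<beta> (x + \<sigma> *\<^sub>R z))"
      by (intro continuous_intros continuous_on_compose2[OF Cc_continuous[OF assms(3), of UNIV]]) auto
    have "0 \<le> MA" using order_trans[OF norm_ge_zero MA[of 0]] .
    then show "norm (\<alpha> z * \<beta> (x + \<sigma> *\<^sub>R z)) \<le> MA * MB" for x
      unfolding norm_mult by (intro mult_mono MA MB) auto
  qed
  \<comment> \<open>Joint uniform continuity of \<open>H\<close> is what gives continuity for the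
    supremum norm.\<close>
  have contF: "continuous_on UNIV F"
    unfolding continuous_on_iff
  proof (intro ballI allI impI)
    fix z and e :: real assume "e > 0"
    then have "e/2 > 0" by simp
    then obtain d where d: "d > 0" "\<And>p p'. dist p' p < d \<Longrightarrow> dist (H p') (H p) < e/2"
      using unif unfolding uniformly_continuous_on_def by (metis (no_types) UNIV_I)
    have "dist (F z') (F z) < e" if "dist z' z < d" for z'
    proof -
      have "dist (F z') (F z) \<le> e/2"
      proof (rule dist_bound)
        fix x :: "real^'n"
        have "dist (z', x) (z, x) < d" using that by (simp add: dist_Pair_Pair)
        from d(2)[OF this] show "dist (apply_bcontfun (F z') x) (apply_bcontfun (F z) x) \<le> e/2"
          by (simp add: F H_def)
      qed
      then show ?thesis using \<open>e > 0\<close> by simp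
    qed
    then show "\<exists>d>0. \<forall>x'\<in>UNIV. dist x' z < d \<longrightarrow> dist (F x') (F z) < e" using d(1) by auto
  qed
  \<comment> \<open>A bounded continuous function need not have compact support, so it is cut off
    before \<open>L\<close> is applied. The cutoff is 1 wherever an integrand can be nonzero, and
    its fixed compact support makes \<open>L'\<close> a bounded linear map.\<close>
  define \<eta> :: "real^'n \<Rightarrow> complex" where "\<eta> x = of_real (max 0 (min 1 (R + 1 - norm x)))" for x
  have \<eta>1: "\<eta> x = 1" if "norm x \<le> R" for x using that by (simp add: \<eta>_def)
  have Cc\<eta>: "Cc \<eta>"
  proof (rule CcI[of _ "cball 0 (R + 1)"])
    show "continuous_on UNIV \<eta>" unfolding \<eta>_def by (intro continuous_intros)
    show "x \<in> cball 0 (R + 1)" if "\<eta> x \<noteq> 0" for x using that by (auto simp: \<eta>_def max_def min_def split: if_splits)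
  qed simp
  have \<eta>b: "norm (\<eta> x) \<le> 1" for x unfolding \<eta>_def norm_of_real by simp
  define L' where "L' G = L (\<lambda>x. \<eta> x * apply_bcontfun G x)" for G
  have CcG: "Cc (\<lambda>x. \<eta> x * apply_bcontfun G x)" "tsupp (\<lambda>x. \<eta> x * apply_bcontfun G x) \<subseteq> tsupp \<eta>" for G
    by (intro Cc_mult Cc\<eta> continuous_on_apply_bcontfun)+
  obtain C where C: "C \<ge> 0"
    "\<And>\<phi> B. Cc \<phi> \<Longrightarrow> tsupp \<phi> \<subseteq> tsupp \<eta> \<Longrightarrow> (\<And>x. norm (\<phi> x) \<le> B) \<Longrightarrow> norm (L \<phi>) \<le> C * B"
    using L.bound[OF Cc_compact_tsupp[OF Cc\<eta>]] by blast
  have bl: "bounded_linear L'"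
  proof (rule bounded_linear_intro)
    show "L' (G + G') = L' G + L' G'" for G G'
      unfolding L'_def using L.add[OF CcG(1)[of G] CcG(1)[of G']] by (simp add: distrib_left)
    show "L' (r *\<^sub>R G) = r *\<^sub>R L' G" for r G
      unfolding L'_def using L.cmult[OF CcG(1)[of G], of "of_real r"]
      by (simp add: scaleR_conv_of_real mult.left_commute)
    show "norm (L' G) \<le> norm G * C" for G
      unfolding L'_def mult.commute[of "norm G"]
    proof (rule C(2)[OF CcG])
      show "norm (\<eta> x * apply_bcontfun G x) \<le> norm G" for x
        unfolding norm_mult using mult_mono[OF \<eta>b[of x] norm_bounded[of G x]] by simp
    qed
  qed
  obtain a b :: "real^'n" where box: "\<And>x. norm x \<le> A \<Longrightarrow> x \<in> cbox a b" by (rule norm_ball_subset_cbox) (rule that)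
  have intF: "F integrable_on cbox a b"
    by (rule integrable_continuous[OF continuous_on_subset[OF contF]]) simp
  have ev: "bounded_linear (\<lambda>G. apply_bcontfun G x)" for x :: "real^'n"
    by (rule bounded_linear_intro[where K=1]) (auto intro: norm_bounded)
  have \<Phi>: "apply_bcontfun (integral (cbox a b) F) x = (LINT z|lborel. \<alpha> z * \<beta> (x + \<sigma> *\<^sub>R z))" for x
  proof -
    have "apply_bcontfun (integral (cbox a b) F) x = integral (cbox a b) (\<lambda>z. \<alpha> z * \<beta> (x + \<sigma> *\<^sub>R z))"
      using integral_linear[OF intF ev[of x]] by (simp add: o_def F)
    also have "\<dots> = (LINT z|lborel. \<alpha> z * \<beta> (x + \<sigma> *\<^sub>R z))"
    proof (rule integral_cbox_eq_lborel(2))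
      show "continuous_on UNIV (\<lambda>z. \<alpha> z * \<beta> (x + \<sigma> *\<^sub>R z))"
        by (intro continuous_intros Cc_continuous[OF assms(2)]
            continuous_on_compose2[OF Cc_continuous[OF assms(3), of UNIV]]) auto
    qed (use R(2) box in blast)
    finally show ?thesis .
  qed
  have "L' (integral (cbox a b) F) = integral (cbox a b) (\<lambda>z. L' (F z))"
    using integral_linear[OF intF bl] by (simp add: o_def)
  also have "\<dots> = integral (cbox a b) (\<lambda>z. \<alpha> z * L \<beta>)"
  proof (rule integral_cong)
    fix z
    have "(\<lambda>x. \<eta> x * apply_bcontfun (F z) x) = (\<lambda>x. \<alpha> z * \<beta> (x + \<sigma> *\<^sub>R z))"
    proof
      fix x show "\<eta> x * apply_bcontfun (F z) x = \<alpha> z * \<beta> (x + \<sigma> *\<^sub>R z)"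
        using \<eta>1[of x] R(1)[of z x] unfolding F by (cases "\<alpha> z * \<beta> (x + \<sigma> *\<^sub>R z) = 0") auto
    qed
    then show "L' (F z) = \<alpha> z * L \<beta>"
      unfolding L'_def using L.cmult[OF Cc_translate[OF assms(3)], of "\<alpha> z" "\<sigma> *\<^sub>R z"] inv by simp
  qed
  also have "\<dots> = (LINT z|lborel. \<alpha> z * L \<beta>)"
  proof (rule integral_cbox_eq_lborel(2))
    show "continuous_on UNIV (\<lambda>z. \<alpha> z * L \<beta>)" by (intro continuous_intros Cc_continuous[OF assms(2)])
  qed (use A(2) box in auto)
  finally have "L' (integral (cbox a b) F) = (LINT z|lborel. \<alpha> z) * L \<beta>" by simp
  moreover have "\<eta> x * apply_bcontfun (integral (cbox a b) F) x = (LINT z|lborel. \<alpha> z * \<beta> (x + \<sigma> *\<^sub>R z))" for x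
  proof (cases "norm x \<le> R")
    case False
    then have "(\<lambda>z. \<alpha> z * \<beta> (x + \<sigma> *\<^sub>R z)) = (\<lambda>z. 0)" using R(1)[of _ x] by blast
    then show ?thesis unfolding \<Phi> by simp
  qed (simp add: \<Phi> \<eta>1)
  ultimately show ?thesis unfolding L'_def by simp
qed

text \<open>Uniqueness of Haar measure by convolution: \<open>L\<close> of the convolution of
  \<open>\<phi>\<close> with an even bump \<open>\<psi>\<close> is computed twice, with either
  factor as the translated one. This gives the symmetric identity
  \<open>L \<phi> * \<integral>\<psi> = L \<psi> * \<integral>\<phi>\<close>.\<close>

lemma translation_invariant_radon_lebesgue:
  fixes L :: "(real^'n::finite \<Rightarrow> complex) \<Rightarrow> complex"
  assumes "radon L" and inv: "\<And>\<phi> z. Cc \<phi> \<Longrightarrow> L (\<lambda>x. \<phi> (x + z)) = L \<phi>"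
  shows "\<exists>c. \<forall>\<phi>. Cc \<phi> \<longrightarrow> L \<phi> = c * (LINT x|lborel. \<phi> x)"
proof -
  define \<psi> :: "real^'n \<Rightarrow> complex" where "\<psi> x = of_real (max 0 (1 - norm x))" for x
  have Cc\<psi>: "Cc \<psi>"
  proof (rule CcI[of _ "cball 0 1"])
    show "continuous_on UNIV \<psi>" unfolding \<psi>_def by (intro continuous_intros)
    show "x \<in> cball 0 1" if "\<psi> x \<noteq> 0" for x using that by (auto simp: \<psi>_def max_def split: if_splits)
  qed simp
  have sym: "\<psi> (- x) = \<psi> x" for x by (simp add: \<psi>_def)
  have "(LINT x|lborel. \<psi> x) \<noteq> 0"
  proof
    assume 0: "(LINT x|lborel. \<psi> x) = 0"
    have "(LINT x|lborel. \<psi> x) = of_real (LINT x|lborel. max 0 (1 - norm (x::real^'n)))"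
      unfolding \<psi>_def by simp
    then have "(LINT x|lborel. max 0 (1 - norm (x::real^'n))) = 0" using 0 by simp
    moreover have int: "integrable lborel (\<lambda>x::real^'n. max 0 (1 - norm x))"
      using integrable_Re[OF Cc_integrable[OF Cc\<psi>]] by (simp add: \<psi>_def)
    ultimately have "AE x in lborel. max 0 (1 - norm (x::real^'n)) = 0"
      by (subst (asm) integral_nonneg_eq_0_iff_AE) auto
    then have "AE x in lborel. x \<notin> ball (0::real^'n) 1"
      by eventually_elim (auto simp: max_def split: if_splits)
    then have "ball (0::real^'n) 1 \<in> null_sets lborel" by (subst (asm) AE_iff_null_sets[symmetric]) auto
    then have "negligible (ball (0::real^'n) 1)"
      unfolding negligible_iff_null_sets by (rule null_sets_completionI)
    then show False using open_not_negligible[of "ball (0::real^'n) 1"] by simp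
  qed
  moreover have "L \<phi> * (LINT x|lborel. \<psi> x) = L \<psi> * (LINT x|lborel. \<phi> x)" if \<phi>: "Cc \<phi>" for \<phi>
  proof -
    have "(LINT z|lborel. \<psi> z) * L \<phi> = L (\<lambda>x. LINT z|lborel. \<psi> z * \<phi> (x + 1 *\<^sub>R z))"
      using radon_integral_exchange[OF assms(1) Cc\<psi> \<phi>, of 1] inv[OF \<phi>] by simp
    \<comment> \<open>Substitute \<open>w = x + z\<close> and use that \<open>\<psi>\<close> is
      even; the two sides have the form of the exchange lemma with \<open>\<sigma>\<close> equal to
      1 and to -1.\<close>
    also have "(\<lambda>x. LINT z|lborel. \<psi> z * \<phi> (x + 1 *\<^sub>R z)) = (\<lambda>x. LINT w|lborel. \<phi> w * \<psi> (x + (-1) *\<^sub>R w))"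
    proof
      fix x
      have [measurable]: "\<phi> \<in> borel_measurable borel" "\<psi> \<in> borel_measurable borel"
        using \<phi> Cc\<psi> by (auto intro: Cc_borel_measurable)
      have "(LINT w|lborel. \<phi> w * \<psi> (x + (-1) *\<^sub>R w)) = (LINT z|lborel. \<phi> (x + z) * \<psi> (x + (-1) *\<^sub>R (x + z)))"
        by (rule lborel_integral_translation[symmetric]) measurable
      then show "(LINT z|lborel. \<psi> z * \<phi> (x + 1 *\<^sub>R z)) = (LINT w|lborel. \<phi> w * \<psi> (x + (-1) *\<^sub>R w))"
        by (simp add: sym mult.commute)
    qed
    also have "L \<dots> = (LINT w|lborel. \<phi> w) * L \<psi>"
      by (rule radon_integral_exchange[OF assms(1) \<phi> Cc\<psi> inv[OF Cc\<psi>]])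
    finally show ?thesis by (simp add: mult.commute)
  qed
  ultimately show ?thesis
    by (intro exI[of _ "L \<psi> / (LINT x|lborel. \<psi> x)"]) (simp add: field_simps)
qed

section \<open>The Monge--Ampere measure\<close>

definition subgradient_image :: "(real^'n::finite \<Rightarrow> real) \<Rightarrow> (real^'n) set \<Rightarrow> (real^'n) set" where
  "subgradient_image f S = (\<Union>x\<in>S. subgradients f x)"

text \<open>These are the slopes at which the subdifferential of the convex conjugate has more than
  one element.\<close>

definition multi_subgradients :: "(real^'n::finite \<Rightarrow> real) \<Rightarrow> (real^'n) set" where
  "multi_subgradients f = {y. \<exists>x x'. x \<noteq> x' \<and> y \<in> subgradients f x \<and> y \<in> subgradients f x'}"

definition single_subgradients :: "(real^'n::finite \<Rightarrow> real) \<Rightarrow> (real^'n) set" where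
  "single_subgradients f = {y. \<exists>!x. y \<in> subgradients f x}"

text \<open>On single slopes this is the gradient of the convex conjugate.\<close>

definition contact_point :: "(real^'n::finite \<Rightarrow> real) \<Rightarrow> real^'n \<Rightarrow> real^'n" where
  "contact_point f y = (THE x. y \<in> subgradients f x)"

definition ma_integrand :: "(real^'n::finite \<Rightarrow> real) \<Rightarrow> (real^'n \<Rightarrow> complex) \<Rightarrow> real^'n \<Rightarrow> complex" where
  "ma_integrand f \<phi> y = (if y \<in> single_subgradients f then \<phi> (contact_point f y) else 0)"

text \<open>The Monge-Ampere integral in slope coordinates: the measure is always Lebesgue measure
  and \<open>f\<close> enters the integrand alone, so substitution and dominated convergence are
  available.\<close>

definition ma :: "'n::finite mval" where
  "ma f \<phi> = (LINT y|lborel. ma_integrand f \<phi> y)"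

lemma subgradientsD: "y \<in> subgradients f x \<Longrightarrow> f x + y \<bullet> (z - x) \<le> f z"
  by (simp add: subgradients_def)

lemma subgradientsI: "(\<And>z. f x + y \<bullet> (z - x) \<le> f z) \<Longrightarrow> y \<in> subgradients f x"
  by (simp add: subgradients_def)

lemma contact_point_eq:
  assumes "y \<in> single_subgradients f"
  shows "y \<in> subgradients f x \<longleftrightarrow> x = contact_point f y"
proof -
  have ex: "\<exists>!x. y \<in> subgradients f x" using assms by (simp add: single_subgradients_def)
  have "y \<in> subgradients f (contact_point f y)" unfolding contact_point_def by (rule theI'[OF ex])
  then show ?thesis using ex by metis
qed

lemma single_subgradientsI:
  assumes "y \<in> subgradients f x" "y \<notin> multi_subgradients f"
  shows "y \<in> single_subgradients f" "contact_point f y = x"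
proof -
  show s: "y \<in> single_subgradients f"
    using assms unfolding single_subgradients_def multi_subgradients_def by blast
  show "contact_point f y = x" using contact_point_eq[OF s] assms(1) by simp
qed

lemma single_subgradients_eq:
  "single_subgradients f = subgradient_image f UNIV - multi_subgradients f"
  unfolding single_subgradients_def subgradient_image_def multi_subgradients_def by blast

lemma ma_integrand_nonzero:
  assumes "ma_integrand f \<phi> y \<noteq> 0"
  obtains x where "y \<in> subgradients f x" "\<phi> x \<noteq> 0" "ma_integrand f \<phi> y = \<phi> x"
  using assms contact_point_eq[of y f "contact_point f y"]
  by (auto simp: ma_integrand_def split: if_splits)

section \<open>Compactness of subgradient images\<close>

text \<open>A unit step from \<open>x\<close> in the direction of \<open>y\<close> raises the
  supporting plane by \<open>norm y\<close>, while \<open>f\<close> changes by at most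
  \<open>2 * M\<close> on the enlarged ball.\<close>

lemma subgradient_bound:
  assumes y: "y \<in> subgradients f x" and "norm x \<le> R"
    and M: "\<And>z. norm z \<le> R + 1 \<Longrightarrow> \<bar>f z\<bar> \<le> M"
  shows "norm y \<le> 2 * M"
proof (cases "y = 0")
  case True
  have "0 \<le> \<bar>f x\<bar>" by simp
  also have "\<dots> \<le> M" using assms(2) by (intro M) simp
  finally show ?thesis using True by simp
next
  case False
  let ?z = "x + y /\<^sub>R norm y"
  have "norm ?z \<le> norm x + norm (y /\<^sub>R norm y)" by (rule norm_triangle_ineq)
  then have "norm ?z \<le> R + 1" using assms(2) False by simp
  moreover have "f x + y \<bullet> (?z - x) \<le> f ?z" by (rule subgradientsD[OF y])
  moreover have "y \<bullet> (?z - x) = norm y" using False by (simp add: dot_square_norm power2_eq_square)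
  ultimately show ?thesis using M[of ?z] M[of x] assms(2) by simp
qed

lemma Conv_bounded_on_ball:
  fixes f :: "real^'n::finite \<Rightarrow> real"
  assumes "f \<in> Conv"
  obtains M where "\<And>z. norm z \<le> R \<Longrightarrow> \<bar>f z\<bar> \<le> M"
proof -
  have "bounded (f ` cball 0 R)"
    by (intro compact_imp_bounded compact_continuous_image Conv_continuous[OF assms] compact_cball)
  then obtain M where "\<forall>t\<in>f ` cball 0 R. norm t \<le> M" unfolding bounded_iff by (elim exE)
  then show ?thesis by (intro that[of M]) auto
qed

text \<open>Over \<open>K\<close> the graph of the subgradient relation is bounded and is cut out by
  inequalities continuous in both variables. The image is a projection of this compact
  graph.\<close>

lemma compact_subgradient_image:
  fixes f :: "real^'n::finite \<Rightarrow> real"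
  assumes "f \<in> Conv" "compact K"
  shows "compact (subgradient_image f K)"
proof -
  let ?G = "{p. fst p \<in> K \<and> snd p \<in> subgradients f (fst p)}"
  obtain R where R: "\<forall>x\<in>K. norm x \<le> R" using compact_imp_bounded[OF assms(2)] unfolding bounded_iff by (elim exE)
  obtain M where M: "\<And>z. norm z \<le> R + 1 \<Longrightarrow> \<bar>f z\<bar> \<le> M"
    by (rule Conv_bounded_on_ball[OF assms(1), of "R + 1"]) (rule that)
  have "?G \<subseteq> K \<times> cball 0 (2 * M)"
  proof
    fix p assume p: "p \<in> ?G"
    then have *: "snd p \<in> subgradients f (fst p)" "norm (fst p) \<le> R" using R by auto
    have "norm (snd p) \<le> 2 * M" by (rule subgradient_bound[OF *]) (rule M)
    then show "p \<in> K \<times> cball 0 (2 * M)" using p by (simp add: mem_Times_iff)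
  qed
  moreover have "closed ?G"
  proof -
    have "?G = (K \<times> UNIV) \<inter> (\<Inter>z. {p. f (fst p) + snd p \<bullet> (z - fst p) \<le> f z})"
      by (auto simp: subgradients_def)
    moreover have "closed {p. f (fst p) + snd p \<bullet> (z - fst p) \<le> f z}" for z
      by (intro closed_Collect_le continuous_intros
          continuous_on_compose2[OF Conv_continuous[OF assms(1), of UNIV]]) auto
    ultimately show ?thesis
      using compact_imp_closed[OF assms(2)] by (auto intro!: closed_Int closed_Times)
  qed
  ultimately have "compact ?G"
    using bounded_subset[OF bounded_Times[OF compact_imp_bounded[OF assms(2)] bounded_cball]]
    by (simp add: compact_eq_bounded_closed)
  then have "compact (snd ` ?G)" by (intro compact_continuous_image continuous_intros)
  moreover have "snd ` ?G = subgradient_image f K"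
    by (force simp: subgradient_image_def image_iff)
  ultimately show ?thesis by simp
qed

lemma subgradient_image_closed_borel:
  fixes f :: "real^'n::finite \<Rightarrow> real"
  assumes "f \<in> Conv" "closed C"
  shows "subgradient_image f C \<in> sets borel"
proof -
  have "C = (\<Union>N::nat. C \<inter> cball 0 (real N))" using real_arch_simple by (auto simp: mem_cball_0)
  then have "subgradient_image f C = (\<Union>N::nat. subgradient_image f (C \<inter> cball 0 (real N)))"
    unfolding subgradient_image_def by blast
  moreover have "compact (subgradient_image f (C \<inter> cball 0 (real N)))" for N
    using assms by (intro compact_subgradient_image closed_Int_compact compact_cball)
  then have "subgradient_image f (C \<inter> cball 0 (real N)) \<in> sets borel" for N by (rule borel_compact)
  ultimately show ?thesis by auto
qed

text \<open>Infinitely many disjoint translates of the set fit into a ball.\<close>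

lemma null_sets_one_point_per_line:
  fixes E :: "'a::euclidean_space set"
  assumes "compact E" and line: "\<And>y s. y \<in> E \<Longrightarrow> s > 0 \<Longrightarrow> y + s *\<^sub>R v \<notin> E"
  shows "E \<in> null_sets lborel"
proof -
  obtain R where R: "\<forall>x\<in>E. norm x \<le> R" using compact_imp_bounded[OF assms(1)] unfolding bounded_iff by (elim exE)
  \<comment> \<open>Shifts of length at most \<open>norm v\<close> keep all translates in one ball,
    and a common point of two translates would give two points of \<open>E\<close> on a line
    parallel to \<open>v\<close>.\<close>
  define T where "T k = (+) ((1 / real (Suc k)) *\<^sub>R v) ` E" for k
  have T: "T k \<in> lmeasurable" "measure lebesgue (T k) = measure lebesgue E" for k
    unfolding T_def using assms(1) by (auto simp only: measure_translation intro!: lmeasurable_compact compact_translation)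
  have disj: "disjoint_family_on T UNIV"
  proof (unfold disjoint_family_on_def, intro ballI impI)
    have *: "T m \<inter> T n = {}" if "m < n" for m n
    proof (rule ccontr)
      assume "T m \<inter> T n \<noteq> {}"
      then obtain y y' where y: "y \<in> E" "y' \<in> E" "(1 / real (Suc m)) *\<^sub>R v + y = (1 / real (Suc n)) *\<^sub>R v + y'"
        unfolding T_def by blast
      have "y' = y + (1 / real (Suc m) - 1 / real (Suc n)) *\<^sub>R v" using y(3) by (simp add: algebra_simps)
      moreover have "1 / real (Suc n) < 1 / real (Suc m)"
        using that by (intro divide_strict_left_mono) auto
      then have "1 / real (Suc m) - 1 / real (Suc n) > 0" by simp
      ultimately show False using line[OF y(1)] y(2) by metis
    qed
    show "T m \<inter> T n = {}" if "m \<noteq> n" for m n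
      using *[of m n] *[of n m] that by (metis inf_commute nat_neq_iff)
  qed
  have "real N * measure lebesgue E \<le> measure lebesgue (cball (0::'a) (R + norm v))" for N :: nat
  proof -
    have "real N * measure lebesgue E = (\<Sum>k<N. measure lebesgue (T k))" by (simp add: T(2))
    also have "\<dots> = measure lebesgue (\<Union>k<N. T k)"
    proof (rule measure_finite_Union[symmetric])
      show "disjoint_family_on T {..<N}" using disj disjoint_family_on_mono by blast
      show "emeasure lebesgue (T k) \<noteq> \<infinity>" for k using fmeasurableD2[OF T(1)[of k]] by simp
    qed (use T(1) in auto)
    also have "\<dots> \<le> measure lebesgue (cball (0::'a) (R + norm v))"
    proof (rule measure_mono_fmeasurable)
      show "(\<Union>k<N. T k) \<subseteq> cball 0 (R + norm v)"
      proof clarify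
        fix k x assume "x \<in> T k"
        then obtain y where y: "y \<in> E" "x = (1 / real (Suc k)) *\<^sub>R v + y" unfolding T_def by blast
        have "norm x \<le> norm ((1 / real (Suc k)) *\<^sub>R v) + norm y" unfolding y by (rule norm_triangle_ineq)
        also have "norm ((1 / real (Suc k)) *\<^sub>R v) \<le> norm v"
          using mult_right_mono[of "1 / real (Suc k)" 1 "norm v"] by simp
        finally show "x \<in> cball 0 (R + norm v)" using R y(1) by force
      qed
    qed (use T(1) in auto)
    finally show ?thesis .
  qed
  then have "measure lebesgue E = 0"
    by (intro real_archimedian_rdiv_eq_0[OF measure_nonneg]) simp
  then have "emeasure lebesgue E = 0"
    using emeasure_eq_measure2[OF lmeasurable_compact[OF assms(1)]] by (simp only: ennreal_0)
  then have "emeasure lborel E = 0" using borel_compact[OF assms(1)] by simp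
  then show ?thesis using borel_compact[OF assms(1)] by (simp add: null_sets_def)
qed

section \<open>Slopes with several contact points\<close>

lemma subgradient_monotone:
  assumes "y \<in> subgradients f x" "y' \<in> subgradients f x'"
  shows "(y - y') \<bullet> (x - x') \<ge> 0"
  using subgradientsD[OF assms(1), of x'] subgradientsD[OF assms(2), of x]
  by (simp add: inner_diff_right inner_diff_left)

lemma multi_subgradients_null:
  fixes f :: "real^'n::finite \<Rightarrow> real"
  assumes "f \<in> Conv"
  shows "multi_subgradients f \<in> null_sets lborel"
proof -
  define E where "E i a b N =
    subgradient_image f (cball 0 (real N) \<inter> {x. x$i \<le> a}) \<inter> subgradient_image f (cball 0 (real N) \<inter> {x. b \<le> x$i})"
    for i :: 'n and a b :: real and N :: nat
  define I where "I = (UNIV :: 'n set) \<times> {(a, b). a \<in> \<rat> \<and> b \<in> \<rat> \<and> a < (b::real)} \<times> (UNIV :: nat set)"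
  have "{(a, b). a \<in> \<rat> \<and> b \<in> \<rat> \<and> a < (b::real)} \<subseteq> \<rat> \<times> \<rat>" by auto
  then have "countable {(a, b). a \<in> \<rat> \<and> b \<in> \<rat> \<and> a < (b::real)}"
    by (rule countable_subset) (intro countable_SIGMA countable_rat)
  then have "countable I" unfolding I_def by (intro countable_SIGMA) auto
  have null: "E i a b N \<in> null_sets lborel" if "a < b" for i a b N
  proof (rule null_sets_one_point_per_line[where v="axis i 1"])
    have "closed {x::real^'n. x$i \<le> a}" "closed {x::real^'n. b \<le> x$i}"
      by (intro closed_Collect_le continuous_intros)+
    then show "compact (E i a b N)"
      unfolding E_def
      by (intro compact_Int compact_subgradient_image[OF assms] compact_Int_closed compact_cball)
    fix y s assume y: "y \<in> E i a b N" "(s::real) > 0"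
    show "y + s *\<^sub>R axis i 1 \<notin> E i a b N"
    proof
      assume "y + s *\<^sub>R axis i 1 \<in> E i a b N"
      then obtain x where x: "x$i \<le> a" "y + s *\<^sub>R axis i 1 \<in> subgradients f x"
        unfolding E_def subgradient_image_def by blast
      obtain x' where x': "b \<le> x'$i" "y \<in> subgradients f x'"
        using y(1) unfolding E_def subgradient_image_def by blast
      have "s * (x$i - x'$i) \<ge> 0"
        using subgradient_monotone[OF x(2) x'(2)] by (simp add: inner_axis')
      then show False using y(2) x(1) x'(1) that by (simp add: zero_le_mult_iff)
    qed
  qed
  have eq: "multi_subgradients f = (\<Union>(i, (a, b), N)\<in>I. E i a b N)"
  proof (intro equalityI subsetI)
    fix y assume "y \<in> multi_subgradients f"
    then obtain x x' where x: "x \<noteq> x'" "y \<in> subgradients f x" "y \<in> subgradients f x'"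
      unfolding multi_subgradients_def by blast
    have main: "y \<in> (\<Union>(i, (a, b), N)\<in>I. E i a b N)"
      if xx: "x$i < x'$i" "y \<in> subgradients f x" "y \<in> subgradients f x'" for x x' i
    proof -
      obtain b where b: "b \<in> \<rat>" "x$i < b" "b < x'$i" using Rats_dense_in_real[OF xx(1)] by blast
      obtain a where a: "a \<in> \<rat>" "x$i < a" "a < b" using Rats_dense_in_real[OF b(2)] by blast
      obtain N where "max (norm x) (norm x') \<le> real N" using real_arch_simple by blast
      then have "x \<in> cball 0 (real N) \<inter> {x. x$i \<le> a}" "x' \<in> cball 0 (real N) \<inter> {x. b \<le> x$i}"
        using a b by auto
      then have "y \<in> E i a b N" unfolding E_def subgradient_image_def using xx(2,3) by blast
      moreover have "(i, (a, b), N) \<in> I" using a b unfolding I_def by simp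
      ultimately show ?thesis by (intro UN_I[of "(i, (a, b), N)"]) simp_all
    qed
    obtain i where "x$i \<noteq> x'$i" using x(1) by (auto simp: vec_eq_iff)
    then show "y \<in> (\<Union>(i, (a, b), N)\<in>I. E i a b N)"
      using main[of x i x'] main[of x' i x] x by linarith
  next
    fix y assume "y \<in> (\<Union>(i, (a, b), N)\<in>I. E i a b N)"
    then obtain i a b N where *: "a < b" "y \<in> E i a b N" unfolding I_def by auto
    then obtain x x' where "x$i \<le> a" "b \<le> x'$i" "y \<in> subgradients f x" "y \<in> subgradients f x'"
      unfolding E_def subgradient_image_def by blast
    moreover from this * have "x \<noteq> x'" by auto
    ultimately show "y \<in> multi_subgradients f" unfolding multi_subgradients_def by blast
  qed
  show ?thesis
    unfolding eq using \<open>countable I\<close> null by (intro null_sets_UN') (auto simp: I_def)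
qed

section \<open>The contact map and the Monge-Ampere integral\<close>

lemma single_subgradients_borel:
  fixes f :: "real^'n::finite \<Rightarrow> real"
  assumes "f \<in> Conv"
  shows "single_subgradients f \<in> sets borel"
  unfolding single_subgradients_eq
  using subgradient_image_closed_borel[OF assms closed_UNIV] multi_subgradients_null[OF assms] by auto

text \<open>Among the single slopes, the preimage of a closed set is its subgradient image, which is
  a countable union of compact sets.\<close>

lemma contact_point_measurable:
  fixes f :: "real^'n::finite \<Rightarrow> real"
  assumes "f \<in> Conv"
  shows "contact_point f \<in> borel_measurable (restrict_space borel (single_subgradients f))"
proof -
  have "contact_point f \<in> measurable (restrict_space borel (single_subgradients f)) (sigma UNIV (Collect closed))"
  proof (rule measurable_measure_of)
    fix C :: "(real^'n) set" assume "C \<in> Collect closed"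
    then have "subgradient_image f C \<in> sets borel" using subgradient_image_closed_borel[OF assms] by simp
    moreover have "contact_point f -` C \<inter> single_subgradients f = subgradient_image f C \<inter> single_subgradients f"
      by (auto simp: subgradient_image_def contact_point_eq)
    ultimately show "contact_point f -` C \<inter> space (restrict_space borel (single_subgradients f))
        \<in> sets (restrict_space borel (single_subgradients f))"
      using single_subgradients_borel[OF assms] by (auto simp: space_restrict_space sets_restrict_space_iff)
  qed auto
  then show ?thesis by (simp only: borel_eq_closed[symmetric])
qed

lemma ma_integrand_measurable:
  fixes f :: "real^'n::finite \<Rightarrow> real"
  assumes "f \<in> Conv" "Cc \<phi>"
  shows "ma_integrand f \<phi> \<in> borel_measurable borel"
proof -
  have "(\<lambda>y. \<phi> (contact_point f y)) \<in> borel_measurable (restrict_space borel (single_subgradients f))"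
    by (rule measurable_compose[OF contact_point_measurable[OF assms(1)] Cc_borel_measurable[OF assms(2)]])
  then show ?thesis
    unfolding ma_integrand_def[abs_def]
    using single_subgradients_borel[OF assms(1)] by (subst measurable_If_restrict_space_iff) auto
qed

text \<open>Up to multiple slopes, which are null, the subgradient image of \<open>B\<close> is the
  preimage of \<open>B\<close> under the contact map. Hence the defining set function agrees with a
  genuine measure on Borel sets, and \<open>measure_of\<close> does not degenerate to 0.\<close>

lemma monge_ampere_eq_distr:
  fixes f :: "real^'n::finite \<Rightarrow> real"
  assumes "f \<in> Conv"
  shows "monge_ampere f = distr (restrict_space lborel (single_subgradients f)) borel (contact_point f)"
    (is "_ = ?M")
proof -
  let ?S = "single_subgradients f" and ?X = "contact_point f"
  have [measurable]: "?S \<in> sets borel" by (rule single_subgradients_borel[OF assms])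
  have X: "?X \<in> borel_measurable (restrict_space lborel ?S)"
    using contact_point_measurable[OF assms] by (simp cong: measurable_cong_sets sets_restrict_space_cong)
  have em: "emeasure lebesgue (\<Union>x\<in>B. subgradients f x) = emeasure ?M B" if B: "B \<in> sets borel" for B
  proof -
    have "?X -` B \<inter> space (restrict_space lborel ?S) \<in> sets (restrict_space lborel ?S)"
      by (rule measurable_sets[OF X]) (use B in simp)
    then have pre: "?X -` B \<inter> ?S \<in> sets lborel"
      by (simp add: space_restrict_space sets_restrict_space_iff)
    have eq: "(\<Union>x\<in>B. subgradients f x) = (?X -` B \<inter> ?S) \<union> ((\<Union>x\<in>B. subgradients f x) \<inter> multi_subgradients f)"
    proof (intro equalityI subsetI)
      fix y assume "y \<in> (\<Union>x\<in>B. subgradients f x)"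
      then show "y \<in> (?X -` B \<inter> ?S) \<union> ((\<Union>x\<in>B. subgradients f x) \<inter> multi_subgradients f)"
        using single_subgradientsI[of y f] by (cases "y \<in> multi_subgradients f") auto
    next
      fix y assume "y \<in> (?X -` B \<inter> ?S) \<union> ((\<Union>x\<in>B. subgradients f x) \<inter> multi_subgradients f)"
      then show "y \<in> (\<Union>x\<in>B. subgradients f x)"
        using contact_point_eq[of y f "?X y"] by auto
    qed
    \<comment> \<open>Nothing is claimed about Borel measurability of this part; completeness of
      Lebesgue measure makes it null.\<close>
    have "(\<Union>x\<in>B. subgradients f x) \<inter> multi_subgradients f \<in> null_sets lebesgue"
      using null_sets_completionI[OF multi_subgradients_null[OF assms]]
      by (rule null_sets_completion_subset[rotated]) blast
    then have "emeasure lebesgue (\<Union>x\<in>B. subgradients f x) = emeasure lebesgue (?X -` B \<inter> ?S)"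
      using pre by (subst eq, intro emeasure_Un_null_set) auto
    also have "\<dots> = emeasure lborel (?X -` B \<inter> ?S)" using pre by simp
    also have "\<dots> = emeasure ?M B"
      using X B by (simp add: emeasure_distr emeasure_restrict_space space_restrict_space)
    finally show ?thesis .
  qed
  have "monge_ampere f = measure_of (space ?M) (sets ?M) (emeasure ?M)"
    unfolding monge_ampere_def space_distr sets_distr space_borel
    using em sets.sigma_sets_eq[of borel] by (intro measure_of_eq) auto
  then show ?thesis by (simp only: measure_of_of_measure)
qed

lemma integral_monge_ampere:
  fixes f :: "real^'n::finite \<Rightarrow> real"
  assumes "f \<in> Conv" "Cc \<phi>"
  shows "(LINT x|monge_ampere f. \<phi> x) = ma f \<phi>"
proof -
  let ?S = "single_subgradients f" and ?X = "contact_point f"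
  have X: "?X \<in> borel_measurable (restrict_space lborel ?S)"
    using contact_point_measurable[OF assms(1)] by (simp cong: measurable_cong_sets sets_restrict_space_cong)
  have "(LINT x|monge_ampere f. \<phi> x) = (LINT y|restrict_space lborel ?S. \<phi> (?X y))"
    unfolding monge_ampere_eq_distr[OF assms(1)]
    by (rule integral_distr[OF X Cc_borel_measurable[OF assms(2)]])
  also have "\<dots> = (LINT y|lborel. indicator ?S y *\<^sub>R \<phi> (?X y))"
    using single_subgradients_borel[OF assms(1)] by (intro integral_restrict_space) auto
  also have "\<dots> = ma f \<phi>"
    unfolding ma_def by (intro Bochner_Integration.integral_cong) (auto simp: ma_integrand_def indicator_def)
  finally show ?thesis .
qed

lemma ma_integrand_support:
  assumes "ma_integrand f \<phi> y \<noteq> 0"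
  shows "y \<in> subgradient_image f (tsupp \<phi>)"
  by (rule ma_integrand_nonzero[OF assms]) (auto simp: subgradient_image_def intro: in_tsupp)

lemma ma_integrand_bound:
  assumes "\<And>x. norm (\<phi> x) \<le> B" "subgradient_image f (tsupp \<phi>) \<subseteq> K"
  shows "norm (ma_integrand f \<phi> y) \<le> B * indicator K y"
proof (cases "ma_integrand f \<phi> y = 0")
  case True
  have "0 \<le> B" using order_trans[OF norm_ge_zero assms(1)] .
  then show ?thesis using True by simp
next
  case False
  then have "y \<in> K" using ma_integrand_support[OF False] assms(2) by blast
  moreover obtain x where "ma_integrand f \<phi> y = \<phi> x" by (rule ma_integrand_nonzero[OF False]) (rule that)
  ultimately show ?thesis using assms(1)[of x] by simp
qed

lemma integrable_indicator_compact:
  fixes K :: "'a::euclidean_space set"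
  assumes "compact K" shows "integrable lborel (\<lambda>y. B * indicator K y :: real)"
  using borel_compact[OF assms] emeasure_compact_finite[OF assms]
  by (intro integrable_mult_right integrable_real_indicator) auto

lemma ma_integrand_integrable:
  fixes f :: "real^'n::finite \<Rightarrow> real"
  assumes "f \<in> Conv" "Cc \<phi>"
  shows "integrable lborel (ma_integrand f \<phi>)"
proof (rule Bochner_Integration.integrable_bound)
  let ?K = "subgradient_image f (tsupp \<phi>)" and ?B = "SUP x. norm (\<phi> x)"
  show "integrable lborel (\<lambda>y. ?B * indicator ?K y)"
    by (intro integrable_indicator_compact compact_subgradient_image assms Cc_compact_tsupp)
  show "ma_integrand f \<phi> \<in> borel_measurable lborel" using ma_integrand_measurable[OF assms] by simp
  show "AE y in lborel. norm (ma_integrand f \<phi> y) \<le> norm (?B * indicator ?K y)"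
  proof (intro AE_I2)
    fix y
    have "norm (ma_integrand f \<phi> y) \<le> ?B * indicator ?K y"
      by (rule ma_integrand_bound[OF Cc_bounded[OF assms(2)] order_refl])
    also have "\<dots> \<le> norm (?B * indicator ?K y)" by simp
    finally show "norm (ma_integrand f \<phi> y) \<le> norm (?B * indicator ?K y)" .
  qed
qed

lemma ma_radon: "is_mval (ma :: 'n::finite mval)"
  unfolding is_mval_def radon_functional_def
proof (intro ballI conjI allI impI)
  fix f :: "real^'n \<Rightarrow> real" and \<phi> \<psi> :: "real^'n \<Rightarrow> complex"
  assume f: "f \<in> Conv"
  have "ma_integrand f (\<lambda>x. \<phi> x + \<psi> x) = (\<lambda>y. ma_integrand f \<phi> y + ma_integrand f \<psi> y)"
    by (auto simp: ma_integrand_def)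
  then show "ma f (\<lambda>x. \<phi> x + \<psi> x) = ma f \<phi> + ma f \<psi>" if "Cc \<phi>" "Cc \<psi>"
    unfolding ma_def
    using Bochner_Integration.integral_add[OF ma_integrand_integrable[OF f that(1)] ma_integrand_integrable[OF f that(2)]]
    by simp
  have "ma_integrand f (\<lambda>x. c * \<phi> x) = (\<lambda>y. c * ma_integrand f \<phi> y)" for c
    by (auto simp: ma_integrand_def)
  then show "ma f (\<lambda>x. c * \<phi> x) = c * ma f \<phi>" for c
    unfolding ma_def by simp
  fix K :: "(real^'n) set" assume K: "compact K"
  let ?I = "subgradient_image f K"
  have I: "compact ?I" by (rule compact_subgradient_image[OF f K])
  \<comment> \<open>The constant is the mass that the Monge-Ampere measure gives to
    \<open>K\<close>.\<close>
  show "\<exists>C. \<forall>\<phi>. Cc \<phi> \<longrightarrow> tsupp \<phi> \<subseteq> K \<longrightarrow> norm (ma f \<phi>) \<le> C * (SUP x. norm (\<phi> x))"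
  proof (intro exI[of _ "measure lborel ?I"] allI impI)
    fix \<phi> :: "real^'n \<Rightarrow> complex" assume \<phi>: "Cc \<phi>" "tsupp \<phi> \<subseteq> K"
    have sub: "subgradient_image f (tsupp \<phi>) \<subseteq> ?I" using \<phi>(2) unfolding subgradient_image_def by blast
    have "norm (ma f \<phi>) \<le> (LINT y|lborel. (SUP x. norm (\<phi> x)) * indicator ?I y)"
      unfolding ma_def
      by (rule Bochner_Integration.integral_norm_bound_integral[OF ma_integrand_integrable[OF f \<phi>(1)] integrable_indicator_compact[OF I]])
        (rule ma_integrand_bound[OF Cc_bounded[OF \<phi>(1)] sub])
    also have "\<dots> = measure lborel ?I * (SUP x. norm (\<phi> x))"
      using borel_compact[OF I] by simp
    finally show "norm (ma f \<phi>) \<le> measure lborel ?I * (SUP x. norm (\<phi> x))" .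
  qed
qed

section \<open>Symmetries of the Monge-Ampere functional\<close>

text \<open>Each symmetry acts on pairs of contact point and slope, bijectively on the points.
  Uniqueness of the contact point is then preserved, and what remains is a substitution in the slope
  variable.\<close>

lemma ma_integrand_transfer:
  assumes T: "\<And>x. S (T x) = x" "\<And>x. T (S x) = x"
    and sub: "\<And>x. y \<in> subgradients h x \<longleftrightarrow> y' \<in> subgradients f (T x)"
  shows "ma_integrand h (\<lambda>x. \<phi> (T x)) y = ma_integrand f \<phi> y'"
proof -
  have eq: "y \<in> single_subgradients h \<longleftrightarrow> y' \<in> single_subgradients f"
  proof
    assume y: "y \<in> single_subgradients h"
    have "\<exists>!x. y' \<in> subgradients f x"
    proof (rule ex1I[of _ "T (contact_point h y)"])
      show "y' \<in> subgradients f (T (contact_point h y))" using contact_point_eq[OF y] sub by simp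
      fix x assume "y' \<in> subgradients f x"
      then have "y \<in> subgradients h (S x)" using sub[of "S x"] T(2) by simp
      then show "x = T (contact_point h y)" using contact_point_eq[OF y] T(2)[of x] by simp
    qed
    then show "y' \<in> single_subgradients f" by (simp add: single_subgradients_def)
  next
    assume y': "y' \<in> single_subgradients f"
    have "\<exists>!x. y \<in> subgradients h x"
    proof (rule ex1I[of _ "S (contact_point f y')"])
      show "y \<in> subgradients h (S (contact_point f y'))" using contact_point_eq[OF y'] sub T(2) by simp
      fix x assume "y \<in> subgradients h x"
      then show "x = S (contact_point f y')" using contact_point_eq[OF y'] sub T(1)[of x] by simp
    qed
    then show "y \<in> single_subgradients h" by (simp add: single_subgradients_def)
  qed
  show ?thesis
  proof (cases "y \<in> single_subgradients h")
    case True
    have "y \<in> subgradients h (contact_point h y)" using contact_point_eq[OF True] by simp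
    then have "T (contact_point h y) = contact_point f y'"
      using contact_point_eq[of y' f] True eq sub by simp
    then show ?thesis using True eq by (simp add: ma_integrand_def)
  qed (simp add: ma_integrand_def eq)
qed

lemma ma_epi: "dually_epi_translation_invariant (ma :: 'n::finite mval)"
  unfolding dually_epi_translation_invariant_def
proof (intro ballI allI impI)
  fix f :: "real^'n \<Rightarrow> real" and v :: "real^'n" and c and \<phi> :: "real^'n \<Rightarrow> complex"
  assume f: "f \<in> Conv" and \<phi>: "Cc \<phi>"
  have "ma_integrand (\<lambda>x. f x + v \<bullet> x + c) \<phi> = (\<lambda>y. ma_integrand f \<phi> (- v + y))"
  proof (rule ext, rule ma_integrand_transfer[where S = "\<lambda>x. x" and T = "\<lambda>x. x"])
    fix y show "y \<in> subgradients (\<lambda>x. f x + v \<bullet> x + c) x \<longleftrightarrow> - v + y \<in> subgradients f x" for x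
      unfolding subgradients_def by (simp add: algebra_simps inner_diff_right inner_add_left)
  qed auto
  then show "ma (\<lambda>x. f x + v \<bullet> x + c) \<phi> = ma f \<phi>"
    unfolding ma_def using lborel_integral_translation[OF ma_integrand_measurable[OF f \<phi>], of "- v"] by (simp only:)
qed

lemma ma_translation: "translation_equivariant (ma :: 'n::finite mval)"
  unfolding translation_equivariant_def
proof (intro ballI allI impI)
  fix f :: "real^'n \<Rightarrow> real" and z :: "real^'n" and \<phi> :: "real^'n \<Rightarrow> complex"
  have "ma_integrand (\<lambda>x. f (x - z)) (\<lambda>x. \<phi> ((x - z) + z)) = ma_integrand f (\<lambda>x. \<phi> (x + z))"
  proof (rule ext, rule ma_integrand_transfer[where S = "\<lambda>x. x + z" and T = "\<lambda>x. x - z"])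
    fix y x
    show "y \<in> subgradients (\<lambda>x. f (x - z)) x \<longleftrightarrow> y \<in> subgradients f (x - z)"
    proof
      assume *: "y \<in> subgradients (\<lambda>x. f (x - z)) x"
      show "y \<in> subgradients f (x - z)"
      proof (rule subgradientsI)
        fix w show "f (x - z) + y \<bullet> (w - (x - z)) \<le> f w"
          using subgradientsD[OF *, of "w + z"] by (simp add: algebra_simps)
      qed
    next
      assume *: "y \<in> subgradients f (x - z)"
      show "y \<in> subgradients (\<lambda>x. f (x - z)) x"
      proof (rule subgradientsI)
        fix w show "f (x - z) + y \<bullet> (w - x) \<le> f (w - z)"
          using subgradientsD[OF *, of "w - z"] by (simp add: algebra_simps)
      qed
    qed
  qed auto
  then show "ma (\<lambda>x. f (x - z)) \<phi> = ma f (\<lambda>x. \<phi> (x + z))" unfolding ma_def by simp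
qed

text \<open>Composition with \<open>g\<close> transforms slopes by the transpose of
  \<open>g\<close>, and substituting back in the integral over slopes produces exactly one factor
  \<open>\<bar>det g\<bar>\<close>.\<close>

lemma ma_GL: "GL_equivariant 1 (ma :: 'n::finite mval)"
  unfolding GL_equivariant_def GL_act_def
proof (intro ballI allI impI)
  fix g :: "real^'n^'n" and f :: "real^'n \<Rightarrow> real" and \<phi> :: "real^'n \<Rightarrow> complex"
  assume g: "invertible g" and f: "f \<in> Conv" and \<phi>: "Cc \<phi>"
  obtain g' where g': "invertible g'" "\<And>x. g *v (g' *v x) = x" "\<And>x. g' *v (g *v x) = x"
    "\<bar>det g\<bar> * \<bar>det g'\<bar> = 1" "det g \<noteq> 0" by (rule invertible_inverse_vec[OF g]) (rule that)
  have "ma_integrand (\<lambda>x. f (g *v x)) (\<lambda>x. \<phi> (g *v x)) = (\<lambda>y. ma_integrand f \<phi> (transpose g' *v y))"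
  proof (rule ext, rule ma_integrand_transfer[where S = "(*v) g'" and T = "(*v) g"])
    fix y x
    have in1: "(transpose g' *v y) \<bullet> w = y \<bullet> (g' *v w)" for w
      by (metis dot_lmul_matrix transpose_matrix_vector)
    show "y \<in> subgradients (\<lambda>x. f (g *v x)) x \<longleftrightarrow> transpose g' *v y \<in> subgradients f (g *v x)"
    proof
      assume *: "y \<in> subgradients (\<lambda>x. f (g *v x)) x"
      show "transpose g' *v y \<in> subgradients f (g *v x)"
      proof (rule subgradientsI)
        fix w show "f (g *v x) + (transpose g' *v y) \<bullet> (w - g *v x) \<le> f w"
          using subgradientsD[OF *, of "g' *v w"] unfolding in1 by (simp add: g'(2,3) matrix_vector_mult_diff_distrib)
      qed
    next
      assume *: "transpose g' *v y \<in> subgradients f (g *v x)"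
      show "y \<in> subgradients (\<lambda>x. f (g *v x)) x"
      proof (rule subgradientsI)
        fix w show "f (g *v x) + y \<bullet> (w - x) \<le> f (g *v w)"
          using subgradientsD[OF *, of "g *v w"] unfolding in1 by (simp add: g'(2,3) matrix_vector_mult_diff_distrib)
      qed
    qed
  qed (rule g'(3), rule g'(2))
  then have "ma (\<lambda>x. f (g *v x)) (\<lambda>x. \<phi> (g *v x)) = (LINT y|lborel. ma_integrand f \<phi> (transpose g' *v y))"
    unfolding ma_def by (simp only:)
  also have "\<dots> = complex_of_real (inverse \<bar>det (transpose g')\<bar>) * ma f \<phi>"
    unfolding ma_def
    by (rule lborel_integral_matrix[OF _ ma_integrand_measurable[OF f \<phi>]]) (use g'(1) in \<open>simp add: invertible_det_nz det_transpose\<close>)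
  also have "inverse \<bar>det (transpose g')\<bar> = \<bar>det g\<bar> powr 1"
    using g'(4,5) inverse_unique[of "\<bar>det g'\<bar>" "\<bar>det g\<bar>"] by (simp add: det_transpose mult.commute)
  finally show "ma (\<lambda>x. f (g *v x)) (\<lambda>x. \<phi> (g *v x)) = complex_of_real (\<bar>det g\<bar> powr 1) * ma f \<phi>" .
qed

section \<open>Locality and non-vanishing of the Monge-Ampere functional\<close>

text \<open>For a convex function a plane that supports it near the contact point supports it
  everywhere: the inequality is tested at a point of the segment close to \<open>x\<close> and
  transported to \<open>z\<close> by convexity.\<close>

lemma subgradients_local:
  assumes "h \<in> Conv" "open U" "x \<in> U" "\<And>z. z \<in> U \<Longrightarrow> f z = h z" "y \<in> subgradients f x"
  shows "y \<in> subgradients h x"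
proof (rule subgradientsI)
  fix z
  obtain r where r: "r > 0" "ball x r \<subseteq> U" using assms(2,3) open_contains_ball by blast
  \<comment> \<open>This keeps \<open>t * norm (z - x)\<close> below \<open>r\<close>; the summand 1
    covers \<open>z = x\<close>.\<close>
  define t where "t = min 1 (r / (2 * (norm (z - x) + 1)))"
  have t: "0 < t" "t \<le> 1" unfolding t_def using r(1) by (auto intro!: divide_pos_pos add_nonneg_pos)
  have "t * norm (z - x) \<le> r / (2 * (norm (z - x) + 1)) * norm (z - x)"
    unfolding t_def by (intro mult_right_mono) auto
  also have "\<dots> = r / 2 * (norm (z - x) / (norm (z - x) + 1))" by simp
  finally have 1: "t * norm (z - x) \<le> r / 2 * (norm (z - x) / (norm (z - x) + 1))" .
  have "norm (z - x) / (norm (z - x) + 1) \<le> 1"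
    by (subst divide_le_eq_1_pos) (auto intro: add_nonneg_pos)
  then have "r / 2 * (norm (z - x) / (norm (z - x) + 1)) \<le> r / 2 * 1"
    using r(1) by (intro mult_left_mono) auto
  with 1 r(1) have "t * norm (z - x) < r" by linarith
  then have "x + t *\<^sub>R (z - x) \<in> U" using r(2) t by (auto simp: dist_norm)
  then have "h x + t * (y \<bullet> (z - x)) \<le> h (x + t *\<^sub>R (z - x))"
    using subgradientsD[OF assms(5), of "x + t *\<^sub>R (z - x)"] assms(3,4) by simp
  also have "x + t *\<^sub>R (z - x) = (1 - t) *\<^sub>R x + t *\<^sub>R z" by (simp add: algebra_simps)
  also have "h \<dots> \<le> (1 - t) * h x + t * h z" using t by (intro ConvD[OF assms(1)]) auto
  finally have "t * (h x + y \<bullet> (z - x)) \<le> t * h z" by (simp add: algebra_simps)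
  then show "h x + y \<bullet> (z - x) \<le> h z" using t by simp
qed

text \<open>A contact point where \<open>\<phi>\<close> is nonzero lies in \<open>U\<close>, so it
  is also a contact point of the other function; off the multiple slopes of both the integrands
  agree.\<close>

lemma ma_local: "locally_determined (ma :: 'n::finite mval)"
  unfolding locally_determined_def
proof (intro ballI allI impI)
  fix f h :: "real^'n \<Rightarrow> real" and U and \<phi> :: "real^'n \<Rightarrow> complex"
  assume f: "f \<in> Conv" and h: "h \<in> Conv" and U: "open U" "\<forall>x\<in>U. f x = h x" and \<phi>: "Cc \<phi>" "tsupp \<phi> \<subseteq> U"
  have *: "ma_integrand f' \<phi> y = ma_integrand h' \<phi> y"
    if hyp: "h' \<in> Conv" "\<And>z. z \<in> U \<Longrightarrow> f' z = h' z" "y \<notin> multi_subgradients h'" "ma_integrand f' \<phi> y \<noteq> 0" for f' h' y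
  proof -
    obtain x where x: "y \<in> subgradients f' x" "\<phi> x \<noteq> 0" "ma_integrand f' \<phi> y = \<phi> x"
      by (rule ma_integrand_nonzero[OF hyp(4)]) (rule that)
    have "x \<in> U" using in_tsupp[of \<phi>, OF x(2)] \<phi>(2) by blast
    then have "y \<in> subgradients h' x" by (rule subgradients_local[OF hyp(1) U(1) _ hyp(2) x(1)])
    from single_subgradientsI[OF this hyp(3)] show ?thesis using x(3) by (simp add: ma_integrand_def)
  qed
  have "AE y in lborel. y \<notin> multi_subgradients f \<union> multi_subgradients h"
    by (intro AE_not_in null_sets.Un multi_subgradients_null f h)
  then have "AE y in lborel. ma_integrand f \<phi> y = ma_integrand h \<phi> y"
  proof eventually_elim
    case (elim y)
    show ?case
    proof (cases "ma_integrand f \<phi> y = 0")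
      case True
      then show ?thesis using *[of f h y] f U(2) elim by (cases "ma_integrand h \<phi> y = 0") auto
    next
      case False
      then show ?thesis using *[of h f y] h U(2) elim by auto
    qed
  qed
  then show "ma f \<phi> = ma h \<phi>"
    unfolding ma_def using ma_integrand_measurable[OF f \<phi>(1)] ma_integrand_measurable[OF h \<phi>(1)]
    by (intro integral_cong_AE) auto
qed

text \<open>All slopes in the open standard simplex touch at 0, where the bump is 1. A vanishing
  integral of the nonnegative integrand would make this nonempty open set null.\<close>

lemma ma_simplex_nonzero: "\<exists>\<phi>. Cc \<phi> \<and> ma (simplex_fn (UNIV :: 'n::finite set)) \<phi> \<noteq> 0"
proof -
  let ?h = "simplex_fn (UNIV :: 'n set)"
  obtain \<phi> :: "real^'n \<Rightarrow> complex" where \<phi>: "Cc \<phi>" "\<phi> 0 = 1" "\<And>x. \<exists>r\<ge>0. \<phi> x = complex_of_real r"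
    by (rule exists_Cc_bump[of 0]) (rule that)
  define O' where "O' = {y::real^'n. (\<forall>i. 0 < y$i) \<and> (\<Sum>i\<in>UNIV. y$i) < 1}"
  have O: "y \<in> subgradients ?h 0" if "y \<in> O'" for y
  proof (rule subgradientsI)
    fix z
    have h0: "?h 0 = 0" by (simp add: simplex_fn_def image_constant_conv)
    have hz: "0 \<le> ?h z" "z$i \<le> ?h z" for i unfolding simplex_fn_def by (rule Max_ge; simp)+
    have "y \<bullet> z = (\<Sum>i\<in>UNIV. y$i * z$i)" by (simp add: inner_vec_def)
    also have "\<dots> \<le> (\<Sum>i\<in>UNIV. y$i * ?h z)"
      using that hz by (intro sum_mono mult_left_mono) (auto simp: O'_def less_imp_le)
    also have "\<dots> = (\<Sum>i\<in>UNIV. y$i) * ?h z" by (simp add: sum_distrib_right)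
    also have "\<dots> \<le> 1 * ?h z" using that hz(1) by (intro mult_right_mono) (auto simp: O'_def)
    finally show "?h 0 + y \<bullet> (z - 0) \<le> ?h z" using h0 by simp
  qed
  have "ma ?h \<phi> \<noteq> 0"
  proof
    assume 0: "ma ?h \<phi> = 0"
    have int: "integrable lborel (ma_integrand ?h \<phi>)" by (rule ma_integrand_integrable[OF simplex_fn_Conv \<phi>(1)])
    have re: "integrable lborel (\<lambda>y. Re (ma_integrand ?h \<phi> y))" by (rule integrable_Re[OF int])
    have nonneg: "0 \<le> Re (ma_integrand ?h \<phi> y)" for y
      using \<phi>(3)[of "contact_point ?h y"] by (auto simp: ma_integrand_def)
    have "(LINT y|lborel. Re (ma_integrand ?h \<phi> y)) = Re (ma ?h \<phi>)"
      unfolding ma_def by (rule integral_Re[OF int])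
    then have "AE y in lborel. Re (ma_integrand ?h \<phi> y) = 0"
      using 0 integral_nonneg_eq_0_iff_AE[OF re] nonneg by simp
    moreover have "AE y in lborel. y \<notin> multi_subgradients ?h"
      by (intro AE_not_in multi_subgradients_null simplex_fn_Conv)
    ultimately have "AE y in lborel. y \<notin> O'"
    proof eventually_elim
      case (elim y)
      show ?case
      proof
        assume "y \<in> O'"
        from single_subgradientsI[OF O[OF this] elim(2)] show False
          using elim(1) \<phi>(2) by (simp add: ma_integrand_def)
      qed
    qed
    moreover have "O' = (\<Inter>i. {y. 0 < y$i}) \<inter> {y. (\<Sum>i\<in>UNIV. y$i) < 1}" by (auto simp: O'_def)
    then have "open O'"
      by (auto intro!: open_Int open_INT open_Collect_less continuous_intros)
    ultimately have "O' \<in> null_sets lborel"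
      by (subst AE_iff_null_sets) auto
    then have "negligible O'" unfolding negligible_iff_null_sets by (rule null_sets_completionI)
    moreover have "(\<chi> i. 1 / (real CARD('n) + 1)) \<in> O'" by (simp add: O'_def field_simps)
    ultimately show False using open_not_negligible[OF \<open>open O'\<close>] by blast
  qed
  then show ?thesis using \<phi>(1) by blast
qed

section \<open>Weak continuity of the Monge-Ampere functional\<close>

text \<open>Subtracting the slope gives a function with a strict minimum at the contact point, lower
  by some \<open>\<delta>\<close> than on a small sphere. An error below \<open>\<delta> / 3\<close>
  keeps the centre below the sphere, and convexity keeps it below everything outside, so the
  approximating function attains its global minimum inside.\<close>

lemma contact_points_converge:
  fixes f :: "real^'n::finite \<Rightarrow> real"
  assumes f: "f \<in> Conv" and fs: "\<And>j. fs j \<in> Conv" and conv: "loc_unif_conv fs f"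
    and y: "y \<in> single_subgradients f" and e: "e > 0"
  shows "eventually (\<lambda>j. \<exists>x. y \<in> subgradients (fs j) x \<and> dist x (contact_point f y) < e) sequentially"
proof -
  let ?c = "contact_point f y"
  define F where "F x = f x - y \<bullet> x" for x
  have contF: "continuous_on S F" for S unfolding F_def[abs_def] by (intro continuous_intros Conv_continuous[OF f])
  have above: "F ?c < F x" if "x \<noteq> ?c" for x
  proof (rule ccontr)
    assume "\<not> F ?c < F x"
    then have *: "f x - y \<bullet> x \<le> f ?c - y \<bullet> ?c" by (simp add: F_def)
    have c: "y \<in> subgradients f ?c" using contact_point_eq[OF y] by simp
    have "y \<in> subgradients f x"
    proof (rule subgradientsI)
      fix z show "f x + y \<bullet> (z - x) \<le> f z"
        using subgradientsD[OF c, of z] * by (simp add: inner_diff_right)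
    qed
    then show False using contact_point_eq[OF y] that by simp
  qed
  have "sphere ?c e \<noteq> {}" using e by simp
  then obtain m where m: "m \<in> sphere ?c e" "\<And>x. x \<in> sphere ?c e \<Longrightarrow> F m \<le> F x"
    using continuous_attains_inf[OF compact_sphere _ contF] by blast
  define \<delta> where "\<delta> = F m - F ?c"
  have "m \<noteq> ?c" using m(1) e by auto
  then have \<delta>: "\<delta> > 0" unfolding \<delta>_def using above[of m] by simp
  have "eventually (\<lambda>j. \<forall>x\<in>cball ?c e. \<bar>fs j x - f x\<bar> < \<delta> / 3) sequentially"
    using conv[unfolded loc_unif_conv_def, rule_format, OF compact_cball, of "\<delta> / 3"] \<delta> by simp
  then show ?thesis
  proof eventually_elim
    case (elim j)
    define G where "G x = fs j x - y \<bullet> x" for x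
    have contG: "continuous_on S G" for S unfolding G_def[abs_def] by (intro continuous_intros Conv_continuous[OF fs])
    have sph: "G ?c < G s" if "s \<in> sphere ?c e" for s
    proof -
      have "\<bar>fs j s - f s\<bar> < \<delta> / 3" "\<bar>fs j ?c - f ?c\<bar> < \<delta> / 3" using elim that e by auto
      moreover have "F ?c + \<delta> \<le> F s" using m(2)[OF that] by (simp add: \<delta>_def)
      ultimately show ?thesis using \<delta> unfolding F_def G_def by linarith
    qed
    have out: "G ?c < G x" if "e \<le> dist ?c x" for x
    proof -
      \<comment> \<open>The segment from the centre to \<open>x\<close> crosses the sphere at
        parameter \<open>t\<close>.\<close>
      define t where "t = e / dist ?c x"
      have "dist ?c x > 0" using that e by linarith
      then have t: "0 < t" "t \<le> 1" unfolding t_def using that e by (simp_all only: divide_pos_pos divide_le_eq_1_pos)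
      let ?s = "(1 - t) *\<^sub>R ?c + t *\<^sub>R x"
      have "?c - ?s = t *\<^sub>R (?c - x)" by (simp add: algebra_simps)
      then have "dist ?c ?s = t * dist ?c x" using t by (simp add: dist_norm)
      also have "\<dots> = e" unfolding t_def using that e by auto
      finally have "G ?c < G ?s" by (intro sph) simp
      also have "G ?s \<le> (1 - t) * G ?c + t * G x"
        using ConvD[OF fs[of j], of "1 - t" t ?c x] t unfolding G_def by (simp add: inner_add_right algebra_simps)
      finally have "t * G ?c < t * G x" by (simp add: algebra_simps)
      then show ?thesis using t by simp
    qed
    obtain x where x: "x \<in> cball ?c e" "\<And>z. z \<in> cball ?c e \<Longrightarrow> G x \<le> G z"
      using continuous_attains_inf[OF compact_cball _ contG, of ?c e] e by auto
    have "G x \<le> G ?c" using x(2)[of ?c] e by simp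
    then have "dist x ?c < e" using out[of x] by (cases "e \<le> dist ?c x") (auto simp: dist_commute)
    moreover have "y \<in> subgradients (fs j) x"
    proof (rule subgradientsI)
      fix z
      have "G x \<le> G z"
        using x(2)[of z] out[of z] \<open>G x \<le> G ?c\<close> by (cases "z \<in> cball ?c e") auto
      then show "fs j x + y \<bullet> (z - x) \<le> fs j z" unfolding G_def by (simp add: inner_diff_right)
    qed
    ultimately show ?case by blast
  qed
qed

text \<open>For a slope that is never attained, \<open>F\<close> has no global minimum. Some
  \<open>z\<close> therefore lies below the minimum over the ball by a margin that survives
  approximation, and no point of the ball can be a contact point.\<close>

lemma eventually_no_contact:
  fixes f :: "real^'n::finite \<Rightarrow> real"
  assumes f: "f \<in> Conv" and conv: "loc_unif_conv fs f"
    and y: "y \<notin> subgradient_image f UNIV" and R: "R \<ge> 0"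
  shows "eventually (\<lambda>j. \<forall>x. norm x \<le> R \<longrightarrow> y \<notin> subgradients (fs j) x) sequentially"
proof -
  define F where "F x = f x - y \<bullet> x" for x
  have "continuous_on (cball 0 R) F" unfolding F_def[abs_def] by (intro continuous_intros Conv_continuous[OF f])
  then obtain m where m: "m \<in> cball 0 R" "\<And>x. x \<in> cball 0 R \<Longrightarrow> F m \<le> F x"
    using continuous_attains_inf[OF compact_cball, of 0 R F] R by auto
  have "y \<notin> subgradients f m" using y unfolding subgradient_image_def by blast
  then obtain z where z: "f z < f m + y \<bullet> (z - m)" unfolding subgradients_def by (auto simp: not_le)
  define \<delta> where "\<delta> = F m - F z"
  have \<delta>: "\<delta> > 0" unfolding \<delta>_def F_def using z by (simp add: inner_diff_right)
  have "compact (insert z (cball 0 R))" by (intro compact_insert compact_cball)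
  then have "eventually (\<lambda>j. \<forall>x\<in>insert z (cball 0 R). \<bar>fs j x - f x\<bar> < \<delta> / 3) sequentially"
    using conv[unfolded loc_unif_conv_def, rule_format, of "insert z (cball 0 R)" "\<delta> / 3"] \<delta> by simp
  then show ?thesis
  proof eventually_elim
    case (elim j)
    show ?case
    proof (intro allI impI notI)
      fix x assume x: "norm x \<le> R" "y \<in> subgradients (fs j) x"
      have "\<bar>fs j x - f x\<bar> < \<delta> / 3" "\<bar>fs j z - f z\<bar> < \<delta> / 3" using elim x(1) by auto
      moreover have "F z + \<delta> \<le> F x" using m(2)[of x] x(1) by (simp add: \<delta>_def)
      moreover have "fs j x - y \<bullet> x \<le> fs j z - y \<bullet> z"
        using subgradientsD[OF x(2), of z] by (simp add: inner_diff_right)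
      ultimately show False using \<delta> unfolding F_def by linarith
    qed
  qed
qed

text \<open>If the slope is attained, the contact points converge; if not, they leave every ball and
  the integrand is eventually 0.\<close>

lemma ma_integrand_converges:
  fixes f :: "real^'n::finite \<Rightarrow> real"
  assumes f: "f \<in> Conv" and fs: "\<And>j. fs j \<in> Conv" and conv: "loc_unif_conv fs f" and \<phi>: "Cc \<phi>"
    and y: "y \<notin> multi_subgradients f" "\<And>j. y \<notin> multi_subgradients (fs j)"
  shows "(\<lambda>j. ma_integrand (fs j) \<phi> y) \<longlonglongrightarrow> ma_integrand f \<phi> y"
proof (cases "y \<in> single_subgradients f")
  case True
  show ?thesis
  proof (rule tendstoI)
    fix e :: real assume e: "e > 0"
    let ?c = "contact_point f y"
    have "continuous_on UNIV \<phi>" by (rule Cc_continuous[OF \<phi>])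
    then obtain d where d: "d > 0" "\<forall>x. dist x ?c < d \<longrightarrow> dist (\<phi> x) (\<phi> ?c) < e"
      unfolding continuous_on_iff using e by (meson UNIV_I)
    show "eventually (\<lambda>j. dist (ma_integrand (fs j) \<phi> y) (ma_integrand f \<phi> y) < e) sequentially"
      using contact_points_converge[OF f fs conv True d(1)]
    proof eventually_elim
      case (elim j)
      then obtain x where x: "y \<in> subgradients (fs j) x" "dist x ?c < d" by (elim exE conjE)
      then show ?case
        using single_subgradientsI[OF x(1) y(2)] d(2) True by (simp add: ma_integrand_def)
    qed
  qed
next
  case False
  then have no: "y \<notin> subgradient_image f UNIV" using y(1) unfolding single_subgradients_eq by blast
  obtain R where R: "R \<ge> 0" "\<And>x. \<phi> x \<noteq> 0 \<Longrightarrow> norm x \<le> R" by (rule Cc_support_ball[OF \<phi>]) (rule that)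
  have "eventually (\<lambda>j. ma_integrand (fs j) \<phi> y = 0) sequentially"
    using eventually_no_contact[OF f conv no R(1)]
  proof eventually_elim
    case (elim j)
    show ?case
    proof (rule ccontr)
      assume "ma_integrand (fs j) \<phi> y \<noteq> 0"
      then obtain x where "y \<in> subgradients (fs j) x" "\<phi> x \<noteq> 0" by (rule ma_integrand_nonzero) (rule that)
      then show False using elim R(2) by blast
    qed
  qed
  then show ?thesis using False by (simp add: ma_integrand_def[of f] tendsto_eventually)
qed

lemma ma_continuous: "mval_continuous (ma :: 'n::finite mval)"
  unfolding mval_continuous_def
proof (intro allI impI)
  fix fs and f :: "real^'n \<Rightarrow> real" and \<phi> :: "real^'n \<Rightarrow> complex"
  assume fs: "\<forall>j. fs j \<in> Conv" and f: "f \<in> Conv" and conv: "loc_unif_conv fs f" and \<phi>: "Cc \<phi>"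
  obtain R where R: "R \<ge> 0" "\<And>x. \<phi> x \<noteq> 0 \<Longrightarrow> norm x \<le> R" by (rule Cc_support_ball[OF \<phi>]) (rule that)
  obtain M where M: "\<And>z. norm z \<le> R + 1 \<Longrightarrow> \<bar>f z\<bar> \<le> M"
    by (rule Conv_bounded_on_ball[OF f, of "R + 1"]) (rule that)
  have "eventually (\<lambda>j. \<forall>x\<in>cball 0 (R + 1). \<bar>fs j x - f x\<bar> < 1) sequentially"
    using conv[unfolded loc_unif_conv_def, rule_format, OF compact_cball, of 1] by simp
  then obtain N where N: "\<forall>j\<ge>N. \<forall>x\<in>cball 0 (R + 1). \<bar>fs j x - f x\<bar> < 1"
    unfolding eventually_sequentially by (elim exE)
  \<comment> \<open>From index \<open>N\<close> on all functions are bounded by \<open>M + 1\<close>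
    on the ball of radius \<open>R + 1\<close>, hence their slopes over the support of
    \<open>\<phi>\<close> by \<open>2 * (M + 1)\<close>. This yields one integrable majorant for the
    shifted sequence.\<close>
  let ?K = "cball (0::real^'n) (2 * (M + 1))" and ?B = "SUP x. norm (\<phi> x)"
  have "(\<lambda>j. ma (fs (j + N)) \<phi>) \<longlonglongrightarrow> ma f \<phi>"
    unfolding ma_def
  proof (rule integral_dominated_convergence[where w="\<lambda>y. ?B * indicator ?K y"])
    show "integrable lborel (\<lambda>y. ?B * indicator ?K y)"
      by (rule integrable_indicator_compact[OF compact_cball])
    show "ma_integrand f \<phi> \<in> borel_measurable lborel" using ma_integrand_measurable[OF f \<phi>] by simp
    show "ma_integrand (fs (j + N)) \<phi> \<in> borel_measurable lborel" for j
      using ma_integrand_measurable[OF _ \<phi>] fs by simp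
    have "AE y in lborel. \<forall>j. y \<notin> multi_subgradients (fs j)"
      unfolding AE_all_countable using fs by (intro allI AE_not_in multi_subgradients_null) auto
    moreover have "AE y in lborel. y \<notin> multi_subgradients f"
      by (intro AE_not_in multi_subgradients_null f)
    ultimately show "AE y in lborel. (\<lambda>j. ma_integrand (fs (j + N)) \<phi> y) \<longlonglongrightarrow> ma_integrand f \<phi> y"
    proof eventually_elim
      case (elim y)
      have "(\<lambda>j. ma_integrand (fs j) \<phi> y) \<longlonglongrightarrow> ma_integrand f \<phi> y"
        using elim fs by (intro ma_integrand_converges[OF f _ conv \<phi>]) auto
      then show ?case by (rule LIMSEQ_ignore_initial_segment)
    qed
    have "norm (ma_integrand (fs (j + N)) \<phi> y) \<le> ?B * indicator ?K y" for j y
    proof (cases "ma_integrand (fs (j + N)) \<phi> y = 0")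
      case True
      have "0 \<le> ?B" using order_trans[OF norm_ge_zero Cc_bounded[OF \<phi>]] .
      then show ?thesis using True by simp
    next
      case False
      obtain x where x: "y \<in> subgradients (fs (j + N)) x" "\<phi> x \<noteq> 0" "ma_integrand (fs (j + N)) \<phi> y = \<phi> x"
        by (rule ma_integrand_nonzero[OF False]) (rule that)
      have "\<bar>fs (j + N) z\<bar> \<le> M + 1" if "norm z \<le> R + 1" for z
      proof -
        have "\<bar>fs (j + N) z - f z\<bar> < 1" using N that by simp
        then show ?thesis using M[OF that] by linarith
      qed
      from subgradient_bound[OF x(1) R(2)[OF x(2)] this] have "y \<in> ?K" by simp
      then show ?thesis using x(3) Cc_bounded[OF \<phi>, of x] by simp
    qed
    then show "AE y in lborel. norm (ma_integrand (fs (j + N)) \<phi> y) \<le> ?B * indicator ?K y" for j by simp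
  qed
  then show "(\<lambda>j. ma (fs j) \<phi>) \<longlonglongrightarrow> ma f \<phi>" by (rule LIMSEQ_offset)
qed

section \<open>Values on simplex functions\<close>

definition diag_matrix :: "('n::finite \<Rightarrow> real) \<Rightarrow> real^'n^'n" where
  "diag_matrix c = (\<chi> i j. if i = j then c i else 0)"

lemma diag_matrix_mult [simp]: "(diag_matrix c *v x) $ i = c i * x $ i"
  by (simp add: diag_matrix_def matrix_vector_mult_def if_distrib[of "\<lambda>t. t * _"] cong: if_cong)

lemma det_diag_matrix: "det (diag_matrix c) = prod c UNIV"
  by (subst det_diagonal) (auto simp: diag_matrix_def)

lemma invertible_diag_matrix: "(\<And>i. c i \<noteq> 0) \<Longrightarrow> invertible (diag_matrix c)"
  by (simp add: invertible_det_nz det_diag_matrix)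

lemma simplex_fn_cmult:
  assumes "t \<ge> 0" "\<And>j. j \<in> J \<Longrightarrow> z$j = t * x$j"
  shows "simplex_fn J z = t * simplex_fn J x"
proof -
  have "insert 0 ((\<lambda>j. z$j) ` J) = (*) t ` insert 0 ((\<lambda>j. x$j) ` J)"
    using assms(2) by (auto simp: image_image image_iff)
  moreover have "t * Max (insert 0 ((\<lambda>j. x$j) ` J)) = Max ((*) t ` insert 0 ((\<lambda>j. x$j) ` J))"
    by (rule mono_Max_commute) (auto intro: monoI mult_left_mono assms(1))
  ultimately show ?thesis unfolding simplex_fn_def by simp
qed

lemma simplex_fn_UNIV: "simplex_fn UNIV x = max 0 (Max (range (($) x)))"
  unfolding simplex_fn_def by (subst Max_insert) auto

context GL_mval
begin

lemma homogeneous_apply: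
  "homogeneous k \<Psi> \<Longrightarrow> f \<in> Conv \<Longrightarrow> t > 0 \<Longrightarrow> Cc \<phi> \<Longrightarrow>
    \<Psi> (\<lambda>x. t * f x) \<phi> = complex_of_real (t ^ k) * \<Psi> f \<phi>"
  unfolding homogeneous_def by blast

lemma vanish_simplex_nonpos_weight:
  assumes hom: "homogeneous k \<Psi>" and k: "k \<ge> 1" and q: "q \<le> 0"
  shows "vanish (simplex_fn J)"
proof (induction "card J" arbitrary: J rule: less_induct)
  \<comment> \<open>The empty \<open>J\<close> is covered by the same argument: \<open>?h\<close> is
    0 and \<open>g\<close> is the identity.\<close>
  case less
  let ?h = "simplex_fn J"
  let ?A = "{x::real^'n. \<forall>j\<in>J. x$j = 0}"
  define g :: "real^'n^'n" where "g = diag_matrix (\<lambda>j. if j \<in> J then 2 else 1)"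
  have g: "invertible g" unfolding g_def by (rule invertible_diag_matrix) simp
  have det: "1 \<le> \<bar>det g\<bar>"
    unfolding g_def det_diag_matrix abs_prod by (rule prod_ge_1) simp
  interpret L: radon "\<Psi> ?h" by (rule radon[OF simplex_fn_Conv])
  show ?case
    unfolding vanish_def
  proof (intro allI impI)
    fix \<phi> :: "real^'n \<Rightarrow> complex" assume \<phi>: "Cc \<phi>"
    have \<phi>g: "Cc (\<lambda>x. \<phi> (g *v x))" by (rule Cc_matrix[OF \<phi> g])
    have "\<Psi> ?h (\<lambda>x. \<phi> (g *v x) - \<phi> x) = 0"
    proof (rule L.zero_off_closed[where A = ?A])
      show "\<Psi> ?h \<psi> = 0" if "Cc \<psi>" "tsupp \<psi> \<inter> ?A = {}" for \<psi>
        by (rule simplex_fn_zero_off_face[OF less that]) simp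
      show "\<phi> (g *v x) - \<phi> x = 0" if "x \<in> ?A" for x
      proof -
        have "g *v x = x" using that by (simp add: vec_eq_iff g_def)
        then show ?thesis by simp
      qed
    qed (rule Cc_diff[OF \<phi>g \<phi>])
    then have "\<Psi> ?h (\<lambda>x. \<phi> (g *v x)) = \<Psi> ?h \<phi>" using L.diff[OF \<phi>g \<phi>] by simp
    moreover have "\<Psi> (\<lambda>x. 2 * ?h x) (\<lambda>x. \<phi> (g *v x)) = complex_of_real (2 ^ k) * \<Psi> ?h (\<lambda>x. \<phi> (g *v x))"
      by (rule homogeneous_apply[OF hom simplex_fn_Conv _ \<phi>g]) simp
    moreover have "(\<lambda>x. ?h (g *v x)) = (\<lambda>x. 2 * ?h x)"
      by (rule ext, rule simplex_fn_cmult) (auto simp: g_def)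
    ultimately have "complex_of_real (2 ^ k) * \<Psi> ?h \<phi> = complex_of_real (\<bar>det g\<bar> powr q) * \<Psi> ?h \<phi>"
      using GL_apply[OF g simplex_fn_Conv \<phi>, of J] by simp
    \<comment> \<open>The weight contributes at most 1 and the degree contributes more than 1, so
      the two factors cannot agree on a nonzero value.\<close>
    moreover have "\<bar>det g\<bar> powr q < 2 ^ k"
    proof -
      have "\<bar>det g\<bar> powr q \<le> \<bar>det g\<bar> powr 0" using q det by (rule powr_mono)
      also have "\<dots> \<le> 1" by simp
      also have "(1::real) < 2 ^ k" using k by (simp add: one_less_power)
      finally show ?thesis .
    qed
    ultimately show "\<Psi> ?h \<phi> = 0" by (metis less_irrefl mult_right_cancel of_real_eq_iff)
  qed
qed

lemma vanish_simplex_pos_weight: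
  assumes q: "q > 0" and J: "J \<noteq> UNIV"
  shows "vanish (simplex_fn J)"
  unfolding vanish_def
proof (intro allI impI)
  fix \<phi> :: "real^'n \<Rightarrow> complex" assume \<phi>: "Cc \<phi>"
  let ?h = "simplex_fn J"
  obtain i where i: "i \<notin> J" using J by blast
  interpret L: radon "\<Psi> ?h" by (rule radon[OF simplex_fn_Conv])
  obtain R where R: "R \<ge> 0" "\<And>x. \<phi> x \<noteq> 0 \<Longrightarrow> norm x \<le> R" by (rule Cc_support_ball[OF \<phi>]) (rule that)
  obtain C where C: "C \<ge> 0"
    "\<And>\<phi> B. Cc \<phi> \<Longrightarrow> tsupp \<phi> \<subseteq> cball 0 R \<Longrightarrow> (\<And>x. norm (\<phi> x) \<le> B) \<Longrightarrow> norm (\<Psi> ?h \<phi>) \<le> C * B"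
    using L.bound[OF compact_cball[of 0 R]] by blast
  let ?B = "SUP x. norm (\<phi> x)"
  \<comment> \<open>Stretching the argument by \<open>t \<ge> 1\<close> only shrinks the support and
    keeps the supremum, so the Radon bound is uniform in \<open>t\<close>.\<close>
  have bound: "t powr q * norm (\<Psi> ?h \<phi>) \<le> C * ?B" if t: "t \<ge> 1" for t
  proof -
    define g :: "real^'n^'n" where "g = diag_matrix (\<lambda>j. if j = i then t else 1)"
    have g: "invertible g" unfolding g_def by (rule invertible_diag_matrix) (use t in simp)
    have det: "\<bar>det g\<bar> = t" unfolding g_def det_diag_matrix using t by (simp add: prod.delta)
    have \<phi>g: "Cc (\<lambda>x. \<phi> (g *v x))" by (rule Cc_matrix[OF \<phi> g])
    have "tsupp (\<lambda>x. \<phi> (g *v x)) \<subseteq> cball 0 R"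
    proof (rule tsupp_subset)
      fix x assume "\<phi> (g *v x) \<noteq> 0"
      then have "norm (g *v x) \<le> R" by (rule R(2))
      moreover have "norm x \<le> norm (g *v x)"
      proof (rule norm_le_componentwise_cart)
        show "norm (x$j) \<le> norm ((g *v x)$j)" for j
          using t mult_right_mono[of 1 t "\<bar>x$j\<bar>"] by (cases "j = i") (simp_all add: g_def abs_mult)
      qed
      ultimately show "x \<in> cball 0 R" by simp
    qed simp
    then have "norm (\<Psi> ?h (\<lambda>x. \<phi> (g *v x))) \<le> C * ?B"
      by (rule C(2)[OF \<phi>g]) (rule Cc_bounded[OF \<phi>])
    moreover have "(\<lambda>x. ?h (g *v x)) = ?h"
    proof
      fix x
      have "(g *v x)$j = 1 * x$j" if "j \<in> J" for j using that i by (auto simp: g_def)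
      from simplex_fn_cmult[OF _ this] show "?h (g *v x) = ?h x" by simp
    qed
    then have "\<Psi> ?h (\<lambda>x. \<phi> (g *v x)) = complex_of_real (t powr q) * \<Psi> ?h \<phi>"
      using GL_apply[OF g simplex_fn_Conv \<phi>, of J] det by simp
    ultimately show ?thesis by (simp add: norm_mult)
  qed
  show "\<Psi> ?h \<phi> = 0"
  proof (rule ccontr)
    assume "\<Psi> ?h \<phi> \<noteq> 0"
    then have n: "norm (\<Psi> ?h \<phi>) > 0" by simp
    have B: "?B \<ge> 0" using order_trans[OF norm_ge_zero Cc_bounded[OF \<phi>]] .
    \<comment> \<open>\<open>X\<close> exceeds the quotient allowed by the bound, and the stretch
      \<open>X powr (1 / q)\<close> turns the weight factor into \<open>X\<close>.\<close>
    define X where "X = C * ?B / norm (\<Psi> ?h \<phi>) + 1"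
    have X: "X \<ge> 1" unfolding X_def using n C(1) B by simp
    have "X powr (1 / q) \<ge> 1" using X q by (intro ge_one_powr_ge_zero) auto
    from bound[OF this] have "X * norm (\<Psi> ?h \<phi>) \<le> C * ?B"
      using X q by (simp add: powr_powr)
    then show False using n unfolding X_def by (simp add: distrib_right)
  qed
qed

lemma simplex_point_mass:
  assumes q: "q > 0"
  obtains a where "\<And>\<phi>. Cc \<phi> \<Longrightarrow> \<Psi> (simplex_fn UNIV) \<phi> = a * \<phi> 0"
proof -
  let ?h = "simplex_fn (UNIV :: 'n set)"
  interpret L: radon "\<Psi> ?h" by (rule radon[OF simplex_fn_Conv])
  obtain \<phi>0 :: "real^'n \<Rightarrow> complex" where \<phi>0: "Cc \<phi>0" "\<phi>0 0 = 1" by (rule exists_Cc_bump[of 0]) (rule that)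
  show ?thesis
  proof (rule that[of "\<Psi> ?h \<phi>0"])
    fix \<phi> :: "real^'n \<Rightarrow> complex" assume \<phi>: "Cc \<phi>"
    have c: "Cc (\<lambda>x. \<phi> 0 * \<phi>0 x)" by (rule Cc_cmult[OF \<phi>0(1)])
    \<comment> \<open>The difference vanishes at 0, the only point that carries
      \<open>\<Psi> ?h\<close>.\<close>
    have "\<Psi> ?h (\<lambda>x. \<phi> x - \<phi> 0 * \<phi>0 x) = 0"
    proof (rule L.zero_off_closed[where A = "{x. \<forall>j\<in>UNIV. x$j = 0}"])
      show "\<Psi> ?h \<psi> = 0" if "Cc \<psi>" "tsupp \<psi> \<inter> {x. \<forall>j\<in>UNIV. x$j = 0} = {}" for \<psi>
        by (rule simplex_fn_zero_off_face[OF _ that]) (rule vanish_simplex_pos_weight[OF q], auto)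
      show "\<phi> x - \<phi> 0 * \<phi>0 x = 0" if "x \<in> {x. \<forall>j\<in>UNIV. x$j = 0}" for x
      proof -
        have "x = 0" using that by (simp add: vec_eq_iff)
        then show ?thesis by (simp add: \<phi>0(2))
      qed
    qed (rule Cc_diff[OF \<phi> c])
    then show "\<Psi> ?h \<phi> = \<Psi> ?h \<phi>0 * \<phi> 0"
      using L.diff[OF \<phi> c] L.cmult[OF \<phi>0(1), of "\<phi> 0"] by simp
  qed
qed

text \<open>A linear change of variables in the test function fixes its value at 0, so a point mass
  there feels the weight alone.\<close>

lemma simplex_point_mass_GL:
  assumes a: "\<And>\<phi>. Cc \<phi> \<Longrightarrow> \<Psi> (simplex_fn UNIV) \<phi> = a * \<phi> 0" and g: "invertible g" and \<phi>: "Cc \<phi>"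
  shows "\<Psi> (\<lambda>x. simplex_fn UNIV (g *v x)) \<phi> = complex_of_real (\<bar>det g\<bar> powr q) * (a * \<phi> 0)"
proof -
  obtain g' where g': "invertible g'" "\<And>x. g' *v (g *v x) = x" by (rule invertible_inverse_vec[OF g]) (rule that)
  note c = Cc_matrix[OF \<phi> g'(1)]
  have "\<Psi> (\<lambda>x. simplex_fn UNIV (g *v x)) (\<lambda>x. \<phi> (g' *v (g *v x)))
      = complex_of_real (\<bar>det g\<bar> powr q) * \<Psi> (simplex_fn UNIV) (\<lambda>x. \<phi> (g' *v x))"
    by (rule GL_apply[OF g simplex_fn_Conv c])
  then show ?thesis unfolding g'(2) using a[OF c] by simp
qed

text \<open>The midpoint of the edge from 0 to the i-th unit vector splits the standard simplex into two
  simplices of half the volume, exchanged by an affine involution; their support functions are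
  \<open>max 0 M\<close> and \<open>max (x$i) M\<close> with M the support function of the common facet.\<close>

lemma weight_one:
  assumes q: "q > 0" and val: "mval_valuation \<Psi>"
    and a: "\<And>\<phi>. Cc \<phi> \<Longrightarrow> \<Psi> (simplex_fn UNIV) \<phi> = a * \<phi> 0" and a0: "a \<noteq> 0"
  shows "q = 1"
proof -
  fix i :: 'n
  let ?h = "simplex_fn (UNIV :: 'n set)"
  define m where "m = (\<lambda>x::real^'n. Max (range (($) x)))"
  \<comment> \<open>Halving the i-th coordinate replaces the vertex \<open>axis i 1\<close> by the
    midpoint of its edge to 0.\<close>
  define g1 :: "real^'n^'n" where "g1 = diag_matrix (\<lambda>j. if j = i then 1/2 else 1)"
  define M where "M = (\<lambda>x. m (g1 *v x))"
  \<comment> \<open>Together with the added summand \<open>x$i\<close>, this exchanges the vertices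
    0 and \<open>axis i 1\<close> and fixes the midpoint and all other vertices.\<close>
  define f2 where "f2 = (\<lambda>x::real^'n. \<chi> j. if j = i then - x$i else x$j - x$i)"
  define g2 :: "real^'n^'n" where "g2 = matrix f2"
  have g1: "invertible g1" unfolding g1_def by (rule invertible_diag_matrix) simp
  have det1: "\<bar>det g1\<bar> = 1/2" unfolding g1_def by (simp add: det_diag_matrix prod.delta)
  have "linear f2" unfolding f2_def by (rule linearI) (auto simp: vec_eq_iff algebra_simps)
  then have f2: "g2 *v x = f2 x" for x unfolding g2_def by simp
  have "f2 (f2 x) = x" for x unfolding f2_def by (auto simp: vec_eq_iff)
  then have "g2 ** g2 = mat 1" unfolding matrix_eq by (simp add: matrix_vector_mul_assoc[symmetric] f2)
  then have g2: "invertible g2" "\<bar>det g2\<bar> = 1"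
  proof -
    assume *: "g2 ** g2 = mat 1"
    then show "invertible g2" unfolding invertible_def by (intro exI[of _ g2]) simp
    have "det g2 * det g2 = 1" using * by (metis det_I det_mul)
    then show "\<bar>det g2\<bar> = 1" by (auto simp: square_eq_1_iff)
  qed
  have mge: "x$j \<le> m x" for x j unfolding m_def by simp
  have mle: "m x \<le> c \<longleftrightarrow> (\<forall>j. x$j \<le> c)" for x c unfolding m_def by simp
  have M_half: "x$i / 2 \<le> M x" for x using mge[of "g1 *v x" i] by (simp add: M_def g1_def)
  have M_other: "x$j \<le> M x" if "j \<noteq> i" for x j using mge[of "g1 *v x" j] that by (simp add: M_def g1_def)
  have M_le: "M x \<le> c \<longleftrightarrow> x$i / 2 \<le> c \<and> (\<forall>j. j \<noteq> i \<longrightarrow> x$j \<le> c)" for x c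
    unfolding M_def mle by (auto simp: g1_def)
  define fS where "fS = (\<lambda>x. ?h (g1 *v x))"
  define fT where "fT = (\<lambda>x. ?h ((g1 ** g2) *v x) + axis i 1 \<bullet> x + 0)"
  have fS: "fS x = max 0 (M x)" for x unfolding fS_def M_def m_def by (rule simplex_fn_UNIV)
  have fT: "fT x = max (x$i) (M x)" for x
  proof -
    have "M (f2 x) = M x - x$i"
    proof (rule antisym)
      have "\<And>j. j \<noteq> i \<Longrightarrow> x$j - x$i \<le> M x - x$i" using M_other[of _ x] by simp
      then show "M (f2 x) \<le> M x - x$i"
        unfolding M_le using M_half[of x] by (auto simp: f2_def)
      have "x$j \<le> M (f2 x) + x$i" if "j \<noteq> i" for j
        using M_other[OF that, of "f2 x"] that by (simp add: f2_def)
      then have "M x \<le> M (f2 x) + x$i"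
        unfolding M_le using M_half[of "f2 x"] by (auto simp: f2_def)
      then show "M x - x$i \<le> M (f2 x)" by simp
    qed
    moreover have "?h ((g1 ** g2) *v x) = fS (f2 x)"
      unfolding fS_def by (simp add: matrix_vector_mul_assoc[symmetric] f2)
    ultimately show ?thesis unfolding fT_def fS by (simp add: inner_axis' max_def)
  qed
  \<comment> \<open>\<open>M\<close> dominates \<open>x$i / 2\<close>, the mean of 0 and
    \<open>x$i\<close>, and hence the smaller of the two.\<close>
  have min: "(\<lambda>x. min (fS x) (fT x)) = M"
  proof
    fix x show "min (fS x) (fT x) = M x"
      unfolding fS fT using M_half[of x] by (cases "x$i \<ge> 0") (auto simp: min_def max_def)
  qed
  have max: "(\<lambda>x. max (fS x) (fT x)) = ?h"
  proof
    fix x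
    have "m x \<le> max (x$i) (M x)" unfolding mle using M_other[of _ x] by (metis max.cobounded1 max.coboundedI2)
    moreover have "M x \<le> max (x$i / 2) (m x)" unfolding M_le using mge[of x] by (auto simp: max.coboundedI2)
    moreover have "x$i \<le> m x" by (rule mge)
    moreover have "?h x = max 0 (m x)" unfolding m_def by (rule simplex_fn_UNIV)
    ultimately show "max (fS x) (fT x) = ?h x" unfolding fS fT by (auto simp: max_def split: if_splits)
  qed
  have mpl: "m = pl (range (\<lambda>j. axis j 1)) (\<lambda>_. 0)"
    by (auto simp: m_def pl_def fun_eq_iff image_image inner_axis')
  \<comment> \<open>The common facet has only n vertices, so \<open>M\<close> reduces to the simplex
    function of n - 1 indices, on which a positive weight forces vanishing.\<close>
  have vM: "vanish M" and MC: "M \<in> Conv"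
  proof -
    let ?Z = "range (\<lambda>j. axis j 1 :: real^'n)"
    have "?Z \<subseteq> Basis" by (auto simp: axis_in_Basis_iff)
    then have "\<not> affine_dependent ?Z"
      using independent_mono[OF independent_Basis] affine_dependent_imp_dependent by blast
    moreover have "inj (\<lambda>j. axis j 1 :: real^'n)" by (auto simp: inj_on_def axis_eq_axis)
    then have "card ?Z = CARD('n)" by (rule card_image)
    then have "card ?Z = Suc (card (UNIV - {i}))" by (simp add: card_Suc_Diff1)
    moreover have "vanish (simplex_fn (UNIV - {i}))" by (rule vanish_simplex_pos_weight[OF q]) blast
    ultimately have "vanish m" unfolding mpl by (intro vanish_pl_of_simplex) auto
    moreover have "m \<in> Conv" unfolding mpl by (rule pl_Conv) auto
    ultimately show "vanish M" "M \<in> Conv" unfolding M_def by (auto intro: vanish_GL[OF g1] Conv_matrix)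
  qed
  have SC: "fS \<in> Conv" unfolding fS_def by (rule Conv_matrix[OF simplex_fn_Conv])
  have TC: "fT \<in> Conv" unfolding fT_def by (rule Conv_add_affine[OF Conv_matrix[OF simplex_fn_Conv]])
  obtain \<phi> :: "real^'n \<Rightarrow> complex" where \<phi>: "Cc \<phi>" "\<phi> 0 = 1" by (rule exists_Cc_bump[of 0]) (rule that)
  have "(\<lambda>x. min (fS x) (fT x)) \<in> Conv" unfolding min by (rule MC)
  from val[unfolded mval_valuation_def, rule_format, OF SC TC this \<phi>(1)]
  have "\<Psi> ?h \<phi> + \<Psi> M \<phi> = \<Psi> fS \<phi> + \<Psi> fT \<phi>" unfolding min max .
  moreover have "\<Psi> ?h \<phi> = a" using a[OF \<phi>(1)] \<phi>(2) by simp
  moreover have "\<Psi> M \<phi> = 0" using vM \<phi>(1) by (simp add: vanish_def)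
  moreover have "\<Psi> fS \<phi> = complex_of_real ((1/2) powr q) * a"
    unfolding fS_def using simplex_point_mass_GL[OF a g1 \<phi>(1)] by (simp add: det1 \<phi>(2))
  moreover have "\<Psi> fT \<phi> = complex_of_real ((1/2) powr q) * a"
  proof -
    have "\<Psi> fT \<phi> = \<Psi> (\<lambda>x. ?h ((g1 ** g2) *v x)) \<phi>"
      unfolding fT_def by (rule epi_apply[OF Conv_matrix[OF simplex_fn_Conv] \<phi>(1)])
    also have "\<dots> = complex_of_real (\<bar>det (g1 ** g2)\<bar> powr q) * (a * \<phi> 0)"
      by (rule simplex_point_mass_GL[OF a invertible_mult[OF g1 g2(1)] \<phi>(1)])
    also have "\<bar>det (g1 ** g2)\<bar> = 1/2" using det1 g2(2) by (simp add: det_mul abs_mult)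
    finally show ?thesis by (simp add: \<phi>(2))
  qed
  ultimately have "a = (2 * complex_of_real ((1/2) powr q)) * a" by simp
  then have "complex_of_real (2 * (1/2) powr q) = 1" using a0 by simp
  then have "2 * (1/2) powr q = (1::real)" by (simp only: of_real_eq_1_iff)
  then have "(1/2) powr q = (1/2::real) powr 1" by simp
  then show "q = 1" by (subst (asm) powr_inj) auto
qed

text \<open>Doubling the argument doubles the simplex function. The degree then gives the factor
  \<open>2 ^ k\<close>, and weight one gives the determinant \<open>2 ^ CARD('n)\<close>.\<close>

lemma degree_eq_dimension:
  assumes hom: "homogeneous k \<Psi>" and q: "q = 1"
    and a: "\<And>\<phi>. Cc \<phi> \<Longrightarrow> \<Psi> (simplex_fn UNIV) \<phi> = a * \<phi> 0" and a0: "a \<noteq> 0"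
  shows "k = CARD('n)"
proof -
  let ?h = "simplex_fn (UNIV :: 'n set)"
  define g :: "real^'n^'n" where "g = diag_matrix (\<lambda>_. 2)"
  have g: "invertible g" unfolding g_def by (rule invertible_diag_matrix) simp
  have det: "\<bar>det g\<bar> = 2 ^ CARD('n)" by (simp add: g_def det_diag_matrix)
  obtain \<phi> :: "real^'n \<Rightarrow> complex" where \<phi>: "Cc \<phi>" "\<phi> 0 = 1" by (rule exists_Cc_bump[of 0]) (rule that)
  have "(\<lambda>x. ?h (g *v x)) = (\<lambda>x. 2 * ?h x)"
    by (rule ext, rule simplex_fn_cmult) (auto simp: g_def)
  then have "\<Psi> (\<lambda>x. 2 * ?h x) \<phi> = complex_of_real (2 ^ CARD('n)) * a"
    using simplex_point_mass_GL[OF a g \<phi>(1)] \<phi>(2) q det by simp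
  moreover have "\<Psi> (\<lambda>x. 2 * ?h x) \<phi> = complex_of_real (2 ^ k) * \<Psi> ?h \<phi>"
    by (rule homogeneous_apply[OF hom simplex_fn_Conv _ \<phi>(1)]) simp
  ultimately have "complex_of_real (2 ^ k) = complex_of_real (2 ^ CARD('n))"
    using a[OF \<phi>(1)] \<phi>(2) a0 by simp
  then have "(2::real) ^ k = 2 ^ CARD('n)" by (simp only: of_real_eq_iff)
  then show ?thesis by simp
qed

lemma constant_of_degree_zero:
  assumes hom: "homogeneous 0 \<Psi>" and f: "f \<in> Conv" and \<phi>: "Cc \<phi>"
  shows "\<Psi> f \<phi> = \<Psi> (\<lambda>x. 0) \<phi>"
proof -
  define fs where "fs j = (\<lambda>x. inverse (real (Suc j)) * f x)" for j
  have "loc_unif_conv fs (\<lambda>x. 0)"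
    unfolding loc_unif_conv_def
  proof (intro allI impI)
    fix K :: "(real^'n) set" and e :: real assume K: "compact K" and e: "e > 0"
    obtain R where R: "\<forall>x\<in>K. norm x \<le> R" using compact_imp_bounded[OF K] unfolding bounded_iff by (elim exE)
    obtain B where B: "\<And>x. norm x \<le> R \<Longrightarrow> \<bar>f x\<bar> \<le> B"
      by (rule Conv_bounded_on_ball[OF f, of R]) (rule that)
    have "(\<lambda>j. inverse (real (Suc j)) * B) \<longlonglongrightarrow> 0 * B" by (intro tendsto_intros LIMSEQ_inverse_real_of_nat)
    then have "eventually (\<lambda>j. inverse (real (Suc j)) * B < e) sequentially"
      using e by (intro order_tendstoD) auto
    then show "eventually (\<lambda>j. \<forall>x\<in>K. \<bar>fs j x - 0\<bar> < e) sequentially"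
    proof eventually_elim
      case (elim j)
      show ?case
      proof
        fix x assume "x \<in> K"
        then have "\<bar>f x\<bar> \<le> B" using B R by blast
        then have "\<bar>inverse (real (Suc j))\<bar> * \<bar>f x\<bar> \<le> inverse (real (Suc j)) * B" by (intro mult_mono) auto
        also note elim
        finally have "\<bar>inverse (real (Suc j)) * f x\<bar> < e" unfolding abs_mult .
        then show "\<bar>fs j x - 0\<bar> < e" by (simp only: fs_def diff_0_right)
      qed
    qed
  qed
  moreover have "fs j \<in> Conv" for j unfolding fs_def by (rule Conv_cmult[OF f]) simp
  ultimately have "(\<lambda>j. \<Psi> (fs j) \<phi>) \<longlonglongrightarrow> \<Psi> (\<lambda>x. 0) \<phi>"
    using continuous[unfolded mval_continuous_def, rule_format, of fs "\<lambda>x. 0"] Conv_zero \<phi> by simp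
  moreover have "\<Psi> (fs j) \<phi> = \<Psi> f \<phi>" for j
    unfolding fs_def using homogeneous_apply[OF hom f _ \<phi>, of "inverse (real (Suc j))"] by simp
  ultimately show ?thesis by (simp add: LIMSEQ_const_iff)
qed

lemma lebesgue_of_degree_zero:
  assumes hom: "homogeneous 0 \<Psi>"
  obtains c where "\<And>f \<phi>. f \<in> Conv \<Longrightarrow> Cc \<phi> \<Longrightarrow> \<Psi> f \<phi> = c * (LINT x|lborel. \<phi> x)"
proof -
  have "\<Psi> (\<lambda>x. 0) (\<lambda>x. \<phi> (x + z)) = \<Psi> (\<lambda>x. 0) \<phi>" if "Cc \<phi>" for \<phi> z
    using translation[unfolded translation_equivariant_def, rule_format, OF Conv_zero that, of z] by simp
  then have "\<exists>c. \<forall>\<phi>. Cc \<phi> \<longrightarrow> \<Psi> (\<lambda>x. 0) \<phi> = c * (LINT x|lborel. \<phi> x)"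
    by (rule translation_invariant_radon_lebesgue[OF radon[OF Conv_zero]])
  then obtain c where c: "\<forall>\<phi>. Cc \<phi> \<longrightarrow> \<Psi> (\<lambda>x. 0) \<phi> = c * (LINT x|lborel. \<phi> x)" by (elim exE)
  show ?thesis
    by (rule that[of c]) (simp add: constant_of_degree_zero[OF hom] c)
qed

text \<open>A scaling with determinant \<open>d > 1\<close> suffices: substitution in the Lebesgue
  integral gives \<open>inverse d\<close>, and \<open>d powr q\<close> determines
  \<open>q\<close>.\<close>

lemma weight_minus_one:
  assumes c: "\<And>f \<phi>. f \<in> Conv \<Longrightarrow> Cc \<phi> \<Longrightarrow> \<Psi> f \<phi> = c * (LINT x|lborel. \<phi> x)"
    and f: "f \<in> Conv" and \<phi>: "Cc \<phi>" "\<Psi> f \<phi> \<noteq> 0"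
  shows "q = -1"
proof -
  define g :: "real^'n^'n" where "g = diag_matrix (\<lambda>_. 2)"
  have g: "invertible g" unfolding g_def by (rule invertible_diag_matrix) simp
  define d :: real where "d = 2 ^ CARD('n)"
  have d: "d > 1" unfolding d_def by (intro one_less_power) auto
  have det: "\<bar>det g\<bar> = d" by (simp add: g_def d_def det_diag_matrix)
  have "complex_of_real (d powr q) * \<Psi> f \<phi> = c * (LINT x|lborel. \<phi> (g *v x))"
    using GL_apply[OF g f \<phi>(1)] c[OF Conv_matrix[OF f] Cc_matrix[OF \<phi>(1) g]] det by simp
  also have "\<dots> = complex_of_real (inverse d) * \<Psi> f \<phi>"
    using lborel_integral_matrix[OF g Cc_borel_measurable[OF \<phi>(1)]] c[OF f \<phi>(1)] det by simp
  finally have "complex_of_real (d powr q) = complex_of_real (inverse d)" using \<phi>(2) by simp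
  then have "d powr q = inverse d" by (simp only: of_real_eq_iff)
  also have "inverse d = d powr (-1)" using d by (simp add: powr_minus)
  finally show ?thesis using powr_inj[of d q "-1"] d by simp
qed

end

section \<open>The classification\<close>

lemma GL_mval_ma: "GL_mval ma 1"
  by unfold_locales (rule ma_radon ma_continuous ma_epi ma_local ma_translation ma_GL)+

lemma GL_mval_diff:
  fixes \<Psi> \<Phi> :: "'n::finite mval"
  assumes "GL_mval \<Psi> q" "GL_mval \<Phi> q"
  shows "GL_mval (\<lambda>f \<phi>. \<Psi> f \<phi> - c * \<Phi> f \<phi>) q"
proof -
  interpret A: GL_mval \<Psi> q by fact
  interpret B: GL_mval \<Phi> q by fact
  show ?thesis
  proof
    show "is_mval (\<lambda>f \<phi>. \<Psi> f \<phi> - c * \<Phi> f \<phi>)"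
      unfolding is_mval_def radon_functional_def
    proof (intro ballI conjI allI impI)
      fix f :: "real^'n \<Rightarrow> real" assume f: "f \<in> Conv"
      interpret LA: radon "\<Psi> f" by (rule A.radon[OF f])
      interpret LB: radon "\<Phi> f" by (rule B.radon[OF f])
      fix \<phi> \<psi> :: "real^'n \<Rightarrow> complex"
      show "\<Psi> f (\<lambda>x. \<phi> x + \<psi> x) - c * \<Phi> f (\<lambda>x. \<phi> x + \<psi> x) = \<Psi> f \<phi> - c * \<Phi> f \<phi> + (\<Psi> f \<psi> - c * \<Phi> f \<psi>)"
        if "Cc \<phi>" "Cc \<psi>" using LA.add[OF that] LB.add[OF that] by (simp add: algebra_simps)
      show "\<Psi> f (\<lambda>x. r * \<phi> x) - c * \<Phi> f (\<lambda>x. r * \<phi> x) = r * (\<Psi> f \<phi> - c * \<Phi> f \<phi>)" if "Cc \<phi>" for r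
        using LA.cmult[OF that] LB.cmult[OF that] by (simp add: algebra_simps)
      fix K :: "(real^'n) set" assume K: "compact K"
      obtain C where C: "\<And>\<phi> B. Cc \<phi> \<Longrightarrow> tsupp \<phi> \<subseteq> K \<Longrightarrow> (\<And>x. norm (\<phi> x) \<le> B) \<Longrightarrow> norm (\<Psi> f \<phi>) \<le> C * B"
        using LA.bound[OF K] by blast
      obtain D where D: "\<And>\<phi> B. Cc \<phi> \<Longrightarrow> tsupp \<phi> \<subseteq> K \<Longrightarrow> (\<And>x. norm (\<phi> x) \<le> B) \<Longrightarrow> norm (\<Phi> f \<phi>) \<le> D * B"
        using LB.bound[OF K] by blast
      show "\<exists>C. \<forall>\<phi>. Cc \<phi> \<longrightarrow> tsupp \<phi> \<subseteq> K \<longrightarrow> norm (\<Psi> f \<phi> - c * \<Phi> f \<phi>) \<le> C * (SUP x. norm (\<phi> x))"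
      proof (intro exI[of _ "C + norm c * D"] allI impI)
        fix \<phi> :: "real^'n \<Rightarrow> complex" assume \<phi>: "Cc \<phi>" "tsupp \<phi> \<subseteq> K"
        let ?B = "SUP x. norm (\<phi> x)"
        have "norm (\<Psi> f \<phi> - c * \<Phi> f \<phi>) \<le> norm (\<Psi> f \<phi>) + norm c * norm (\<Phi> f \<phi>)"
          using norm_triangle_ineq4[of "\<Psi> f \<phi>" "c * \<Phi> f \<phi>"] by (simp add: norm_mult)
        also have "\<dots> \<le> C * ?B + norm c * (D * ?B)"
          using C[OF \<phi> Cc_bounded[OF \<phi>(1)]] D[OF \<phi> Cc_bounded[OF \<phi>(1)]]
          by (intro add_mono mult_left_mono) auto
        finally show "norm (\<Psi> f \<phi> - c * \<Phi> f \<phi>) \<le> (C + norm c * D) * ?B" by (simp add: algebra_simps)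
      qed
    qed
    show "mval_continuous (\<lambda>f \<phi>. \<Psi> f \<phi> - c * \<Phi> f \<phi>)"
      unfolding mval_continuous_def
    proof (intro allI impI)
      fix fs and f :: "real^'n \<Rightarrow> real" and \<phi> :: "real^'n \<Rightarrow> complex"
      assume *: "\<forall>j. fs j \<in> Conv" "f \<in> Conv" "loc_unif_conv fs f" "Cc \<phi>"
      show "(\<lambda>j. \<Psi> (fs j) \<phi> - c * \<Phi> (fs j) \<phi>) \<longlonglongrightarrow> \<Psi> f \<phi> - c * \<Phi> f \<phi>"
        using A.continuous[unfolded mval_continuous_def, rule_format, OF *(1)[rule_format] *(2-4)]
          B.continuous[unfolded mval_continuous_def, rule_format, OF *(1)[rule_format] *(2-4)]
        by (intro tendsto_intros)
    qed
    show "dually_epi_translation_invariant (\<lambda>f \<phi>. \<Psi> f \<phi> - c * \<Phi> f \<phi>)"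
      unfolding dually_epi_translation_invariant_def
    proof (intro ballI allI impI)
      fix f :: "real^'n \<Rightarrow> real" and y r and \<phi> :: "real^'n \<Rightarrow> complex" assume *: "f \<in> Conv" "Cc \<phi>"
      show "\<Psi> (\<lambda>x. f x + y \<bullet> x + r) \<phi> - c * \<Phi> (\<lambda>x. f x + y \<bullet> x + r) \<phi> = \<Psi> f \<phi> - c * \<Phi> f \<phi>"
        using A.epi_apply[OF *] B.epi_apply[OF *] by simp
    qed
    show "locally_determined (\<lambda>f \<phi>. \<Psi> f \<phi> - c * \<Phi> f \<phi>)"
      unfolding locally_determined_def
    proof (intro ballI allI impI)
      fix f h :: "real^'n \<Rightarrow> real" and U and \<phi> :: "real^'n \<Rightarrow> complex"
      assume *: "f \<in> Conv" "h \<in> Conv" "open U" "\<forall>x\<in>U. f x = h x" "Cc \<phi>" "tsupp \<phi> \<subseteq> U"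
      have "\<Psi> f \<phi> = \<Psi> h \<phi>" "\<Phi> f \<phi> = \<Phi> h \<phi>"
        using A.local[unfolded locally_determined_def, rule_format, OF *(1-3) _ *(5,6)]
          B.local[unfolded locally_determined_def, rule_format, OF *(1-3) _ *(5,6)] *(4) by auto
      then show "\<Psi> f \<phi> - c * \<Phi> f \<phi> = \<Psi> h \<phi> - c * \<Phi> h \<phi>" by simp
    qed
    show "translation_equivariant (\<lambda>f \<phi>. \<Psi> f \<phi> - c * \<Phi> f \<phi>)"
      unfolding translation_equivariant_def
    proof (intro ballI allI impI)
      fix f :: "real^'n \<Rightarrow> real" and z and \<phi> :: "real^'n \<Rightarrow> complex" assume *: "f \<in> Conv" "Cc \<phi>"
      show "\<Psi> (\<lambda>x. f (x - z)) \<phi> - c * \<Phi> (\<lambda>x. f (x - z)) \<phi> = \<Psi> f (\<lambda>x. \<phi> (x + z)) - c * \<Phi> f (\<lambda>x. \<phi> (x + z))"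
        using A.translation[unfolded translation_equivariant_def, rule_format, OF *, of z]
          B.translation[unfolded translation_equivariant_def, rule_format, OF *, of z] by simp
    qed
    show "GL_equivariant q (\<lambda>f \<phi>. \<Psi> f \<phi> - c * \<Phi> f \<phi>)"
      unfolding GL_equivariant_def GL_act_def
    proof (intro ballI allI impI)
      fix g :: "real^'n^'n" and f :: "real^'n \<Rightarrow> real" and \<phi> :: "real^'n \<Rightarrow> complex"
      assume *: "invertible g" "f \<in> Conv" "Cc \<phi>"
      show "\<Psi> (\<lambda>x. f (g *v x)) (\<lambda>x. \<phi> (g *v x)) - c * \<Phi> (\<lambda>x. f (g *v x)) (\<lambda>x. \<phi> (g *v x))
          = complex_of_real (\<bar>det g\<bar> powr q) * (\<Psi> f \<phi> - c * \<Phi> f \<phi>)"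
        using A.GL_apply[OF *] B.GL_apply[OF *] by (simp add: algebra_simps)
    qed
  qed
qed

text \<open>The constant is the ratio of the two point masses on the full simplex function; on
  proper index sets both functionals vanish already.\<close>

lemma monge_ampere_multiple:
  fixes \<Psi> :: "'n::finite mval"
  assumes "GL_mval \<Psi> 1" and a: "\<And>\<phi>. Cc \<phi> \<Longrightarrow> \<Psi> (simplex_fn UNIV) \<phi> = a * \<phi> 0"
  obtains c where "\<And>f \<phi>. f \<in> Conv \<Longrightarrow> Cc \<phi> \<Longrightarrow> \<Psi> f \<phi> = c * ma f \<phi>"
proof -
  interpret M: GL_mval "ma :: 'n mval" 1 by (rule GL_mval_ma)
  obtain b where b: "\<And>\<phi>. Cc \<phi> \<Longrightarrow> ma (simplex_fn (UNIV :: 'n set)) \<phi> = b * \<phi> 0"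
    by (rule M.simplex_point_mass) (simp, rule that)
  have "b \<noteq> 0" using ma_simplex_nonzero[where 'n='n] b by (elim exE conjE) auto
  interpret D: GL_mval "\<lambda>f \<phi>. \<Psi> f \<phi> - (a / b) * ma f \<phi>" 1
    by (rule GL_mval_diff[OF assms(1) GL_mval_ma])
  have "D.vanish (simplex_fn J)" for J
  proof (cases "J = UNIV")
    case True
    then show ?thesis unfolding D.vanish_def using a b \<open>b \<noteq> 0\<close> by simp
  qed (rule D.vanish_simplex_pos_weight, simp)
  then have "\<Psi> f \<phi> - (a / b) * ma f \<phi> = 0" if "f \<in> Conv" "Cc \<phi>" for f \<phi>
    using D.vanish_all[OF _ that(1)] that(2) unfolding D.vanish_def by simp
  then show ?thesis by (intro that[of "a / b"]) simp
qed

text \<open>The second assumption excludes the zero functional, which is equivariant with every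
  weight.\<close>

theorem theorem5p6:
  fixes \<Psi> :: "'n::finite mval" and k :: nat and q :: real
  assumes "\<Psi> \<in> MAVal k"
    and "\<exists>f\<in>Conv. \<exists>\<phi>. Cc \<phi> \<and> \<Psi> f \<phi> \<noteq> 0"
  shows "GL_equivariant q \<Psi> \<longleftrightarrow>
     ((k = 0 \<and> q = -1 \<and>
        (\<exists>c::complex. \<forall>f\<in>Conv. \<forall>\<phi>. Cc \<phi> \<longrightarrow> \<Psi> f \<phi> = c * (LINT x|lborel. \<phi> x))) \<or>
      (k = CARD('n) \<and> q = 1 \<and>
        (\<exists>c::complex. \<forall>f\<in>Conv. \<forall>\<phi>. Cc \<phi> \<longrightarrow> \<Psi> f \<phi> = c * (LINT x|monge_ampere f. \<phi> x))))"
    (is "_ \<longleftrightarrow> ?leb \<or> ?ma")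
proof
  assume GL: "GL_equivariant q \<Psi>"
  have mv: "mval_valuation \<Psi>" and hom: "homogeneous k \<Psi>" using assms(1) by (auto simp: MAVal_def)
  interpret GL_mval \<Psi> q using assms(1) GL unfolding MAVal_def GL_mval_def by simp
  obtain f0 \<phi>0 where nz: "f0 \<in> Conv" "Cc \<phi>0" "\<Psi> f0 \<phi>0 \<noteq> 0" using assms(2) by (elim bexE exE conjE)
  have nv: "\<exists>J. \<not> vanish (simplex_fn J)"
  proof (rule ccontr)
    assume "\<nexists>J. \<not> vanish (simplex_fn J)"
    then have "vanish (simplex_fn J)" for J by simp
    then have "vanish f0" by (rule vanish_all[OF _ nz(1)])
    then show False using nz(2,3) by (simp add: vanish_def)
  qed
  show "?leb \<or> ?ma"
  proof (cases "k = 0")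
    case True
    have hom0: "homogeneous 0 \<Psi>" using hom True by simp
    obtain c where c: "\<And>f \<phi>. f \<in> Conv \<Longrightarrow> Cc \<phi> \<Longrightarrow> \<Psi> f \<phi> = c * (LINT x|lborel. \<phi> x)"
      by (rule lebesgue_of_degree_zero[OF hom0]) (rule that)
    have "q = -1" by (rule weight_minus_one[OF c nz])
    then show ?thesis using True c by (intro disjI1 conjI exI[of _ c] ballI allI impI)
  next
    case False
    have q: "q > 0"
    proof (rule ccontr)
      assume "\<not> q > 0"
      then have "vanish (simplex_fn J)" for J using False by (intro vanish_simplex_nonpos_weight[OF hom]) auto
      then show False using nv by simp
    qed
    obtain a where a: "\<And>\<phi>. Cc \<phi> \<Longrightarrow> \<Psi> (simplex_fn UNIV) \<phi> = a * \<phi> 0"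
      by (rule simplex_point_mass[OF q]) (rule that)
    have a0: "a \<noteq> 0"
    proof
      assume "a = 0"
      then have "vanish (simplex_fn UNIV)" using a by (simp add: vanish_def)
      then have "vanish (simplex_fn J)" for J by (cases "J = UNIV") (auto intro: vanish_simplex_pos_weight[OF q])
      then show False using nv by simp
    qed
    have q1: "q = 1" by (rule weight_one[OF q mv a a0])
    have GL1: "GL_mval \<Psi> 1" using GL_mval_axioms q1 by simp
    obtain c where c: "\<And>f \<phi>. f \<in> Conv \<Longrightarrow> Cc \<phi> \<Longrightarrow> \<Psi> f \<phi> = c * ma f \<phi>"
      by (rule monge_ampere_multiple[OF GL1]) (rule a, assumption, rule that)
    have "\<Psi> f \<phi> = c * (LINT x|monge_ampere f. \<phi> x)" if "f \<in> Conv" "Cc \<phi>" for f \<phi>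
      unfolding integral_monge_ampere[OF that] by (rule c[OF that])
    then show ?thesis
      using degree_eq_dimension[OF hom q1 a a0] q1 by (intro disjI2 conjI exI[of _ c] ballI allI impI)
  qed
next
  assume "?leb \<or> ?ma"
  then show "GL_equivariant q \<Psi>"
  proof (elim disjE conjE exE)
    fix c assume q: "q = -1" and c: "\<forall>f\<in>Conv. \<forall>\<phi>. Cc \<phi> \<longrightarrow> \<Psi> f \<phi> = c * (LINT x|lborel. \<phi> x)"
    show ?thesis
      unfolding GL_equivariant_def GL_act_def
    proof (intro ballI allI impI)
      fix g :: "real^'n^'n" and f :: "real^'n \<Rightarrow> real" and \<phi> :: "real^'n \<Rightarrow> complex"
      assume *: "invertible g" "f \<in> Conv" "Cc \<phi>"
      have "\<Psi> (\<lambda>x. f (g *v x)) (\<lambda>x. \<phi> (g *v x)) = c * (LINT x|lborel. \<phi> (g *v x))"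
        by (rule c[rule_format, OF Conv_matrix[OF *(2)] Cc_matrix[OF *(3,1)]])
      also have "\<dots> = complex_of_real (inverse \<bar>det g\<bar>) * \<Psi> f \<phi>"
        using lborel_integral_matrix[OF *(1) Cc_borel_measurable[OF *(3)]] c[rule_format, OF *(2,3)] by simp
      also have "inverse \<bar>det g\<bar> = \<bar>det g\<bar> powr q" unfolding q by (simp add: powr_minus)
      finally show "\<Psi> (\<lambda>x. f (g *v x)) (\<lambda>x. \<phi> (g *v x)) = complex_of_real (\<bar>det g\<bar> powr q) * \<Psi> f \<phi>" .
    qed
  next
    fix c assume q: "q = 1" and c: "\<forall>f\<in>Conv. \<forall>\<phi>. Cc \<phi> \<longrightarrow> \<Psi> f \<phi> = c * (LINT x|monge_ampere f. \<phi> x)"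
    interpret M: GL_mval "ma :: 'n mval" 1 by (rule GL_mval_ma)
    have c': "\<Psi> f \<phi> = c * ma f \<phi>" if "f \<in> Conv" "Cc \<phi>" for f \<phi>
      using c[rule_format, OF that] unfolding integral_monge_ampere[OF that] .
    show ?thesis
      unfolding GL_equivariant_def GL_act_def
    proof (intro ballI allI impI)
      fix g :: "real^'n^'n" and f :: "real^'n \<Rightarrow> real" and \<phi> :: "real^'n \<Rightarrow> complex"
      assume *: "invertible g" "f \<in> Conv" "Cc \<phi>"
      show "\<Psi> (\<lambda>x. f (g *v x)) (\<lambda>x. \<phi> (g *v x)) = complex_of_real (\<bar>det g\<bar> powr q) * \<Psi> f \<phi>"
        using c'[OF Conv_matrix[OF *(2)] Cc_matrix[OF *(3,1)]] c'[OF *(2,3)] M.GL_apply[OF *] q by simp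
    qed
  qed
qed

end
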